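(* Let $1<\alpha<2$, $0\le r\le 1$, let $\beta\in[\alpha-1,1]$ be determined by $r=\frac{\sin(\pi\beta)}{\sin(\pi(\alpha-\beta))+\sin(\pi\beta)}$, let $0<K_m\le K(x)\le K_M<\infty$ on $(0,1)$, and let $s\in\mathbb N_0=\mathbb N\cup\{0\}$. For $f\in H^s_{\omega^{(\beta,\alpha-\beta)}}(0,1)$ and $1/K\in W^{s+1}_\infty(0,1)$, let $u$ be the solution of $$L_r^\alpha u(x)=f_1(x)-A f_2(x),\quad x\in(0,1),\qquad u(0)=u(1)=0,$$ where $f_1(x)=\frac1{K(x)}\int_0^xf(y)\,dy$ and $f_2(x)=\frac1{K(x)}$, and let $u_N$ be its spectral approximation (defined in the context). Then there exists $C>0$, independent of $N$, such that $$\|u-u_N\|_{\omega^{(-(\alpha-\beta),-\beta)}}\le\frac{C\,\|1/K\|_{W^{s+1}_\infty}}{(N+1)^{\alpha+s}}\big(\|f\|_{s,\omega^{(\beta,\alpha-\beta)}}+1\big).$$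
   Context: Weights and spaces: $\omega^{(a,b)}(x)=(1-x)^a x^b$ on $(0,1)$; $(g,h)_\omega=\int_0^1\omega\,g\,h\,dx$, $\|g\|_\omega=(g,g)_\omega^{1/2}$, $L^2_\omega(0,1)=\{g:\|g\|_\omega<\infty\}$. For $m\in\mathbb N_0$, $H^m_{\omega^{(a,b)}}(0,1)=\{v:\|v\|_{m,\omega^{(a,b)}}^2=\sum_{j=0}^m\|D^jv\|_{\omega^{(a+j,b+j)}}^2<\infty\}$. $W^m_\infty$ is the standard Sobolev space on $(0,1)$ with its norm. Fractional integrals for $0<\sigma<1$: ${}_0I_x^\sigma w(x)=\frac1{\Gamma(\sigma)}\int_0^x w(s)(x-s)^{\sigma-1}ds$ and ${}_xI_1^\sigma w(x)=\frac1{\Gamma(\sigma)}\int_x^1 w(s)(s-x)^{\sigma-1}ds$. $D$ is the first derivative. Operator: $L_r^\alpha u=-\big(r\,{}_0I_x^{2-\alpha}+(1-r)\,{}_xI_1^{2-\alpha}\big)Du$. In the problem, $A$ is the constant (depending on $u$) $A=K(0)\big[\big(r\,{}_0I_x^{2-\alpha}+(1-r)\,{}_xI_1^{2-\alpha}\big)Du(x)\big]\big|_{x=0}$, which is formally what the equation gives when multiplied by $K$ and evaluated at $x=0$; thus one seeks $u$ together with the constant $A$. Jacobi polynomials on $(0,1)$: $G_n^{(a,b)}(x)=P_n^{(a,b)}(2x-1)$, with $P_n^{(a,b)}$ the standard Jacobi polynomials on $[-1,1]$ (orthogonal for $(1-x)^a(1+x)^b$). Solution and its approximation: the problem has a unique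 solution $u\in L^2_{\omega^{(-(\alpha-\beta),-\beta)}}(0,1)$, namely $$u=\omega^{(\alpha-\beta,\beta)}\sum_{j=0}^\infty c_jG_j^{(\alpha-\beta,\beta)},\qquad c_j=\frac{-f_{1,j+1}+A f_{2,j+1}}{\lambda_j},$$ where $f_{i,j}=\dfrac{(f_i,G_j^{(\beta-1,\alpha-\beta-1)})_{\omega^{(\beta-1,\alpha-\beta-1)}}}{\|G_j^{(\beta-1,\alpha-\beta-1)}\|^2_{\omega^{(\beta-1,\alpha-\beta-1)}}}$ for $i=1,2$, $A=\dfrac{(f_1,1)_{\omega^{(\beta-1,\alpha-\beta-1)}}}{(f_2,1)_{\omega^{(\beta-1,\alpha-\beta-1)}}}$, and $\lambda_j=\dfrac{\sin(\pi\alpha)}{\sin(\pi(\alpha-\beta))+\sin(\pi\beta)}\dfrac{\Gamma(j+\alpha)}{j!}$. The spectral approximation is the truncation $u_N=\omega^{(\alpha-\beta,\beta)}\sum_{j=0}^Nc_jG_j^{(\alpha-\beta,\beta)}$. *)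

theory Defs
  imports "HOL-Analysis.Analysis" "HOL-Probability.Essential_Supremum"
begin

section \<open>Weighted spaces on the unit interval\<close>

definition weight :: "real \<Rightarrow> real \<Rightarrow> real \<Rightarrow> real" where
  "weight a b x = (1 - x) powr a * x powr b"

definition wip :: "real \<Rightarrow> real \<Rightarrow> (real \<Rightarrow> real) \<Rightarrow> (real \<Rightarrow> real) \<Rightarrow> real" where
  "wip a b g h = (LINT x:{0<..<1}|lebesgue. weight a b x * g x * h x)"

definition wnorm :: "real \<Rightarrow> real \<Rightarrow> (real \<Rightarrow> real) \<Rightarrow> real" where
  "wnorm a b g = sqrt (wip a b g g)"

definition wL2 :: "real \<Rightarrow> real \<Rightarrow> (real \<Rightarrow> real) set" where
  "wL2 a b = {g \<in> borel_measurable (lebesgue_on {0<..<1}).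
     set_integrable lebesgue {0<..<1} (\<lambda>x. weight a b x * g x * g x)}"


section \<open>Weak derivatives and Sobolev spaces on the unit interval\<close>

text \<open>Real test functions that are smooth on the line and supported in a compact subset of
  the open unit interval.\<close>

definition test_function :: "(real \<Rightarrow> real) \<Rightarrow> bool" where
  "test_function \<phi> \<longleftrightarrow>
     (\<forall>n x. (deriv ^^ n) \<phi> differentiable (at x)) \<and>
     (\<exists>a b. 0 < a \<and> b < 1 \<and> (\<forall>x. x \<notin> {a..b} \<longrightarrow> \<phi> x = 0))"

definition locally_integrable :: "(real \<Rightarrow> real) \<Rightarrow> bool" where
  "locally_integrable g \<longleftrightarrow> (\<forall>a b. 0 < a \<and> b < 1 \<longrightarrow> set_integrable lebesgue {a..b} g)"

definition has_weak_deriv :: "nat \<Rightarrow> (real \<Rightarrow> real) \<Rightarrow> (real \<Rightarrow> real) \<Rightarrow> bool" where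
  "has_weak_deriv j g h \<longleftrightarrow> locally_integrable g \<and> locally_integrable h \<and>
     (\<forall>\<phi>. test_function \<phi> \<longrightarrow>
        (LINT x:{0<..<1}|lebesgue. g x * (deriv ^^ j) \<phi> x) =
        (-1) ^ j * (LINT x:{0<..<1}|lebesgue. h x * \<phi> x))"

text \<open>A weak derivative is unique only up to a null set. All uses below are insensitive to the
  choice of representative.\<close>

definition weak_deriv :: "nat \<Rightarrow> (real \<Rightarrow> real) \<Rightarrow> real \<Rightarrow> real" where
  "weak_deriv j g = (SOME h. has_weak_deriv j g h)"

definition wH :: "nat \<Rightarrow> real \<Rightarrow> real \<Rightarrow> (real \<Rightarrow> real) set" where
  "wH m a b = {v. \<forall>j\<le>m. \<exists>h. has_weak_deriv j v h \<and> h \<in> wL2 (a + real j) (b + real j)}"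

definition wH_norm :: "nat \<Rightarrow> real \<Rightarrow> real \<Rightarrow> (real \<Rightarrow> real) \<Rightarrow> real" where
  "wH_norm m a b v = sqrt (\<Sum>j\<le>m. (wnorm (a + real j) (b + real j) (weak_deriv j v))\<^sup>2)"

definition Linf_norm :: "(real \<Rightarrow> real) \<Rightarrow> ereal" where
  "Linf_norm g = esssup (lebesgue_on {0<..<1}) (\<lambda>x. ereal \<bar>g x\<bar>)"

definition W_inf :: "nat \<Rightarrow> (real \<Rightarrow> real) set" where
  "W_inf m = {v. \<forall>j\<le>m. \<exists>h. has_weak_deriv j v h \<and> Linf_norm h < \<infinity>}"

definition W_inf_norm :: "nat \<Rightarrow> (real \<Rightarrow> real) \<Rightarrow> real" where
  "W_inf_norm m v = (MAX j\<in>{..m}. real_of_ereal (Linf_norm (weak_deriv j v)))"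


section \<open>The fractional diffusion problem\<close>

definition frac_int_left :: "real \<Rightarrow> (real \<Rightarrow> real) \<Rightarrow> real \<Rightarrow> real" where
  "frac_int_left \<sigma> w x =
     1 / Gamma \<sigma> * (LINT s:{0<..<x}|lebesgue. w s * (x - s) powr (\<sigma> - 1))"

definition frac_int_right :: "real \<Rightarrow> (real \<Rightarrow> real) \<Rightarrow> real \<Rightarrow> real" where
  "frac_int_right \<sigma> w x =
     1 / Gamma \<sigma> * (LINT s:{x<..<1}|lebesgue. w s * (s - x) powr (\<sigma> - 1))"

definition frac_op :: "real \<Rightarrow> real \<Rightarrow> (real \<Rightarrow> real) \<Rightarrow> real \<Rightarrow> real" where
  "frac_op \<alpha> r u x =
     - (r * frac_int_left (2 - \<alpha>) (weak_deriv 1 u) x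
        + (1 - r) * frac_int_right (2 - \<alpha>) (weak_deriv 1 u) x)"

definition rhs1 :: "(real \<Rightarrow> real) \<Rightarrow> (real \<Rightarrow> real) \<Rightarrow> real \<Rightarrow> real" where
  "rhs1 K f x = 1 / K x * (LINT y:{0<..<x}|lebesgue. f y)"

definition rhs2 :: "(real \<Rightarrow> real) \<Rightarrow> real \<Rightarrow> real" where
  "rhs2 K x = 1 / K x"

text \<open>The unknown is the pair of u and the constant A. The function u is continuous up to the
  boundary with an integrable weak derivative, so that it is absolutely continuous and the
  fractional integrals of its derivative exist almost everywhere. The equation multiplied by K says
  that K times the flux, which is the negative of the fractional operator, equals A minus the
  integral of f from 0 to x, so the description of A as the value at 0 of K times the flux is
  part of the equation and is not a separate condition.\<close>

definition is_solution ::
  "real \<Rightarrow> real \<Rightarrow> real \<Rightarrow> (real \<Rightarrow> real) \<Rightarrow> (real \<Rightarrow> real) \<Rightarrow> (real \<Rightarrow> real) \<Rightarrow> real \<Rightarrow> bool" where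
  "is_solution \<alpha> \<beta> r K f u A \<longleftrightarrow>
     u \<in> wL2 (- (\<alpha> - \<beta>)) (- \<beta>) \<and>
     continuous_on {0..1} u \<and> u 0 = 0 \<and> u 1 = 0 \<and>
     (\<exists>h. has_weak_deriv 1 u h \<and> set_integrable lebesgue {0<..<1} h) \<and>
     (AE x in lebesgue_on {0<..<1}. frac_op \<alpha> r u x = rhs1 K f x - A * rhs2 K x)"


section \<open>The spectral approximation\<close>

text \<open>The Jacobi polynomials in the standard normalization, on the interval from -1 to 1.\<close>

definition jacobi_P :: "nat \<Rightarrow> real \<Rightarrow> real \<Rightarrow> real \<Rightarrow> real" where
  "jacobi_P n a b t =
     (\<Sum>k\<le>n. ((real n + a) gchoose (n - k)) * ((real n + b) gchoose k)
              * ((t - 1) / 2) ^ k * ((t + 1) / 2) ^ (n - k))"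

definition jacobi_G :: "nat \<Rightarrow> real \<Rightarrow> real \<Rightarrow> real \<Rightarrow> real" where
  "jacobi_G n a b x = jacobi_P n a b (2 * x - 1)"

definition jacobi_coeff :: "real \<Rightarrow> real \<Rightarrow> (real \<Rightarrow> real) \<Rightarrow> nat \<Rightarrow> real" where
  "jacobi_coeff \<alpha> \<beta> g j =
     wip (\<beta> - 1) (\<alpha> - \<beta> - 1) g (jacobi_G j (\<beta> - 1) (\<alpha> - \<beta> - 1))
     / (wnorm (\<beta> - 1) (\<alpha> - \<beta> - 1) (jacobi_G j (\<beta> - 1) (\<alpha> - \<beta> - 1)))\<^sup>2"

definition const_A :: "real \<Rightarrow> real \<Rightarrow> (real \<Rightarrow> real) \<Rightarrow> (real \<Rightarrow> real) \<Rightarrow> real" where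
  "const_A \<alpha> \<beta> K f =
     wip (\<beta> - 1) (\<alpha> - \<beta> - 1) (rhs1 K f) (\<lambda>_. 1)
     / wip (\<beta> - 1) (\<alpha> - \<beta> - 1) (rhs2 K) (\<lambda>_. 1)"

definition eigenval :: "real \<Rightarrow> real \<Rightarrow> nat \<Rightarrow> real" where
  "eigenval \<alpha> \<beta> j =
     sin (pi * \<alpha>) / (sin (pi * (\<alpha> - \<beta>)) + sin (pi * \<beta>)) * (Gamma (real j + \<alpha>) / fact j)"

definition sol_coeff :: "real \<Rightarrow> real \<Rightarrow> (real \<Rightarrow> real) \<Rightarrow> (real \<Rightarrow> real) \<Rightarrow> nat \<Rightarrow> real" where
  "sol_coeff \<alpha> \<beta> K f j =
     (- jacobi_coeff \<alpha> \<beta> (rhs1 K f) (j + 1)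
      + const_A \<alpha> \<beta> K f * jacobi_coeff \<alpha> \<beta> (rhs2 K) (j + 1)) / eigenval \<alpha> \<beta> j"

definition spectral_approx ::
  "real \<Rightarrow> real \<Rightarrow> (real \<Rightarrow> real) \<Rightarrow> (real \<Rightarrow> real) \<Rightarrow> nat \<Rightarrow> real \<Rightarrow> real" where
  "spectral_approx \<alpha> \<beta> K f N x =
     weight (\<alpha> - \<beta>) \<beta> x * (\<Sum>j\<le>N. sol_coeff \<alpha> \<beta> K f j * jacobi_G j (\<alpha> - \<beta>) \<beta> x)"

end

theory Submission
  imports Defs
begin

text \<open>
  Write \<open>p = \<alpha> - \<beta> - 1\<close>, \<open>q = \<beta> - 1\<close> and \<open>\<omega> = weight (\<alpha> - \<beta>) \<beta>\<close>. The idea is that the fractional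
  operator is diagonal in Jacobi polynomials, so that \<open>spectral_approx\<close> is the truncated orthogonal
  expansion of \<open>u / \<omega>\<close> times \<open>\<omega>\<close>, and that the smoothness of the right-hand side makes its Jacobi
  coefficients small.

  Diagonalization. Since \<open>u\<close> is a primitive of an integrable function \<open>h\<close>, the operator is, up to a
  constant, the integral of \<open>h\<close> against a two-sided Riesz kernel of exponent \<open>-1 - p - q = 1 - \<alpha>\<close> with
  different constants on the two sides of the diagonal (\<open>frac_op_riesz\<close>). The kernel transports
  \<open>weight q p\<close> times a polynomial to a polynomial of the same degree. For the constant polynomial
  this is the identity \<open>riesz_integral\<close>, whose value \<open>\<pi>\<close> does not depend on the point, and the
  higher moments follow from a three-term recurrence obtained by integrating total derivatives
  (\<open>riesz_integral_power\<close>). Exchanging the two arguments of the kernel amounts to exchanging \<open>p\<close> and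
  \<open>q\<close>. Hence the transport is adjoint to the one with \<open>p\<close> and \<open>q\<close> exchanged, it preserves
  orthogonality to polynomials of lower degree, and it maps the Jacobi polynomials for \<open>weight q p\<close>
  to multiples of those for \<open>weight p q\<close> (\<open>riesz_image_jacobi\<close>).

  Coefficients. The equation is multiplied by \<open>weight q p\<close> times a polynomial and integrated. Fubini
  moves the kernel onto the polynomial, and integration by parts replaces \<open>h\<close> by \<open>u\<close> and the polynomial
  by its derivative (\<open>solution_moment\<close>). The constant polynomial forces \<open>A = const_A\<close>. The Jacobi
  polynomial of degree \<open>j + 1\<close> has as its derivative a multiple of the one of degree \<open>j\<close> for \<open>\<omega>\<close>,
  and this identifies \<open>sol_coeff\<close> with the Jacobi coefficient of \<open>u / \<omega>\<close> (\<open>sol_coeff_eq_fourier\<close>).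

  Decay. Polynomials are dense, so the squared error is the tail of the squared coefficients
  (\<open>jacobi_error_bound\<close>). The eigenvalues grow like \<open>j\<close> to the power
  \<open>\<alpha> - 1\<close>. The right-hand side is \<open>1 / K\<close> times a primitive of
  \<open>f\<close>, shifted by a constant. Thus it has \<open>s + 1\<close> derivatives in the weighted
  spaces; each of them can be moved by the Rodrigues formula and gains one power of the degree, and Bessel's
  inequality sums up what is left (\<open>coefficient_decay\<close>). Altogether the gain is
  \<open>(\<alpha> - 1) + (s + 1)\<close> powers. The factor of this rate depends on \<open>f\<close>,
  \<open>K\<close> and \<open>u\<close> but not on \<open>N\<close>. As \<open>1 / K\<close> is bounded away
  from zero, its norm is positive and can be divided out of that factor.
\<close>

section \<open>Smooth bump functions and the fundamental lemma of the calculus of variations\<close>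

text \<open>Smoothness by coinduction: a class of functions that is closed under differentiation
  consists of smooth functions. It replaces explicit formulas for the iterated derivatives.\<close>

lemma smooth_coinduct:
  fixes f :: "real \<Rightarrow> real"
  assumes f: "P f"
    and step: "\<And>g. P g \<Longrightarrow> \<exists>g'. P g' \<and> (\<forall>x. (g has_real_derivative g' x) (at x))"
  shows "(deriv ^^ n) f differentiable (at x)"
proof -
  have D: "P (deriv g) \<and> (\<forall>x. g differentiable (at x))" if Pg: "P g" for g
  proof -
    obtain g' where g': "P g'" "\<And>x. (g has_real_derivative g' x) (at x)"
      using step[OF Pg] by blast
    then have "deriv g = g'" by (intro ext DERIV_imp_deriv)
    then show ?thesis using g' by (auto simp: real_differentiable_def)
  qed
  have "P ((deriv ^^ n) f)" by (induction n) (use f D in auto)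
  then show ?thesis using D by blast
qed

text \<open>The exponent \<open>m\<close> makes the family closed under differentiation up to linear
  combinations. The parameter \<open>e\<close> controls the steepness; for \<open>e\<close> tending to 0
  and \<open>m = 0\<close> the function tends to the indicator of the positive half-line.\<close>

definition flat :: "real \<Rightarrow> nat \<Rightarrow> real \<Rightarrow> real" where
  "flat e m y = (if y > 0 then exp (- e / y) / y ^ m else 0)"

text \<open>With \<open>1 / y\<close> as variable this is the dominance of the exponential over
  powers. With \<open>m + 1\<close> for \<open>m\<close> it concerns the difference quotients of the
  flat function at 0.\<close>

lemma flat_tendsto_0:
  assumes "e > 0" shows "(flat e m \<longlongrightarrow> 0) (at 0)"
proof -
  have "((\<lambda>y. exp (- (e * y)) * y ^ m) \<longlongrightarrow> 0) at_top"
  proof -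
    have "((\<lambda>y. (e*y) ^ m / exp (e * y)) \<longlongrightarrow> 0) at_top"
      by (rule filterlim_compose[OF tendsto_power_div_exp_0])
        (use assms in \<open>auto intro!: filterlim_tendsto_pos_mult_at_top filterlim_ident tendsto_const\<close>)
    from tendsto_mult_right[OF this, of "1 / e ^ m"] show ?thesis
      using assms by (simp add: exp_minus field_simps power_mult_distrib)
  qed
  then have "((\<lambda>y. exp (- (e * inverse y)) * inverse y ^ m) \<longlongrightarrow> 0) (at_right 0)"
    by (rule filterlim_compose[OF _ filterlim_inverse_at_top_right])
  then have R: "(flat e m \<longlongrightarrow> 0) (at_right 0)"
    by (rule Lim_transform_eventually)
      (auto simp: flat_def eventually_at_filter field_simps)
  have L: "(flat e m \<longlongrightarrow> 0) (at_left 0)"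
    by (rule tendsto_eventually) (auto simp: flat_def eventually_at_filter)
  show ?thesis using L R by (simp add: filterlim_at_split)
qed

lemma flat_deriv:
  assumes e: "e > 0"
  shows "(flat e m has_real_derivative (e * flat e (m + 2) y - real m * flat e (m + 1) y)) (at y)"
proof -
  consider "y > 0" | "y < 0" | "y = 0" by linarith
  then show ?thesis
  proof cases
    case 1
    have "((\<lambda>y. exp (- e / y) / y ^ m) has_real_derivative
            (e * flat e (m + 2) y - real m * flat e (m + 1) y)) (at y)"
    proof (cases m)
      case (Suc k)
      show ?thesis using 1 unfolding Suc
        by (auto intro!: derivative_eq_intros simp: flat_def field_simps power2_eq_square power_Suc
            simp del: power_Suc2 split: nat.splits) (cases k; simp add: field_simps)
    qed (use 1 in \<open>auto intro!: derivative_eq_intros simp: flat_def field_simps power2_eq_square\<close>)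
    then show ?thesis
      by (rule has_field_derivative_transform_within_open[of _ _ _ "{0<..}"])
        (use 1 in \<open>auto simp: flat_def\<close>)
  next
    case 2
    have "((\<lambda>y. 0) has_real_derivative 0) (at y)" by simp
    then have "(flat e m has_real_derivative 0) (at y)"
      by (rule has_field_derivative_transform_within_open[of _ _ _ "{..<0}"])
        (use 2 in \<open>auto simp: flat_def\<close>)
    then show ?thesis using 2 by (simp add: flat_def)
  next
    case 3
    have "((\<lambda>h. (flat e m (0 + h) - flat e m 0) / h) \<longlongrightarrow> 0) (at 0)"
      by (rule Lim_transform_eventually[OF flat_tendsto_0[OF e, of "m + 1"]])
        (auto simp: flat_def eventually_at_filter)
    then have "(flat e m has_real_derivative 0) (at 0)"
      unfolding has_field_derivative_def by (simp add: has_field_derivative_def[symmetric] DERIV_def)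
    then show ?thesis using 3 by (simp add: flat_def)
  qed
qed

text \<open>The linear span of the products of two flat functions. It is invariant under
  differentiation, which is what \<open>smooth_coinduct\<close> asks for.\<close>

inductive bump_span :: "real \<Rightarrow> real \<Rightarrow> real \<Rightarrow> (real \<Rightarrow> real) \<Rightarrow> bool" for e a b where
  bump: "bump_span e a b (\<lambda>x. c * (flat e m (x - a) * flat e n (b - x)))"
| add: "bump_span e a b f \<Longrightarrow> bump_span e a b g \<Longrightarrow> bump_span e a b (\<lambda>x. f x + g x)"

lemma bump_span_deriv:
  assumes "e > 0" "bump_span e a b f"
  shows "\<exists>f'. bump_span e a b f' \<and> (\<forall>x. (f has_real_derivative f' x) (at x))"
  using assms(2)
proof induction
  case (bump c m n)
  let ?F = "\<lambda>c m n x. c * (flat e m (x - a) * flat e n (b - x))"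
  let ?f' = "\<lambda>x. (?F (c * e) (m + 2) n x + ?F (- c * real m) (m + 1) n x)
    + (?F (- c * e) m (n + 2) x + ?F (c * real n) m (n + 1) x)"
  have "bump_span e a b ?f'" by (intro bump_span.intros)
  moreover have "(?F c m n has_real_derivative ?f' x) (at x)" for x
  proof -
    have 1: "((\<lambda>x. flat e m (x - a)) has_real_derivative
       (e * flat e (m + 2) (x - a) - real m * flat e (m + 1) (x - a)) * 1) (at x)"
      by (rule DERIV_chain2[OF flat_deriv[OF assms(1)]]) (auto intro!: derivative_eq_intros)
    have 2: "((\<lambda>x. flat e n (b - x)) has_real_derivative
       (e * flat e (n + 2) (b - x) - real n * flat e (n + 1) (b - x)) * (-1)) (at x)"
      by (rule DERIV_chain2[OF flat_deriv[OF assms(1)]]) (auto intro!: derivative_eq_intros)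
    show ?thesis
      by (rule DERIV_cong[OF DERIV_cmult[OF DERIV_mult[OF 1 2]]]) (simp add: algebra_simps)
  qed
  ultimately show ?case by blast
next
  case (add f g)
  then obtain f' g' where "bump_span e a b f'" "bump_span e a b g'"
    "\<And>x. (f has_real_derivative f' x) (at x)" "\<And>x. (g has_real_derivative g' x) (at x)" by blast
  then show ?case
    by (intro exI[of _ "\<lambda>x. f' x + g' x"]) (auto intro: bump_span.add DERIV_add)
qed

definition bump_fun :: "real \<Rightarrow> real \<Rightarrow> real \<Rightarrow> real \<Rightarrow> real" where
  "bump_fun e a b x = flat e 0 (x - a) * flat e 0 (b - x)"

lemma test_function_bump:
  assumes "e > 0" "0 < a" "b < 1"
  shows "test_function (bump_fun e a b)"
proof -
  have "bump_span e a b (bump_fun e a b)"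
    using bump_span.bump[of e a b 1 0 0] by (simp add: bump_fun_def[abs_def])
  then have "(deriv ^^ n) (bump_fun e a b) differentiable at x" for n x
    by (rule smooth_coinduct[where P = "bump_span e a b"]) (rule bump_span_deriv[OF assms(1)])
  moreover have "bump_fun e a b x = 0" if "x \<notin> {a..b}" for x
    using that by (auto simp: bump_fun_def flat_def)
  ultimately show ?thesis unfolding test_function_def using assms by blast
qed

lemma test_function_linear:
  assumes f: "test_function f" and g: "test_function g"
  shows "test_function (\<lambda>x. f x - c * g x)"
proof -
  let ?P = "\<lambda>h. \<exists>n. h = (\<lambda>x. (deriv ^^ n) f x - c * (deriv ^^ n) g x)"
  have "(deriv ^^ n) (\<lambda>x. f x - c * g x) differentiable (at x)" for n x
  proof (rule smooth_coinduct[where P = ?P])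
    show "?P (\<lambda>x. f x - c * g x)" by (rule exI[of _ 0]) simp
    fix h assume "?P h"
    then obtain n where h: "h = (\<lambda>x. (deriv ^^ n) f x - c * (deriv ^^ n) g x)" by blast
    have "((deriv ^^ n) f has_real_derivative (deriv ^^ Suc n) f x) (at x)"
      "((deriv ^^ n) g has_real_derivative (deriv ^^ Suc n) g x) (at x)" for x
      using f g by (auto simp: test_function_def DERIV_deriv_iff_real_differentiable)
    then have "(h has_real_derivative (deriv ^^ Suc n) f x - c * (deriv ^^ Suc n) g x) (at x)" for x
      unfolding h by (intro DERIV_diff DERIV_cmult)
    then show "\<exists>h'. ?P h' \<and> (\<forall>x. (h has_real_derivative h' x) (at x))"
      by (intro exI[of _ "\<lambda>x. (deriv ^^ Suc n) f x - c * (deriv ^^ Suc n) g x"]) blast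
  qed
  moreover obtain a b where f0: "0 < a" "b < 1" "\<And>x. x \<notin> {a..b} \<Longrightarrow> f x = 0"
    using f unfolding test_function_def by metis
  obtain a' b' where g0: "0 < a'" "b' < 1" "\<And>x. x \<notin> {a'..b'} \<Longrightarrow> g x = 0"
    using g unfolding test_function_def by metis
  have "f x - c * g x = 0" if "x \<notin> {min a a'..max b b'}" for x
  proof -
    have "x \<notin> {a..b}" "x \<notin> {a'..b'}" using that by auto
    then show ?thesis using f0(3) g0(3) by simp
  qed
  moreover have "0 < min a a'" "max b b' < 1" using f0 g0 by auto
  ultimately show ?thesis unfolding test_function_def by blast
qed

lemma test_function_deriv:
  assumes f: "test_function f"
  shows "(f has_real_derivative deriv f x) (at x)" "test_function (deriv f)"
proof -
  obtain a b where ab: "0 < a" "b < 1" "\<And>x. x \<notin> {a..b} \<Longrightarrow> f x = 0"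
    using f unfolding test_function_def by metis
  have "(deriv ^^ n) f differentiable (at x)" for n x
    using f by (auto simp: test_function_def)
  from this[of 0] show "(f has_real_derivative deriv f x) (at x)" for x
    by (simp add: DERIV_deriv_iff_real_differentiable)
  have "deriv f x = 0" if "x \<notin> {a..b}" for x
  proof -
    have "((\<lambda>x. 0) has_real_derivative 0) (at x)" by simp
    then have "(f has_real_derivative 0) (at x)"
      by (rule has_field_derivative_transform_within_open[of _ _ _ "- {a..b}"])
        (use that ab in auto)
    then show ?thesis by (rule DERIV_imp_deriv)
  qed
  moreover have "(deriv ^^ n) (deriv f) differentiable (at x)" for n x
    using f unfolding test_function_def by (metis funpow_Suc_right o_apply)
  ultimately show "test_function (deriv f)"
    unfolding test_function_def using ab by blast
qed

lemma test_function_continuous: "test_function f \<Longrightarrow> continuous_on S f"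
  using test_function_deriv(1) by (blast intro: DERIV_continuous_on DERIV_subset)

lemma test_function_support:
  assumes "test_function f"
  obtains a b where "0 < a" "a < b" "b < 1" "\<And>x. x \<notin> {a<..<b} \<Longrightarrow> f x = 0"
proof -
  obtain a b where ab: "0 < a" "b < 1" "\<And>x. x \<notin> {a..b} \<Longrightarrow> f x = 0"
    using assms unfolding test_function_def by metis
  show ?thesis
  proof (rule that[of "min a (1/2) / 2" "(max b (1/2) + 1) / 2"])
    fix x assume "x \<notin> {min a (1/2) / 2<..<(max b (1/2) + 1) / 2}"
    then have "x \<notin> {a..b}" using ab(1,2) by (auto simp: min_def max_def split: if_splits)
    then show "f x = 0" by (rule ab)
  qed (use ab in \<open>auto simp: min_def max_def\<close>)
qed

text \<open>Outside the support the primitive is constant, namely 0 on the left and the total integral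
  on the right; so the integral is the only obstruction to compact support.\<close>

lemma test_function_primitive:
  assumes f: "test_function f" and 0: "integral {0..1} f = 0"
  shows "\<exists>F. test_function F \<and> deriv F = f"
proof -
  obtain a b where ab: "0 < a" "a < b" "b < 1" "\<And>x. x \<notin> {a<..<b} \<Longrightarrow> f x = 0"
    using test_function_support[OF f] by metis
  define F where "F x = integral {0..x} f" for x
  have F0: "F x = 0" if "x \<le> a" for x
    unfolding F_def using ab that by (subst integral_cong[of _ _ "\<lambda>_. 0"]) auto
  have int: "f integrable_on {x..y}" for x y
    by (intro integrable_continuous_interval test_function_continuous f)
  have F1: "F x = 0" if "b \<le> x" for x
  proof -
    have "F x = integral {0..b} f + integral {b..x} f"
      unfolding F_def using ab that by (simp add: Henstock_Kurzweil_Integration.integral_combine int)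
    also have "integral {b..x} f = integral {b..1} f"
      using ab that by (subst (1 2) integral_cong[of _ _ "\<lambda>_. 0"]) auto
    also have "integral {0..b} f + \<dots> = integral {0..1} f"
      using ab by (simp add: Henstock_Kurzweil_Integration.integral_combine int)
    finally show ?thesis using 0 by simp
  qed
  have D: "(F has_real_derivative f x) (at x)" for x
  proof (cases "x < a")
    case True
    have "((\<lambda>x. 0) has_real_derivative 0) (at x)" by simp
    then have "(F has_real_derivative 0) (at x)"
      by (rule has_field_derivative_transform_within_open[of _ _ _ "{..<a}"])
        (use True F0 in auto)
    then show ?thesis using True ab by simp
  next
    case False
    then have "(F has_real_derivative f x) (at x within {0..x+1})"
      unfolding F_def[abs_def] using ab
      by (intro integral_has_real_derivative test_function_continuous f) auto
    then show ?thesis using False ab by (simp add: at_within_Icc_at)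
  qed
  then have dF: "deriv F = f" by (intro ext DERIV_imp_deriv)
  have "(deriv ^^ n) F differentiable (at x)" for n x
  proof (cases n)
    case 0 then show ?thesis using D by (auto simp: real_differentiable_def)
  next
    case (Suc m) then show ?thesis using f dF by (simp add: funpow_Suc_right test_function_def del: funpow.simps)
  qed
  then have "test_function F"
    unfolding test_function_def using ab F0 F1
    by (intro conjI allI exI[of _ a] exI[of _ b]) (auto simp: not_le less_imp_le)
  with dF show ?thesis by blast
qed

abbreviation U01 :: "real measure" where
  "U01 \<equiv> lebesgue_on {0<..<1}"

lemma set_integral_U01: "(LINT x:{0<..<1}|lebesgue. f x) = (LINT x|U01. f x)" for f :: "real \<Rightarrow> real"
  by (simp add: set_lebesgue_integral_def integral_restrict_space)

lemma set_integrable_U01: "set_integrable lebesgue {0<..<1} f \<longleftrightarrow> integrable U01 f" for f :: "real \<Rightarrow> real"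
  by (simp add: set_integrable_def integrable_restrict_space)

text \<open>Intervals form a generator of the Borel sets that is stable under intersection, so by a
  Dynkin system argument all integrals over Borel sets vanish, in particular those over the sets where
  the function is positive or negative.\<close>

lemma AE_zero_of_interval_integrals:
  fixes f :: "real \<Rightarrow> real"
  assumes f: "integrable lebesgue f" and supp: "\<And>x. x \<notin> {a..b} \<Longrightarrow> f x = 0"
    and 0: "\<And>x y. (LINT t:{x..y}|lebesgue. f t) = 0"
  shows "AE x in lebesgue. f x = 0"
proof -
  obtain f' where f'[measurable]: "f' \<in> borel_measurable lborel" and ae: "AE x in lborel. f x = f' x"
    using completion_ex_borel_measurable_real[of f lborel] f by auto
  then have ae': "AE x in lebesgue. f x = f' x" by (simp add: AE_completion)
  have "integrable lebesgue f'"
    using f ae' f' by (subst integrable_cong_AE[of f' _ f]) (auto simp: measurable_completion)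
  then have int: "integrable lborel f'" by (simp add: integrable_completion)
  then have intA: "integrable lborel (\<lambda>x. indicator A x * f' x)" if "A \<in> sets lborel" for A
    using integrable_mult_indicator[OF that int] by simp
  have eq: "(LINT x|lborel. indicator A x * f' x) = (LINT x:A|lebesgue. f x)"
    if [measurable]: "A \<in> sets lborel" for A
  proof -
    have "(LINT x|lborel. indicator A x * f' x) = (LINT x|lebesgue. indicator A x * f' x)"
      by (rule integral_completion[symmetric]) measurable
    also have "\<dots> = (LINT x|lebesgue. indicator A x * f x)"
      using f that ae' by (intro integral_cong_AE borel_measurable_times) (auto simp: measurable_completion)
    finally show ?thesis by (simp add: set_lebesgue_integral_def)
  qed
  have tot: "(LINT x|lborel. f' x) = 0"
  proof -
    have "(LINT x:UNIV|lebesgue. f x) = (LINT x:{a..b}|lebesgue. f x)"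
      unfolding set_lebesgue_integral_def using supp
      by (intro Bochner_Integration.integral_cong) (auto simp: indicator_def)
    with eq[of UNIV] 0 show ?thesis by simp
  qed
  have A0: "(LINT x|lborel. indicator A x * f' x) = 0" if "A \<in> sets borel" for A
  proof -
    let ?G = "range (\<lambda>(a, b). {a..b::real})"
    have "Int_stable ?G"
      by (auto simp: Int_stable_def image_iff)
    moreover have "?G \<subseteq> Pow UNIV" by simp
    moreover have "A \<in> sigma_sets UNIV ?G"
      using that by (simp add: borel_eq_atLeastAtMost)
    ultimately show ?thesis
    proof (induction rule: sigma_sets_induct_disjoint)
      case (basic A)
      then obtain x y where "A = {x..y}" by auto
      then show ?case using eq[of A] 0 by simp
    next
      case empty show ?case by simp
    next
      case (compl A)
      then have A: "A \<in> sets lborel" by (simp add: borel_eq_atLeastAtMost)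
      have "(LINT x|lborel. indicator (UNIV - A) x * f' x) = (LINT x|lborel. f' x - indicator A x * f' x)"
        by (intro Bochner_Integration.integral_cong) (auto simp: indicator_def)
      then show ?case using compl A int intA tot by simp
    next
      case (union A)
      then have A: "A i \<in> sets lborel" for i by (auto simp: borel_eq_atLeastAtMost)
      have "(LINT x:(\<Union>i. A i)|lborel. f' x) = (\<Sum>i. (LINT x:(A i)|lborel. f' x))"
        by (rule lebesgue_integral_countable_add)
          (use A union int in \<open>auto simp: disjoint_family_on_def set_integrable_def intro!: integrable_mult_indicator[of _ lborel f', simplified]\<close>)
      then show ?case using union by (simp add: set_lebesgue_integral_def)
    qed
  qed
  have "AE x in lborel. indicator {x. f' x > 0} x * f' x = 0"
    using A0[of "{x. f' x > 0}"] intA[of "{x. f' x > 0}"]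
    by (subst integral_nonneg_eq_0_iff_AE[symmetric]) (auto simp: indicator_def)
  moreover have "AE x in lborel. - (indicator {x. f' x < 0} x * f' x) = 0"
    using A0[of "{x. f' x < 0}"] intA[of "{x. f' x < 0}"]
    by (subst integral_nonneg_eq_0_iff_AE[symmetric]) (auto simp: indicator_def)
  ultimately have "AE x in lborel. f x = 0"
    using ae by eventually_elim (auto simp: indicator_def split: if_splits)
  then show ?thesis by (simp add: AE_completion)
qed

lemma set_integrable_sub_Icc:
  fixes f :: "real \<Rightarrow> real"
  assumes "set_integrable lebesgue {a..b} f" "a \<le> x" "y \<le> b"
  shows "set_integrable lebesgue {x..y} f"
  using assms by (auto intro: set_integrable_subset)

lemma set_integrable_cont_mult:
  fixes f g :: "real \<Rightarrow> real"
  assumes f: "set_integrable lebesgue {a..b} f" and g: "continuous_on {a..b} g"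
  shows "set_integrable lebesgue {a..b} (\<lambda>x. f x * g x)"
proof -
  have "set_integrable lebesgue {a..b} (\<lambda>x. g x * f x)"
  proof (rule absolutely_integrable_bounded_measurable_product_real[OF _ _ _ f])
    show "g \<in> borel_measurable (lebesgue_on {a..b})"
      by (intro continuous_imp_measurable_on_sets_lebesgue g) auto
    show "bounded (g ` {a..b})"
      by (intro compact_imp_bounded compact_continuous_image g) auto
  qed auto
  then show ?thesis by (simp add: mult.commute)
qed

lemma integrable_U01_compact_support:
  fixes w \<phi> :: "real \<Rightarrow> real"
  assumes w: "set_integrable lebesgue {a..b} w" and ab: "0 < a" "b < 1"
    and \<phi>: "continuous_on {a..b} \<phi>" "\<And>x. x \<notin> {a..b} \<Longrightarrow> \<phi> x = 0"
  shows "integrable U01 (\<lambda>x. w x * \<phi> x)" "(LINT x|U01. w x * \<phi> x) = (LINT x:{a..b}|lebesgue. w x * \<phi> x)"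
proof -
  have *: "(\<lambda>x. indicator {0<..<1} x *\<^sub>R (w x * \<phi> x)) = (\<lambda>x. indicator {a..b} x *\<^sub>R (w x * \<phi> x))"
    using ab \<phi>(2) by (intro ext) (auto simp: indicator_def)
  show "integrable U01 (\<lambda>x. w x * \<phi> x)"
    using set_integrable_cont_mult[OF w \<phi>(1)]
    by (simp add: set_integrable_U01[symmetric] set_integrable_def *[simplified])
  show "(LINT x|U01. w x * \<phi> x) = (LINT x:{a..b}|lebesgue. w x * \<phi> x)"
    by (simp add: set_integral_U01[symmetric] set_lebesgue_integral_def *[simplified])
qed

lemma integrable_mult_test:
  assumes "locally_integrable w" "test_function \<phi>"
  shows "integrable U01 (\<lambda>x. w x * \<phi> x)"
proof -
  obtain a b where ab: "0 < a" "a < b" "b < 1" "\<And>x. x \<notin> {a<..<b} \<Longrightarrow> \<phi> x = 0"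
    using test_function_support[OF assms(2)] by metis
  show ?thesis
    by (rule integrable_U01_compact_support(1)[of a b])
      (use assms ab in \<open>auto simp: locally_integrable_def intro: test_function_continuous\<close>)
qed

text \<open>The open interval is a countable union of compact ones.\<close>

lemma AE_U01_local:
  assumes "\<And>a b. 0 < a \<Longrightarrow> b < 1 \<Longrightarrow> AE x in lebesgue. x \<in> {a..b} \<longrightarrow> P x"
  shows "AE x in U01. P x"
proof -
  have "AE x in lebesgue. \<forall>n::nat. x \<in> {1 / (real n + 1)..1 - 1 / (real n + 1)} \<longrightarrow> P x"
    unfolding AE_all_countable by (intro allI assms) (auto simp: field_simps)
  then have "AE x in lebesgue. x \<in> {0<..<1} \<longrightarrow> P x"
  proof eventually_elim
    case (elim x)
    show ?case
    proof
      assume x: "x \<in> {0<..<1}"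
      then obtain n where n: "inverse (real (Suc n)) < min x (1 - x)"
        using reals_Archimedean[of "min x (1 - x)"] by auto
      then show "P x" using elim[rule_format, of n] by (auto simp: inverse_eq_divide add.commute)
    qed
  qed
  then show ?thesis by (simp add: AE_restrict_space_iff)
qed

lemma bump_fun_limit:
  "(\<lambda>n. bump_fun (1 / real (Suc n)) a b x) \<longlonglongrightarrow> indicator {a<..<b} x"
proof (cases "a < x \<and> x < b")
  case True
  have "(\<lambda>n. exp (- (1 / real (Suc n)) / y)) \<longlonglongrightarrow> exp (- 0 / y)" for y :: real
    by (cases "y = 0") (simp, intro tendsto_intros tendsto_divide tendsto_minus LIMSEQ_inverse_real_of_nat[unfolded inverse_eq_divide])
  then have *: "(\<lambda>n. exp (- (1 / real (Suc n)) / (x - a)) * exp (- (1 / real (Suc n)) / (b - x))) \<longlonglongrightarrow>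
    exp (- 0 / (x - a)) * exp (- 0 / (b - x))"
    by (intro tendsto_mult)
  then show ?thesis using True by (simp add: bump_fun_def flat_def)
next
  case False
  then show ?thesis by (auto simp: bump_fun_def flat_def indicator_def)
qed

lemma bump_fun_bounds: "0 < e \<Longrightarrow> 0 \<le> bump_fun e a b x \<and> bump_fun e a b x \<le> indicator {a..b} x"
  by (auto simp: bump_fun_def flat_def indicator_def intro!: mult_le_one)

lemma bump_fun_outside: "x \<notin> {a..b} \<Longrightarrow> bump_fun e a b x = 0"
  by (auto simp: bump_fun_def flat_def)

text \<open>Bump functions converge boundedly to the indicator of an interval, so the hypothesis passes
  to integrals over intervals.\<close>

lemma weakly_zero_imp_AE_zero:
  assumes w: "locally_integrable w"
    and 0: "\<And>\<phi>. test_function \<phi> \<Longrightarrow> (LINT x|U01. w x * \<phi> x) = 0"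
  shows "AE x in U01. w x = 0"
proof (rule AE_U01_local)
  fix a b :: real assume ab: "0 < a" "b < 1"
  have sub: "(LINT t:{x..y}|lebesgue. w t) = 0" if xy: "a \<le> x" "y \<le> b" for x y
  proof -
    have x01: "0 < x" "y < 1" using ab xy by auto
    then have wi: "set_integrable lebesgue {x..y} w"
      using w by (auto simp: locally_integrable_def)
    let ?\<phi> = "\<lambda>n. bump_fun (1 / real (Suc n)) x y"
    have t: "test_function (?\<phi> n)" for n by (rule test_function_bump) (use x01 in auto)
    have i: "(LINT t:{x..y}|lebesgue. w t * ?\<phi> n t) = 0" for n
      by (subst integrable_U01_compact_support(2)[symmetric])
        (use x01 wi 0[OF t] test_function_continuous[OF t] in \<open>auto simp: bump_fun_outside\<close>)
    have "(\<lambda>n. LINT t:{x..y}|lebesgue. w t * ?\<phi> n t) \<longlonglongrightarrow> (LINT t:{x..y}|lebesgue. w t * indicator {x<..<y} t)"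
      unfolding set_lebesgue_integral_def
    proof (rule integral_dominated_convergence[where w = "\<lambda>t. norm (indicator {x..y} t *\<^sub>R w t)"])
      show "integrable lebesgue (\<lambda>t. norm (indicator {x..y} t *\<^sub>R w t))"
        using wi by (auto simp: set_integrable_def)
      have m: "(\<lambda>t. indicator {x..y} t *\<^sub>R w t) \<in> borel_measurable lebesgue"
        using wi by (auto simp: set_integrable_def)
      have "(\<lambda>t. (indicator {x..y} t *\<^sub>R w t) * indicator {x<..<y} t) \<in> borel_measurable lebesgue"
        by (intro borel_measurable_times m borel_measurable_indicator) auto
      then show "(\<lambda>t. indicator {x..y} t *\<^sub>R (w t * indicator {x<..<y} t)) \<in> borel_measurable lebesgue"
        by (simp add: mult_ac)
      have "(\<lambda>t. indicator {x..y} t *\<^sub>R (w t * ?\<phi> n t)) \<in> borel_measurable lebesgue" for n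
        using set_integrable_cont_mult[OF wi test_function_continuous[OF t]]
        by (auto simp: set_integrable_def)
      then show "(\<lambda>t. indicator {x..y} t *\<^sub>R (w t * ?\<phi> n t)) \<in> borel_measurable lebesgue" for n .
      show "AE t in lebesgue. (\<lambda>n. indicator {x..y} t *\<^sub>R (w t * ?\<phi> n t)) \<longlonglongrightarrow>
          indicator {x..y} t *\<^sub>R (w t * indicator {x<..<y} t)"
        by (intro AE_I2 tendsto_intros bump_fun_limit)
      show "AE t in lebesgue. norm (indicator {x..y} t *\<^sub>R (w t * ?\<phi> n t)) \<le> norm (indicator {x..y} t *\<^sub>R w t)" for n
      proof (rule AE_I2)
        fix t
        have "\<bar>?\<phi> n t\<bar> \<le> 1"
          using bump_fun_bounds[of "1 / real (Suc n)" x y t] by (cases "t \<in> {x..y}") auto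
        then have "\<bar>w t\<bar> * \<bar>?\<phi> n t\<bar> \<le> \<bar>w t\<bar> * 1" by (intro mult_left_mono) auto
        then show "norm (indicator {x..y} t *\<^sub>R (w t * ?\<phi> n t)) \<le> norm (indicator {x..y} t *\<^sub>R w t)"
          by (auto simp: indicator_def abs_mult)
      qed
    qed
    then have "(LINT t:{x..y}|lebesgue. w t * indicator {x<..<y} t) = 0"
      using i LIMSEQ_unique[OF _ tendsto_const[of 0]] by auto
    also have "(LINT t:{x..y}|lebesgue. w t * indicator {x<..<y} t) = (LINT t:{x..y}|lebesgue. w t)"
    proof -
      have "AE t in lebesgue. t \<noteq> x" "AE t in lebesgue. t \<noteq> y"
        by (auto intro!: AE_completion AE_lborel_singleton)
      then have *: "AE t in lebesgue. indicator {x..y} t *\<^sub>R (w t * indicator {x<..<y} t) = indicator {x..y} t *\<^sub>R w t"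
        by eventually_elim (auto simp: indicator_def)
      show ?thesis unfolding set_lebesgue_integral_def
      proof (rule integral_cong_AE[OF _ _ *])
        show m: "(\<lambda>t. indicator {x..y} t *\<^sub>R w t) \<in> borel_measurable lebesgue"
          using wi by (auto simp: set_integrable_def)
        have "(\<lambda>t. (indicator {x..y} t *\<^sub>R w t) * indicator {x<..<y} t) \<in> borel_measurable lebesgue"
          by (intro borel_measurable_times m borel_measurable_indicator) auto
        then show "(\<lambda>t. indicator {x..y} t *\<^sub>R (w t * indicator {x<..<y} t)) \<in> borel_measurable lebesgue"
          by (simp add: mult_ac)
      qed
    qed
    finally show ?thesis .
  qed
  have "AE x in lebesgue. indicator {a..b} x * w x = 0"
  proof (rule AE_zero_of_interval_integrals[where a = a and b = b])
    show "integrable lebesgue (\<lambda>x. indicator {a..b} x * w x)"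
      using w ab by (auto simp: locally_integrable_def set_integrable_def)
    fix x y
    have "(LINT t:{x..y}|lebesgue. indicator {a..b} t * w t) = (LINT t:{max a x..min b y}|lebesgue. w t)"
      unfolding set_lebesgue_integral_def
      by (intro Bochner_Integration.integral_cong) (auto simp: indicator_def)
    then show "(LINT t:{x..y}|lebesgue. indicator {a..b} t * w t) = 0" using sub by simp
  qed auto
  then show "AE x in lebesgue. x \<in> {a..b} \<longrightarrow> w x = 0"
    by eventually_elim (auto simp: indicator_def)
qed

section \<open>Absolutely continuous representatives of weakly differentiable functions\<close>

lemma test_function_integral:
  assumes "test_function \<phi>"
  shows "integrable U01 \<phi>" "(LINT x|U01. \<phi> x) = integral {0..1} \<phi>"
proof -
  have "set_integrable lebesgue {0..1} \<phi>"
    by (intro absolutely_integrable_continuous_real test_function_continuous assms)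
  then have i: "set_integrable lebesgue {0<..<1} \<phi>"
    by (rule set_integrable_subset) auto
  then show "integrable U01 \<phi>" by (simp add: set_integrable_U01)
  have "(LINT x|U01. \<phi> x) = integral {0<..<1} \<phi>"
    using set_lebesgue_integral_eq_integral(2)[OF i] by (simp add: set_integral_U01)
  also have "\<dots> = integral {0..1} \<phi>"
    using integral_open_interval_real[of 0 1 \<phi>] by simp
  finally show "(LINT x|U01. \<phi> x) = integral {0..1} \<phi>" .
qed

text \<open>The lemma of du Bois-Reymond. Subtracting from a test function the multiple of one fixed
  bump that has the same integral leaves the derivative of a test function; hence \<open>w\<close> minus
  its mean against that bump annihilates all test functions.\<close>

lemma weakly_constant_imp_AE_constant:
  assumes w: "locally_integrable w"
    and 0: "\<And>\<phi>. test_function \<phi> \<Longrightarrow> (LINT x|U01. w x * deriv \<phi> x) = 0"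
  shows "\<exists>c. AE x in U01. w x = c"
proof -
  define \<psi> where "\<psi> = bump_fun 1 (1/4) (3/4)"
  have \<psi>: "test_function \<psi>" unfolding \<psi>_def by (rule test_function_bump) auto
  have pos: "integral {0..1} \<psi> \<noteq> 0"
  proof
    assume "integral {0..1} \<psi> = 0"
    moreover have "continuous_on {0..1} \<psi>" by (rule test_function_continuous[OF \<psi>])
    moreover have "\<psi> x \<ge> 0" for x using bump_fun_bounds[of 1 "1/4" "3/4" x] by (simp add: \<psi>_def)
    ultimately have "\<forall>x\<in>{0..1}. \<psi> x = 0"
      by (subst integral_eq_0_iff[symmetric]) auto
    then have "\<psi> (1/2) = 0" by simp
    then show False by (simp add: \<psi>_def bump_fun_def flat_def)
  qed
  \<comment> \<open>The constant is the mean of \<open>w\<close> against the normalized bump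
    \<open>\<psi>\<close>.\<close>
  define c where "c = (LINT x|U01. w x * \<psi> x) / integral {0..1} \<psi>"
  have li: "locally_integrable (\<lambda>x. w x - c)"
    unfolding locally_integrable_def
  proof (intro allI impI)
    fix a b :: real assume "0 < a \<and> b < 1"
    then have "set_integrable lebesgue {a..b} w"
      using w unfolding locally_integrable_def by blast
    moreover have "set_integrable lebesgue {a..b} (\<lambda>x. c)"
      by (intro absolutely_integrable_continuous_real continuous_on_const)
    ultimately show "set_integrable lebesgue {a..b} (\<lambda>x. w x - c)"
      by (rule set_integral_diff(1))
  qed
  have "(LINT x|U01. (w x - c) * \<phi> x) = 0" if \<phi>: "test_function \<phi>" for \<phi>
  proof -
    define k where "k = integral {0..1} \<phi> / integral {0..1} \<psi>"
    have cont: "\<phi> integrable_on {0..1}" "(\<lambda>x. k * \<psi> x) integrable_on {0..1}"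
      by (intro integrable_continuous_interval continuous_on_mult continuous_on_const
          test_function_continuous \<phi> \<psi>)+
    have t: "test_function (\<lambda>x. \<phi> x - k * \<psi> x)" by (rule test_function_linear[OF \<phi> \<psi>])
    have "integral {0..1} (\<lambda>x. \<phi> x - k * \<psi> x) = integral {0..1} \<phi> - k * integral {0..1} \<psi>"
      using cont by (subst Henstock_Kurzweil_Integration.integral_diff) auto
    also have "\<dots> = 0" using pos by (simp add: k_def)
    finally obtain F where "test_function F" "deriv F = (\<lambda>x. \<phi> x - k * \<psi> x)"
      using test_function_primitive[OF t] by blast
    then have "(LINT x|U01. w x * (\<phi> x - k * \<psi> x)) = 0" using 0[of F] by simp
    also have "(LINT x|U01. w x * (\<phi> x - k * \<psi> x)) = (LINT x|U01. w x * \<phi> x - k * (w x * \<psi> x))"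
      by (intro Bochner_Integration.integral_cong) (auto simp: algebra_simps)
    also have "\<dots> = (LINT x|U01. w x * \<phi> x) - k * (LINT x|U01. w x * \<psi> x)"
      by (subst Bochner_Integration.integral_diff)
        (intro integrable_mult_test integrable_mult_right w \<phi> \<psi> | simp only: integral_mult_right_zero)+
    finally have 1: "(LINT x|U01. w x * \<phi> x) = k * (LINT x|U01. w x * \<psi> x)" by simp
    have "(LINT x|U01. (w x - c) * \<phi> x) = (LINT x|U01. w x * \<phi> x - c * \<phi> x)"
      by (intro Bochner_Integration.integral_cong) (auto simp: algebra_simps)
    also have "\<dots> = (LINT x|U01. w x * \<phi> x) - c * integral {0..1} \<phi>"
      by (subst Bochner_Integration.integral_diff)
        (intro integrable_mult_test integrable_mult_right test_function_integral w \<phi>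
          | simp only: integral_mult_right_zero test_function_integral[OF \<phi>])+
    also have "\<dots> = 0" unfolding 1 using pos by (simp add: c_def k_def)
    finally show ?thesis .
  qed
  from weakly_zero_imp_AE_zero[OF li this] have "AE x in U01. w x = c" by simp
  then show ?thesis by blast
qed

text \<open>Local absolute continuity on the open unit interval together with a choice of the
  derivative. Unlike weak derivatives, which are classes modulo null sets, this notion fixes the values
  of \<open>g\<close> everywhere, so that the product rule can be stated pointwise.\<close>

definition ac_deriv :: "(real \<Rightarrow> real) \<Rightarrow> (real \<Rightarrow> real) \<Rightarrow> bool" where
  "ac_deriv g h \<longleftrightarrow> locally_integrable h \<and>
     (\<forall>x y. 0 < x \<and> x \<le> y \<and> y < 1 \<longrightarrow> g y - g x = (LINT t:{x..y}|lebesgue. h t))"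

lemma ac_derivD:
  assumes "ac_deriv g h" "0 < x" "y < 1"
  shows "set_integrable lebesgue {x..y} h" "x \<le> y \<Longrightarrow> g y = g x + (LINT t:{x..y}|lebesgue. h t)"
proof -
  show "set_integrable lebesgue {x..y} h"
    using assms unfolding ac_deriv_def locally_integrable_def by blast
  assume "x \<le> y"
  then have "g y - g x = (LINT t:{x..y}|lebesgue. h t)"
    using assms unfolding ac_deriv_def by blast
  then show "g y = g x + (LINT t:{x..y}|lebesgue. h t)" by linarith
qed

lemma set_integral_combine:
  fixes f :: "real \<Rightarrow> real"
  assumes f: "set_integrable lebesgue {x..z} f" and "x \<le> y" "y \<le> z"
  shows "(LINT t:{x..z}|lebesgue. f t) = (LINT t:{x..y}|lebesgue. f t) + (LINT t:{y..z}|lebesgue. f t)"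
proof -
  have "set_integrable lebesgue {x..y} f" "set_integrable lebesgue {y..z} f"
    using assms by (auto intro: set_integrable_sub_Icc)
  then show ?thesis
    using assms Henstock_Kurzweil_Integration.integral_combine[of x y z f]
    by (simp add: set_lebesgue_integral_eq_integral[of "{x..y}"] set_lebesgue_integral_eq_integral[of "{y..z}"]
         set_lebesgue_integral_eq_integral[OF f])
qed

lemma indefinite_integral_continuous:
  fixes h :: "real \<Rightarrow> real"
  assumes h: "set_integrable lebesgue {a..b} h" and g: "\<And>x. x \<in> {a..b} \<Longrightarrow> g x = c + (LINT t:{a..x}|lebesgue. h t)"
  shows "continuous_on {a..b} g"
proof -
  have h': "h integrable_on {a..b}" by (rule set_lebesgue_integral_eq_integral(1)[OF h])
  have "continuous_on {a..b} (\<lambda>x. c + integral {a..x} h)"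
    by (rule continuous_on_add[OF continuous_on_const indefinite_integral_continuous_1[OF h']])
  moreover have "c + integral {a..x} h = g x" if x: "x \<in> {a..b}" for x
  proof -
    have "set_integrable lebesgue {a..x} h"
      by (rule set_integrable_sub_Icc[OF h]) (use x in auto)
    from set_lebesgue_integral_eq_integral(2)[OF this] show ?thesis
      by (simp only: g[OF x])
  qed
  ultimately show ?thesis by (rule continuous_on_eq)
qed

lemma ac_deriv_continuous:
  assumes "ac_deriv g h" shows "continuous_on {0<..<1} g"
proof -
  have "isCont g x" if "x \<in> {0<..<1}" for x
  proof -
    define a b where "a = x / 2" and "b = (x + 1) / 2"
    have ab: "0 < a" "a < x" "x < b" "b < 1" using that by (auto simp: a_def b_def)
    have "continuous_on {a..b} g"
    proof (rule indefinite_integral_continuous[of a b h g "g a"])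
      show "set_integrable lebesgue {a..b} h" by (rule ac_derivD(1)[OF assms ab(1,4)])
      fix y assume "y \<in> {a..b}"
      then show "g y = g a + (LINT t:{a..y}|lebesgue. h t)"
        by (intro ac_derivD(2)[OF assms]) (use ab in auto)
    qed
    then show ?thesis using ab continuous_on_interior[of "{a..b}" g x] by simp
  qed
  then show ?thesis by (intro continuous_at_imp_continuous_on ballI)
qed

lemma locally_integrable_continuous:
  assumes "continuous_on {0<..<1} g" shows "locally_integrable g"
  unfolding locally_integrable_def
  by (intro allI impI absolutely_integrable_continuous_real continuous_on_subset[OF assms]) auto

lemma ac_deriv_of_primitive:
  assumes h: "locally_integrable h"
  defines "G \<equiv> (\<lambda>x. if 1/2 \<le> x then (LINT t:{1/2..x}|lebesgue. h t) else - (LINT t:{x..1/2}|lebesgue. h t))"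
  shows "ac_deriv G h"
  unfolding ac_deriv_def
proof (intro conjI allI impI h)
  fix x y :: real assume xy: "0 < x \<and> x \<le> y \<and> y < 1"
  have i: "set_integrable lebesgue {a..b} h" if "0 < a" "b < 1" for a b
    using h that by (auto simp: locally_integrable_def)
  consider "y < 1/2" | "x < 1/2" "1/2 \<le> y" | "1/2 \<le> x" by linarith
  then show "G y - G x = (LINT t:{x..y}|lebesgue. h t)"
  proof cases
    case 1 then show ?thesis using xy set_integral_combine[OF i, of x "1/2" y] by (simp add: G_def)
  next
    case 2 then show ?thesis using xy set_integral_combine[OF i, of x y "1/2"] by (simp add: G_def)
  next
    case 3 then show ?thesis using xy set_integral_combine[OF i, of "1/2" y x] by (simp add: G_def)
  qed
qed

text \<open>Fubini for \<open>h1 s * h2 t\<close> on the square, which the diagonal divides into two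
  triangles. On each of them one of the two integrations can be carried out.\<close>

lemma integration_by_parts_ac:
  fixes h1 h2 g1 g2 :: "real \<Rightarrow> real"
  assumes xy: "x \<le> y"
    and h1: "set_integrable lebesgue {x..y} h1" and h2: "set_integrable lebesgue {x..y} h2"
    and g1: "\<And>t. t \<in> {x..y} \<Longrightarrow> g1 t = g1 x + (LINT s:{x..t}|lebesgue. h1 s)"
    and g2: "\<And>t. t \<in> {x..y} \<Longrightarrow> g2 t = g2 x + (LINT s:{x..t}|lebesgue. h2 s)"
  shows "set_integrable lebesgue {x..y} (\<lambda>t. h1 t * g2 t + g1 t * h2 t)"
    and "g1 y * g2 y - g1 x * g2 x = (LINT t:{x..y}|lebesgue. h1 t * g2 t + g1 t * h2 t)"
proof -
  have c1: "continuous_on {x..y} g1" by (rule indefinite_integral_continuous[OF h1 g1])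
  have c2: "continuous_on {x..y} g2" by (rule indefinite_integral_continuous[OF h2 g2])
  have i12: "set_integrable lebesgue {x..y} (\<lambda>t. h1 t * g2 t)" by (rule set_integrable_cont_mult[OF h1 c2])
  have i21: "set_integrable lebesgue {x..y} (\<lambda>t. g1 t * h2 t)"
    using set_integrable_cont_mult[OF h2 c1] by (simp add: mult.commute)
  show "set_integrable lebesgue {x..y} (\<lambda>t. h1 t * g2 t + g1 t * h2 t)"
    by (rule set_integral_add(1)[OF i12 i21])
  define \<mu> where "\<mu> = lebesgue_on {x..y}"
  interpret finite_measure \<mu> unfolding \<mu>_def by (rule finite_measure_lebesgue_on) auto
  interpret P: pair_sigma_finite \<mu> \<mu> ..
  have to\<mu>: "(LINT t:{x..y}|lebesgue. f t) = (LINT t|\<mu>. f t)" for f :: "real \<Rightarrow> real"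
    by (simp add: \<mu>_def set_lebesgue_integral_def integral_restrict_space)
  have to\<mu>i: "set_integrable lebesgue {x..y} f \<longleftrightarrow> integrable \<mu> f" for f :: "real \<Rightarrow> real"
    by (simp add: \<mu>_def set_integrable_def integrable_restrict_space)
  have j1: "integrable \<mu> h1" and j2: "integrable \<mu> h2" using h1 h2 by (auto simp: to\<mu>i)
  have [measurable]: "h1 \<in> borel_measurable \<mu>" "h2 \<in> borel_measurable \<mu>" using j1 j2 by auto
  have [measurable]: "(\<lambda>t. t) \<in> borel_measurable \<mu>"
    unfolding \<mu>_def by (intro measurable_restrict_space1 measurable_completion) auto
  have prod: "integrable (\<mu> \<Otimes>\<^sub>M \<mu>) (\<lambda>(s, t). h1 s * h2 t)"
  proof (rule P.Fubini_integrable)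
    show "(\<lambda>(s, t). h1 s * h2 t) \<in> borel_measurable (\<mu> \<Otimes>\<^sub>M \<mu>)" by measurable
    show "integrable \<mu> (\<lambda>s. LINT t|\<mu>. norm (case (s, t) of (s, t) \<Rightarrow> h1 s * h2 t))"
      using j1 by (simp add: abs_mult)
    show "AE s in \<mu>. integrable \<mu> (\<lambda>t. case (s, t) of (s, t) \<Rightarrow> h1 s * h2 t)"
      using j2 by simp
  qed
  let ?L = "\<lambda>(s, t). if s \<le> t then h1 s * h2 t else 0"
  let ?R = "\<lambda>(s, t). if t < s then h1 s * h2 t else 0"
  have L: "integrable (\<mu> \<Otimes>\<^sub>M \<mu>) ?L"
  proof (rule Bochner_Integration.integrable_bound[OF prod])
    show "?L \<in> borel_measurable (\<mu> \<Otimes>\<^sub>M \<mu>)" by measurable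
    show "AE z in (\<mu> \<Otimes>\<^sub>M \<mu>). norm (?L z) \<le> norm (case z of (s, t) \<Rightarrow> h1 s * h2 t)"
      by (rule AE_I2) (simp split: prod.split)
  qed
  have R: "integrable (\<mu> \<Otimes>\<^sub>M \<mu>) ?R"
  proof (rule Bochner_Integration.integrable_bound[OF prod])
    show "?R \<in> borel_measurable (\<mu> \<Otimes>\<^sub>M \<mu>)" by measurable
    show "AE z in (\<mu> \<Otimes>\<^sub>M \<mu>). norm (?R z) \<le> norm (case z of (s, t) \<Rightarrow> h1 s * h2 t)"
      by (rule AE_I2) (simp split: prod.split)
  qed
  have eL: "(LINT z|(\<mu> \<Otimes>\<^sub>M \<mu>). ?L z) = (LINT t|\<mu>. (g1 t - g1 x) * h2 t)"
  proof -
    have "(LINT z|(\<mu> \<Otimes>\<^sub>M \<mu>). ?L z) = (LINT t|\<mu>. LINT s|\<mu>. (if s \<le> t then h1 s * h2 t else 0))"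
      using P.integral_snd[of "\<lambda>s t. if s \<le> t then h1 s * h2 t else 0"] L by simp
    also have "\<dots> = (LINT t|\<mu>. (g1 t - g1 x) * h2 t)"
    proof (rule Bochner_Integration.integral_cong[OF refl])
      fix t assume "t \<in> space \<mu>"
      then have t: "t \<in> {x..y}" by (simp add: \<mu>_def)
      have "(LINT s|\<mu>. (if s \<le> t then h1 s * h2 t else 0)) = (LINT s|\<mu>. (if s \<le> t then h1 s else 0) * h2 t)"
        by (intro Bochner_Integration.integral_cong) auto
      also have "\<dots> = (LINT s|\<mu>. (if s \<le> t then h1 s else 0)) * h2 t" by simp
      also have "(LINT s|\<mu>. (if s \<le> t then h1 s else 0)) = (LINT s:{x..t}|lebesgue. h1 s)"
        unfolding to\<mu>[symmetric] set_lebesgue_integral_def using t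
        by (intro Bochner_Integration.integral_cong) (auto simp: indicator_def)
      also have "\<dots> = g1 t - g1 x" using g1[OF t] by simp
      finally show "(LINT s|\<mu>. (if s \<le> t then h1 s * h2 t else 0)) = (g1 t - g1 x) * h2 t" .
    qed
    finally show ?thesis .
  qed
  have eR: "(LINT z|(\<mu> \<Otimes>\<^sub>M \<mu>). ?R z) = (LINT s|\<mu>. h1 s * (g2 s - g2 x))"
  proof -
    have "(LINT z|(\<mu> \<Otimes>\<^sub>M \<mu>). ?R z) = (LINT s|\<mu>. LINT t|\<mu>. (if t < s then h1 s * h2 t else 0))"
      using P.integral_fst[of "\<lambda>s t. if t < s then h1 s * h2 t else 0"] R by simp
    also have "\<dots> = (LINT s|\<mu>. h1 s * (g2 s - g2 x))"
    proof (rule Bochner_Integration.integral_cong[OF refl])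
      fix s assume "s \<in> space \<mu>"
      then have s: "s \<in> {x..y}" by (simp add: \<mu>_def)
      have "(LINT t|\<mu>. (if t < s then h1 s * h2 t else 0)) = (LINT t|\<mu>. h1 s * (if t < s then h2 t else 0))"
        by (intro Bochner_Integration.integral_cong) auto
      also have "\<dots> = h1 s * (LINT t|\<mu>. (if t < s then h2 t else 0))" by simp
      also have "(LINT t|\<mu>. (if t < s then h2 t else 0)) = (LINT t|\<mu>. (if t \<le> s then h2 t else 0))"
      proof (rule integral_cong_AE)
        have "AE t in lebesgue. t \<noteq> s" by (auto intro!: AE_completion AE_lborel_singleton)
        then have "AE t in \<mu>. t \<noteq> s" unfolding \<mu>_def by (auto simp: AE_restrict_space_iff)
        then show "AE t in \<mu>. (if t < s then h2 t else 0) = (if t \<le> s then h2 t else 0)"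
          by eventually_elim auto
      qed measurable
      also have "\<dots> = (LINT t:{x..s}|lebesgue. h2 t)"
        unfolding to\<mu>[symmetric] set_lebesgue_integral_def using s
        by (intro Bochner_Integration.integral_cong) (auto simp: indicator_def)
      also have "\<dots> = g2 s - g2 x" using g2[OF s] by simp
      finally show "(LINT t|\<mu>. (if t < s then h1 s * h2 t else 0)) = h1 s * (g2 s - g2 x)" .
    qed
    finally show ?thesis .
  qed
  have "(LINT z|(\<mu> \<Otimes>\<^sub>M \<mu>). ?L z + ?R z) = (LINT z|(\<mu> \<Otimes>\<^sub>M \<mu>). (case z of (s, t) \<Rightarrow> h1 s * h2 t))"
    by (intro Bochner_Integration.integral_cong) auto
  also have "\<dots> = (LINT s|\<mu>. LINT t|\<mu>. h1 s * h2 t)"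
    using P.integral_fst[of "\<lambda>s t. h1 s * h2 t"] prod by simp
  also have "\<dots> = (g1 y - g1 x) * (g2 y - g2 x)"
    using g1[of y] g2[of y] xy by (simp add: to\<mu>)
  finally have "(g1 y - g1 x) * (g2 y - g2 x)
      = (LINT t|\<mu>. (g1 t - g1 x) * h2 t) + (LINT s|\<mu>. h1 s * (g2 s - g2 x))"
    using L R eL eR by simp
  moreover have "(LINT t|\<mu>. (g1 t - g1 x) * h2 t) = (LINT t|\<mu>. g1 t * h2 t) - g1 x * (g2 y - g2 x)"
    using i21 j2 g2[of y] xy by (simp add: to\<mu>i to\<mu> left_diff_distrib)
  moreover have "(LINT t|\<mu>. h1 t * (g2 t - g2 x)) = (LINT t|\<mu>. h1 t * g2 t) - (g1 y - g1 x) * g2 x"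
    using i12 j1 g1[of y] xy by (simp add: to\<mu>i to\<mu> right_diff_distrib)
  ultimately show "g1 y * g2 y - g1 x * g2 x = (LINT t:{x..y}|lebesgue. h1 t * g2 t + g1 t * h2 t)"
    using i12 i21 by (simp add: to\<mu>i to\<mu> algebra_simps)
qed

lemma ac_deriv_mult:
  assumes "ac_deriv g1 h1" "ac_deriv g2 h2"
  shows "ac_deriv (\<lambda>x. g1 x * g2 x) (\<lambda>x. h1 x * g2 x + g1 x * h2 x)"
proof -
  have *: "set_integrable lebesgue {x..y} (\<lambda>t. h1 t * g2 t + g1 t * h2 t)"
    "g1 y * g2 y - g1 x * g2 x = (LINT t:{x..y}|lebesgue. h1 t * g2 t + g1 t * h2 t)"
    if xy: "0 < x" "x \<le> y" "y < 1" for x y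
  proof -
    have a: "g1 t = g1 x + (LINT s:{x..t}|lebesgue. h1 s)" if "t \<in> {x..y}" for t
      by (rule ac_derivD(2)[OF assms(1)]) (use that xy in auto)
    have b: "g2 t = g2 x + (LINT s:{x..t}|lebesgue. h2 s)" if "t \<in> {x..y}" for t
      by (rule ac_derivD(2)[OF assms(2)]) (use that xy in auto)
    note i = ac_derivD(1)[OF assms(1) xy(1,3)] ac_derivD(1)[OF assms(2) xy(1,3)]
    show "set_integrable lebesgue {x..y} (\<lambda>t. h1 t * g2 t + g1 t * h2 t)"
      "g1 y * g2 y - g1 x * g2 x = (LINT t:{x..y}|lebesgue. h1 t * g2 t + g1 t * h2 t)"
      by (rule integration_by_parts_ac[OF xy(2) i a b]; assumption)+
  qed
  have "set_integrable lebesgue {x..y} (\<lambda>t. h1 t * g2 t + g1 t * h2 t)" if "0 < x" "y < 1" for x y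
    using *(1)[of x y] that by (cases "x \<le> y") (auto simp: set_integrable_def)
  then show ?thesis unfolding ac_deriv_def locally_integrable_def using *(2) by blast
qed

lemma ac_deriv_add:
  assumes "ac_deriv g1 h1" "ac_deriv g2 h2"
  shows "ac_deriv (\<lambda>x. g1 x + g2 x) (\<lambda>x. h1 x + h2 x)"
proof -
  have i: "set_integrable lebesgue {x..y} h1" "set_integrable lebesgue {x..y} h2" if "0 < x" "y < 1" for x y
    by (rule ac_derivD(1)[OF assms(1) that], rule ac_derivD(1)[OF assms(2) that])
  have "set_integrable lebesgue {x..y} (\<lambda>t. h1 t + h2 t)" if "0 < x" "y < 1" for x y
    by (rule set_integral_add(1)[OF i[OF that]])
  moreover have "(g1 y + g2 y) - (g1 x + g2 x) = (LINT t:{x..y}|lebesgue. h1 t + h2 t)"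
    if xy: "0 < x \<and> x \<le> y \<and> y < 1" for x y
  proof -
    have xy': "0 < x" "y < 1" "x \<le> y" using xy by auto
    show ?thesis
      using ac_derivD(2)[OF assms(1) xy'] ac_derivD(2)[OF assms(2) xy'] set_integral_add(2)[OF i[OF xy'(1,2)]]
      by linarith
  qed
  ultimately show ?thesis unfolding ac_deriv_def locally_integrable_def by blast
qed

lemma ac_deriv_const: "ac_deriv (\<lambda>x. c) (\<lambda>x. 0)"
  by (simp add: ac_deriv_def locally_integrable_def set_lebesgue_integral_def set_integrable_def)

lemma ac_deriv_cmult: "ac_deriv g h \<Longrightarrow> ac_deriv (\<lambda>x. c * g x) (\<lambda>x. c * h x)"
  using ac_deriv_mult[OF ac_deriv_const, of g h c] by simp

lemma ac_deriv_sum: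
  assumes "finite I" "\<And>i. i \<in> I \<Longrightarrow> ac_deriv (g i) (h i)"
  shows "ac_deriv (\<lambda>x. \<Sum>i\<in>I. g i x) (\<lambda>x. \<Sum>i\<in>I. h i x)"
  using assms by (induction I rule: finite_induct) (auto intro: ac_deriv_const ac_deriv_add)

lemma ac_deriv_of_C1:
  assumes D: "\<And>x. x \<in> {0<..<1} \<Longrightarrow> (g has_real_derivative h x) (at x)" and c: "continuous_on {0<..<1} h"
  shows "ac_deriv g h"
  unfolding ac_deriv_def
proof (intro conjI allI impI locally_integrable_continuous c)
  fix x y :: real assume xy: "0 < x \<and> x \<le> y \<and> y < 1"
  have "set_integrable lebesgue {x..y} h"
    by (intro absolutely_integrable_continuous_real continuous_on_subset[OF c]) (use xy in auto)
  moreover have "(h has_integral (g y - g x)) {x..y}"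
  proof (rule fundamental_theorem_of_calculus)
    fix t assume "t \<in> {x..y}"
    then have "(g has_real_derivative h t) (at t within {x..y})"
      by (intro has_field_derivative_at_within[OF D]) (use xy in auto)
    then show "(g has_vector_derivative h t) (at t within {x..y})"
      by (simp only: has_real_derivative_iff_has_vector_derivative)
  qed (use xy in auto)
  ultimately show "g y - g x = (LINT t:{x..y}|lebesgue. h t)"
    by (simp only: set_lebesgue_integral_eq_integral(2) integral_unique)
qed

lemma ac_deriv_test_function:
  assumes g: "ac_deriv g h" and \<phi>: "test_function \<phi>"
  shows "(LINT x|U01. g x * deriv \<phi> x) = - (LINT x|U01. h x * \<phi> x)"
proof -
  obtain a b where ab: "0 < a" "a < b" "b < 1" and z: "\<And>x. x \<notin> {a<..<b} \<Longrightarrow> \<phi> x = 0"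
    using test_function_support[OF \<phi>] by metis
  obtain a' b' where ab': "0 < a'" "a' < b'" "b' < 1" and z': "\<And>x. x \<notin> {a'<..<b'} \<Longrightarrow> deriv \<phi> x = 0"
    using test_function_support[OF test_function_deriv(2)[OF \<phi>]] by metis
  define A B where "A = min a a'" and "B = max b b'"
  have AB: "0 < A" "A < B" "B < 1" using ab ab' by (auto simp: A_def B_def)
  have zAB: "\<phi> x = 0" "deriv \<phi> x = 0" if "x \<notin> {A<..<B}" for x
    using that by (intro z z'; auto simp: A_def B_def)+
  have p: "ac_deriv \<phi> (deriv \<phi>)"
    by (intro ac_deriv_of_C1 test_function_deriv \<phi> test_function_continuous)
  have i: "set_integrable lebesgue {A..B} h" by (rule ac_derivD(1)[OF g AB(1,3)])
  have ig: "set_integrable lebesgue {A..B} g"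
    by (intro absolutely_integrable_continuous_real continuous_on_subset[OF ac_deriv_continuous[OF g]])
      (use AB in auto)
  have hp: "integrable U01 (\<lambda>x. h x * \<phi> x)" "(LINT x|U01. h x * \<phi> x) = (LINT x:{A..B}|lebesgue. h x * \<phi> x)"
    by (rule integrable_U01_compact_support[OF i AB(1,3)];
        use zAB in \<open>auto intro: test_function_continuous \<phi>\<close>)+
  have gp: "(LINT x|U01. g x * deriv \<phi> x) = (LINT x:{A..B}|lebesgue. g x * deriv \<phi> x)"
    by (rule integrable_U01_compact_support[OF ig AB(1,3)];
        use zAB in \<open>auto intro: test_function_continuous test_function_deriv(2)[OF \<phi>]\<close>)
  have s: "set_integrable lebesgue {A..B} (\<lambda>x. h x * \<phi> x)" "set_integrable lebesgue {A..B} (\<lambda>x. g x * deriv \<phi> x)"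
    by (intro set_integrable_cont_mult i ig test_function_continuous test_function_deriv(2) \<phi>)+
  have "g B * \<phi> B = g A * \<phi> A + (LINT t:{A..B}|lebesgue. h t * \<phi> t + g t * deriv \<phi> t)"
    by (rule ac_derivD(2)[OF ac_deriv_mult[OF g p] AB(1,3)]) (use AB in auto)
  moreover have "\<phi> A = 0" "\<phi> B = 0" by (simp_all add: zAB)
  ultimately have "(LINT t:{A..B}|lebesgue. h t * \<phi> t + g t * deriv \<phi> t) = 0" by simp
  then show ?thesis unfolding gp hp using set_integral_add(2)[OF s] by simp
qed

text \<open>The difference of \<open>g\<close> and a primitive of \<open>h\<close> has weak derivative
  0.\<close>

lemma has_weak_deriv_AE_ac_deriv:
  assumes "has_weak_deriv 1 g h"
  obtains G where "ac_deriv G h" "AE x in U01. g x = G x"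
proof -
  have lg: "locally_integrable g" and lh: "locally_integrable h"
    and w: "\<And>\<phi>. test_function \<phi> \<Longrightarrow> (LINT x|U01. g x * deriv \<phi> x) = - (LINT x|U01. h x * \<phi> x)"
    using assms by (auto simp: has_weak_deriv_def set_integral_U01)
  obtain G where G: "ac_deriv G h" using ac_deriv_of_primitive[OF lh] by blast
  have lG: "locally_integrable G" by (intro locally_integrable_continuous ac_deriv_continuous[OF G])
  have "\<exists>c. AE x in U01. g x - G x = c"
  proof (rule weakly_constant_imp_AE_constant)
    show "locally_integrable (\<lambda>x. g x - G x)"
      using lg lG unfolding locally_integrable_def by (blast intro: set_integral_diff(1))
    fix \<phi> assume \<phi>: "test_function \<phi>"
    note i = integrable_mult_test[OF lg test_function_deriv(2)[OF \<phi>]] integrable_mult_test[OF lG test_function_deriv(2)[OF \<phi>]]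
    have "(LINT x|U01. (g x - G x) * deriv \<phi> x) = (LINT x|U01. g x * deriv \<phi> x) - (LINT x|U01. G x * deriv \<phi> x)"
      by (simp only: left_diff_distrib Bochner_Integration.integral_diff[OF i])
    then show "(LINT x|U01. (g x - G x) * deriv \<phi> x) = 0"
      using w[OF \<phi>] ac_deriv_test_function[OF G \<phi>] by simp
  qed
  then obtain c where c: "AE x in U01. g x - G x = c" by blast
  show thesis
  proof (rule that[of "\<lambda>x. G x + c"])
    show "ac_deriv (\<lambda>x. G x + c) h" using ac_deriv_add[OF G ac_deriv_const[of c]] by simp
    show "AE x in U01. g x = G x + c" using c by eventually_elim simp
  qed
qed

lemma has_weak_deriv_unique:
  assumes "has_weak_deriv j g h" "has_weak_deriv j g h'"
  shows "AE x in U01. h x = h' x"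
proof -
  have l: "locally_integrable h" "locally_integrable h'"
    using assms by (auto simp: has_weak_deriv_def)
  have "AE x in U01. h x - h' x = 0"
  proof (rule weakly_zero_imp_AE_zero)
    show "locally_integrable (\<lambda>x. h x - h' x)"
      using l unfolding locally_integrable_def by (blast intro: set_integral_diff(1))
    fix \<phi> assume \<phi>: "test_function \<phi>"
    have "(LINT x|U01. g x * (deriv ^^ j) \<phi> x) = (-1) ^ j * (LINT x|U01. h x * \<phi> x)"
      using assms(1) \<phi> unfolding has_weak_deriv_def set_integral_U01 by blast
    moreover have "(LINT x|U01. g x * (deriv ^^ j) \<phi> x) = (-1) ^ j * (LINT x|U01. h' x * \<phi> x)"
      using assms(2) \<phi> unfolding has_weak_deriv_def set_integral_U01 by blast
    ultimately have "(LINT x|U01. h x * \<phi> x) = (LINT x|U01. h' x * \<phi> x)" by simp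
    then show "(LINT x|U01. (h x - h' x) * \<phi> x) = 0"
      by (simp only: left_diff_distrib Bochner_Integration.integral_diff[OF l[THEN integrable_mult_test[OF _ \<phi>]]] diff_self)
  qed
  then show ?thesis by eventually_elim simp
qed

text \<open>Consecutive weak derivatives of a function are weak derivatives of each other; hence
  families of weak derivatives up to some order are chains of absolutely continuous functions.\<close>

lemma has_weak_deriv_step:
  assumes h: "has_weak_deriv j g h" and h': "has_weak_deriv (Suc j) g h'"
  shows "has_weak_deriv 1 h h'"
  unfolding has_weak_deriv_def
proof (intro conjI allI impI)
  show "locally_integrable h" "locally_integrable h'" using h h' by (auto simp: has_weak_deriv_def)
  fix \<phi> assume \<phi>: "test_function \<phi>"
  have "(LINT x:{0<..<1}|lebesgue. g x * (deriv ^^ j) (deriv \<phi>) x)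
      = (-1) ^ j * (LINT x:{0<..<1}|lebesgue. h x * deriv \<phi> x)"
    using h test_function_deriv(2)[OF \<phi>] unfolding has_weak_deriv_def by blast
  moreover have "(LINT x:{0<..<1}|lebesgue. g x * (deriv ^^ Suc j) \<phi> x)
      = (-1) ^ Suc j * (LINT x:{0<..<1}|lebesgue. h' x * \<phi> x)"
    using h' \<phi> unfolding has_weak_deriv_def by blast
  moreover have "(deriv ^^ Suc j) \<phi> = (deriv ^^ j) (deriv \<phi>)" by (simp add: funpow_Suc_right del: funpow.simps)
  ultimately have "(-1) ^ j * (LINT x:{0<..<1}|lebesgue. h x * deriv \<phi> x)
      = (-1) ^ j * (- (LINT x:{0<..<1}|lebesgue. h' x * \<phi> x))"
    by simp
  then have "(LINT x:{0<..<1}|lebesgue. h x * deriv \<phi> x) = - (LINT x:{0<..<1}|lebesgue. h' x * \<phi> x)"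
    by (rule mult_left_cancel[THEN iffD1, rotated]) simp
  then show "(LINT x:{0<..<1}|lebesgue. h x * (deriv ^^ 1) \<phi> x)
      = (-1) ^ 1 * (LINT x:{0<..<1}|lebesgue. h' x * \<phi> x)" by simp
qed

section \<open>Jacobi polynomials\<close>

lemma borel_measurable_U01: "f \<in> borel_measurable borel \<Longrightarrow> f \<in> borel_measurable U01"
  for f :: "real \<Rightarrow> real"
  by (intro measurable_restrict_space1 measurable_completion) simp

lemma measurable_weight: "weight a b \<in> borel_measurable U01"
proof -
  have "(\<lambda>x. (1 - x) powr a * x powr b) \<in> borel_measurable borel" by measurable
  then show ?thesis unfolding weight_def[abs_def] by (rule borel_measurable_U01)
qed

lemma weight_nonneg: "0 \<le> weight a b x" by (simp add: weight_def)

lemma weight_pos: "x \<in> {0<..<1} \<Longrightarrow> 0 < weight a b x" by (simp add: weight_def)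

lemma weight_add: "weight (a + c) (b + d) x = weight a b x * weight c d x"
  by (simp add: weight_def powr_add mult_ac)

lemma weight_Suc: "x \<in> {0<..<1} \<Longrightarrow> weight (a + 1) (b + 1) x = weight a b x * ((1 - x) * x)"
  by (simp add: weight_add) (simp add: weight_def)

lemma has_integral_weight:
  assumes "a > -1" "b > -1"
  shows "(weight a b has_integral Beta (b + 1) (a + 1)) {0..1}"
  using has_integral_Beta_real[of "b + 1" "a + 1"] assms
  by (simp add: weight_def[abs_def] mult.commute)

lemma integral_U01_eqI:
  fixes f :: "real \<Rightarrow> real"
  assumes "(f has_integral I) {0..1}" "integrable U01 f"
  shows "(LINT x|U01. f x) = I"
proof -
  have i: "set_integrable lebesgue {0<..<1} f" using assms(2) by (simp add: set_integrable_U01)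
  have "(LINT x|U01. f x) = integral {0<..<1} f"
    using set_lebesgue_integral_eq_integral(2)[OF i] by (simp add: set_integral_U01)
  also have "\<dots> = integral {0..1} f" using integral_open_interval_real[of 0 1 f] by simp
  finally show ?thesis using assms(1) by (simp add: integral_unique)
qed

lemma integrable_weight:
  assumes "a > -1" "b > -1"
  shows "integrable U01 (weight a b)" "(LINT x|U01. weight a b x) = Beta (b + 1) (a + 1)"
proof -
  have "weight a b integrable_on {0..1}" using has_integral_weight[OF assms] by blast
  then have "set_integrable lebesgue {0..1} (weight a b)"
    by (rule nonnegative_absolutely_integrable_1) (simp add: weight_nonneg)
  then have "set_integrable lebesgue {0<..<1} (weight a b)" by (rule set_integrable_subset) auto
  then show i: "integrable U01 (weight a b)" by (simp add: set_integrable_U01)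
  show "(LINT x|U01. weight a b x) = Beta (b + 1) (a + 1)"
    by (rule integral_U01_eqI[OF has_integral_weight[OF assms] i])
qed

lemma AE_U01_I: "(\<And>x. x \<in> {0<..<1} \<Longrightarrow> P x) \<Longrightarrow> AE x in U01. P x"
  by (rule AE_I2) simp

lemma integrable_U01_bound:
  fixes f g :: "real \<Rightarrow> real"
  assumes "integrable U01 g" "f \<in> borel_measurable U01" "\<And>x. x \<in> {0<..<1} \<Longrightarrow> \<bar>f x\<bar> \<le> C * g x"
  shows "integrable U01 f"
proof (rule Bochner_Integration.integrable_bound[of _ "\<lambda>x. C * g x"])
  show "integrable U01 (\<lambda>x. C * g x)" using assms(1) by simp
  show "AE x in U01. norm (f x) \<le> norm (C * g x)"
    using assms(3) by (intro AE_U01_I) force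
qed (rule assms(2))

lemma continuous_measurable_U01: "continuous_on {0<..<1} f \<Longrightarrow> f \<in> borel_measurable U01" for f :: "real \<Rightarrow> real"
  by (rule continuous_imp_measurable_on_sets_lebesgue) auto

lemma integrable_weight_mult:
  assumes ab: "a > -1" "b > -1" and f: "continuous_on {0..1} f"
  shows "integrable U01 (\<lambda>x. weight a b x * f x)"
proof -
  obtain C where C: "\<And>x. x \<in> {0..1} \<Longrightarrow> \<bar>f x\<bar> \<le> C"
    using compact_imp_bounded[OF compact_continuous_image[OF f]] unfolding bounded_iff by force
  show ?thesis
  proof (rule integrable_U01_bound[OF integrable_weight(1)[OF ab], of _ C])
    show "(\<lambda>x. weight a b x * f x) \<in> borel_measurable U01"
      by (intro borel_measurable_times measurable_weight continuous_measurable_U01 continuous_on_subset[OF f]) auto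
    fix x :: real assume "x \<in> {0<..<1}"
    then have "\<bar>f x\<bar> \<le> C" using C[of x] by auto
    then show "\<bar>weight a b x * f x\<bar> \<le> C * weight a b x"
      using weight_nonneg[of a b x] mult_right_mono[of "\<bar>f x\<bar>" C "weight a b x"]
      by (simp add: abs_mult mult.commute)
  qed
qed

text \<open>The exceptional set allows for a singularity of the kernel in the interior.\<close>

lemma integral_U01_derivative:
  fixes \<Phi> :: "real \<Rightarrow> real"
  assumes "continuous_on {0..1} \<Phi>" "finite S"
    and "\<And>x. x \<in> {0<..<1} - S \<Longrightarrow> (\<Phi> has_real_derivative \<phi> x) (at x)"
    and "integrable U01 \<phi>"
  shows "(LINT x|U01. \<phi> x) = \<Phi> 1 - \<Phi> 0"
  by (rule integral_U01_eqI[OF fundamental_theorem_of_calculus_interior_strong[OF assms(2)] assms(4)])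
    (use assms in \<open>auto simp flip: has_real_derivative_iff_has_vector_derivative\<close>)

text \<open>The functions \<open>jacobi_G\<close> as elements of the polynomial type, which gives access
  to degrees and leading coefficients.\<close>

definition jacobi_poly :: "nat \<Rightarrow> real \<Rightarrow> real \<Rightarrow> real poly" where
  "jacobi_poly n a b = (\<Sum>k\<le>n. smult (((real n + a) gchoose (n - k)) * ((real n + b) gchoose k))
     ([:-1, 1:] ^ k * [:0, 1:] ^ (n - k)))"

lemma poly_jacobi_poly: "poly (jacobi_poly n a b) x = jacobi_G n a b x"
proof -
  have "(2 * x - 1 - 1) / 2 = x - 1" "(2 * x - 1 + 1) / 2 = x" by simp_all
  then show ?thesis by (simp only: jacobi_G_def jacobi_P_def) (simp add: jacobi_poly_def poly_sum mult.assoc)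
qed

lemma degree_coeff_monic_product:
  assumes "k \<le> n"
  shows "degree ([:-1, 1:] ^ k * [:0, 1::real:] ^ (n - k)) = n" "coeff ([:-1, 1:] ^ k * [:0, 1::real:] ^ (n - k)) n = 1"
proof -
  show d: "degree ([:-1, 1:] ^ k * [:0, 1::real:] ^ (n - k)) = n"
    using assms by (simp add: degree_mult_eq degree_power_eq)
  have "lead_coeff ([:-1, 1:] ^ k * [:0, 1::real:] ^ (n - k)) = 1"
    by (simp add: lead_coeff_mult lead_coeff_power)
  then show "coeff ([:-1, 1:] ^ k * [:0, 1::real:] ^ (n - k)) n = 1" by (simp add: d)
qed

lemma degree_jacobi_poly: "degree (jacobi_poly n a b) \<le> n"
  unfolding jacobi_poly_def
  by (intro degree_sum_le order.trans[OF degree_smult_le]) (auto simp: degree_coeff_monic_product)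

text \<open>Each summand of the definition has leading coefficient a product of two binomials, and
  Vandermonde's identity adds them up.\<close>

lemma coeff_jacobi_poly: "coeff (jacobi_poly n a b) n = (2 * real n + a + b) gchoose n"
proof -
  have "coeff (jacobi_poly n a b) n = (\<Sum>k\<le>n. ((real n + a) gchoose (n - k)) * ((real n + b) gchoose k))"
    by (simp add: jacobi_poly_def coeff_sum degree_coeff_monic_product)
  also have "\<dots> = (\<Sum>k=0..n. ((real n + b) gchoose k) * ((real n + a) gchoose (n - k)))"
    by (simp add: atMost_atLeast0 mult.commute)
  also have "\<dots> = ((real n + b) + (real n + a)) gchoose n" by (rule gbinomial_Vandermonde)
  finally show ?thesis by (simp add: algebra_simps)
qed

lemma continuous_jacobi_G: "continuous_on S (jacobi_G n a b)"
  unfolding poly_jacobi_poly[symmetric, abs_def] by (intro continuous_intros)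

lemma gbinomial_step: "(z - real m) * (z gchoose m) = real (Suc m) * (z gchoose Suc m)" for z :: real
  using gbinomial_mult_1[of z m] by (simp add: algebra_simps)

text \<open>One step of the Rodrigues formula. It is the source of orthogonality, of the norms and of
  the decay of Jacobi coefficients: it trades one order of the polynomial for one derivative and raises
  both exponents of the weight by one. Expanding both sides in powers of \<open>x\<close> and
  \<open>1 - x\<close>, each coefficient on the right arises from two neighbouring ones on the left,
  and \<open>gbinomial_step\<close> shows that they contribute the fractions
  \<open>(n - k + 1) / (n + 1)\<close> and \<open>k / (n + 1)\<close> of it.\<close>

lemma rodrigues_step:
  assumes x: "x \<in> {0<..<1}"
  shows "((\<lambda>x. weight (a + 1) (b + 1) x * jacobi_G n (a + 1) (b + 1) x) has_real_derivative
      - (real n + 1) * (weight a b x * jacobi_G (Suc n) a b x)) (at x)"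
proof -
  define N where "N = real n + 1"
  define c where "c k = ((N + a) gchoose (n - k)) * ((N + b) gchoose k) * (-1) ^ k" for k
  define e where "e k x = (1 - x) powr (a + real k) * x powr (b + N - real k)" for k and x :: real
  define d where "d k = ((N + a) gchoose (Suc n - k)) * ((N + b) gchoose k) * (-1) ^ k * e k x" for k
  have expand: "weight A B x * jacobi_G m A B x
      = (\<Sum>k\<le>m. ((real m + A) gchoose (m - k)) * ((real m + B) gchoose k) * (-1) ^ k
            * ((1 - x) powr (A + real k) * x powr (B + real m - real k)))"
    if "x \<in> {0<..<1}" for A B x and m :: nat
  proof -
    have "weight A B x * ((real m + A gchoose (m - k)) * (real m + B gchoose k) * ((2 * x - 1 - 1) / 2) ^ k * ((2 * x - 1 + 1) / 2) ^ (m - k))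
        = ((real m + A) gchoose (m - k)) * ((real m + B) gchoose k) * (-1) ^ k
            * ((1 - x) powr (A + real k) * x powr (B + real m - real k))" if "k \<le> m" for k
    proof -
      have "(2 * x - 1 - 1) / 2 = - 1 * (1 - x)" "(2 * x - 1 + 1) / 2 = x" by simp_all
      moreover have "x powr (B + real m - real k) = x powr B * x ^ (m - k)"
        using \<open>x \<in> _\<close> that by (simp add: powr_realpow[symmetric] powr_add[symmetric] of_nat_diff algebra_simps)
      moreover have "(1 - x) powr (A + real k) = (1 - x) powr A * (1 - x) ^ k"
        using \<open>x \<in> _\<close> by (simp add: powr_realpow[symmetric] powr_add[symmetric])
      ultimately show ?thesis by (simp only: weight_def power_mult_distrib mult_ac)
    qed
    then show ?thesis unfolding jacobi_G_def jacobi_P_def sum_distrib_left by (intro sum.cong refl) simp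
  qed
  have D: "((\<lambda>x. (1 - x) powr (a + 1 + real k) * x powr (b + 1 + real n - real k)) has_real_derivative
      - (a + 1 + real k) * e k x + (b + N - real k) * e (Suc k) x) (at x)" for k
  proof -
    have "((\<lambda>x. (1 - x) powr (a + 1 + real k) * x powr (b + 1 + real n - real k)) has_real_derivative
      - (a + 1 + real k) * (1 - x) powr (a + 1 + real k - 1) * x powr (b + 1 + real n - real k)
      + (b + 1 + real n - real k) * x powr (b + 1 + real n - real k - 1) * (1 - x) powr (a + 1 + real k)) (at x)"
      using x by (auto intro!: derivative_eq_intros simp: algebra_simps)
    moreover have "a + 1 + real k - 1 = a + real k" "b + 1 + real n - real k = b + N - real k"
      "b + N - real k - 1 = b + N - real (Suc k)" "a + 1 + real k = a + real (Suc k)" by (simp_all add: N_def)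
    ultimately show ?thesis by (simp only: e_def mult_ac)
  qed
  have "((\<lambda>x. \<Sum>k\<le>n. c k * ((1 - x) powr (a + 1 + real k) * x powr (b + 1 + real n - real k))) has_real_derivative
      (\<Sum>k\<le>n. c k * (- (a + 1 + real k) * e k x + (b + N - real k) * e (Suc k) x))) (at x)"
    by (intro DERIV_sum DERIV_cmult D)
  then have "((\<lambda>x. weight (a + 1) (b + 1) x * jacobi_G n (a + 1) (b + 1) x) has_real_derivative
      (\<Sum>k\<le>n. c k * (- (a + 1 + real k) * e k x + (b + N - real k) * e (Suc k) x))) (at x)"
  proof (rule has_field_derivative_transform_within_open[of _ _ _ "{0<..<1}"])
    show "(\<Sum>k\<le>n. c k * ((1 - x) powr (a + 1 + real k) * x powr (b + 1 + real n - real k)))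
       = weight (a + 1) (b + 1) x * jacobi_G n (a + 1) (b + 1) x" if "x \<in> {0<..<1}" for x
      by (subst expand[OF that], intro sum.cong refl) (simp add: c_def N_def add_ac)
  qed (use x in auto)
  also have "(\<Sum>k\<le>n. c k * (- (a + 1 + real k) * e k x + (b + N - real k) * e (Suc k) x))
      = (\<Sum>k\<le>n. - (N - real k) * d k - real (Suc k) * d (Suc k))"
  proof (intro sum.cong refl)
    fix k assume "k \<in> {..n}"
    then have k: "Suc n - k = Suc (n - k)" "N + a - real (n - k) = a + 1 + real k" "N - real k = real (Suc (n - k))"
      by (auto simp: N_def of_nat_diff Suc_diff_le)
    have 1: "(a + 1 + real k) * ((N + a) gchoose (n - k)) = (N - real k) * ((N + a) gchoose (Suc n - k))"
      using gbinomial_step[of "N + a" "n - k"] by (simp only: k)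
    have 2: "(b + N - real k) * ((N + b) gchoose k) = real (Suc k) * ((N + b) gchoose (Suc k))"
      using gbinomial_step[of "N + b" k] by (simp add: algebra_simps)
    have "c k * (- (a + 1 + real k) * e k x + (b + N - real k) * e (Suc k) x)
       = - ((a + 1 + real k) * ((N + a) gchoose (n - k))) * ((N + b) gchoose k) * (-1) ^ k * e k x
         + ((b + N - real k) * ((N + b) gchoose k)) * ((N + a) gchoose (n - k)) * (-1) ^ k * e (Suc k) x"
      by (simp add: c_def algebra_simps)
    also have "\<dots> = - (N - real k) * d k - real (Suc k) * d (Suc k)"
      unfolding 1 2 by (simp add: d_def algebra_simps)
    finally show "c k * (- (a + 1 + real k) * e k x + (b + N - real k) * e (Suc k) x)
       = - (N - real k) * d k - real (Suc k) * d (Suc k)" .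
  qed
  also have "\<dots> = - ((\<Sum>k\<le>n. (N - real k) * d k) + (\<Sum>k\<le>n. real (Suc k) * d (Suc k)))"
    unfolding sum.distrib[symmetric] sum_negf[symmetric] by (intro sum.cong refl) (simp add: algebra_simps)
  also have "(\<Sum>k\<le>n. (N - real k) * d k) = (\<Sum>k\<le>Suc n. (N - real k) * d k)" by (simp add: N_def)
  also have "(\<Sum>k\<le>n. real (Suc k) * d (Suc k)) = (\<Sum>k\<le>Suc n. real k * d k)"
    by (simp add: sum.atMost_Suc_shift del: sum.atMost_Suc)
  also have "(\<Sum>k\<le>Suc n. (N - real k) * d k) + (\<Sum>k\<le>Suc n. real k * d k) = N * (\<Sum>k\<le>Suc n. d k)"
    unfolding sum.distrib[symmetric] sum_distrib_left by (intro sum.cong refl) (simp add: algebra_simps)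
  also have "(\<Sum>k\<le>Suc n. d k) = weight a b x * jacobi_G (Suc n) a b x"
    unfolding expand[OF x] d_def e_def
    by (intro sum.cong refl) (simp add: N_def add_ac)
  finally show ?thesis by (simp only: N_def mult_minus_left)
qed

lemma continuous_weight:
  assumes "a > 0" "b > 0" shows "continuous_on {0..1} (weight a b)"
proof -
  have "continuous_on {0..1} (\<lambda>x. (1 - x) powr a * x powr b)"
    using assms by (intro continuous_intros continuous_on_powr') auto
  then show ?thesis by (simp add: weight_def[abs_def])
qed

text \<open>There are no boundary terms because the raised weight vanishes at both end points.\<close>

lemma rodrigues_integration_by_parts:
  assumes ab: "a > -1" "b > -1"
  shows "(LINT x|U01. weight a b x * (jacobi_G (Suc n) a b x * poly q x))
    = (LINT x|U01. weight (a + 1) (b + 1) x * (jacobi_G n (a + 1) (b + 1) x * poly (pderiv q) x)) / (real n + 1)"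
proof -
  define \<Phi> where "\<Phi> x = weight (a + 1) (b + 1) x * jacobi_G n (a + 1) (b + 1) x * poly q x" for x
  let ?f = "\<lambda>x. weight a b x * (jacobi_G (Suc n) a b x * poly q x)"
  let ?g = "\<lambda>x. weight (a + 1) (b + 1) x * (jacobi_G n (a + 1) (b + 1) x * poly (pderiv q) x)"
  have i: "integrable U01 ?f" "integrable U01 ?g"
    using ab by (intro integrable_weight_mult continuous_intros continuous_jacobi_G; simp)+
  have "(LINT x|U01. - (real n + 1) * ?f x + ?g x) = \<Phi> 1 - \<Phi> 0"
  proof (rule integral_U01_derivative[where S = "{}"])
    show "continuous_on {0..1} \<Phi>"
      unfolding \<Phi>_def[abs_def] using ab
      by (intro continuous_intros continuous_jacobi_G continuous_weight) auto
    show "integrable U01 (\<lambda>x. - (real n + 1) * ?f x + ?g x)"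
      by (intro Bochner_Integration.integrable_add integrable_mult_right i)
    fix x :: real assume "x \<in> {0<..<1} - {}"
    then have x: "x \<in> {0<..<1}" by simp
    show "(\<Phi> has_real_derivative - (real n + 1) * ?f x + ?g x) (at x)"
      unfolding \<Phi>_def[abs_def]
      by (rule DERIV_cong[OF DERIV_mult[OF rodrigues_step[OF x] poly_DERIV]]) (simp add: algebra_simps)
  qed simp
  also have "\<Phi> 1 - \<Phi> 0 = 0" using ab by (simp add: \<Phi>_def weight_def)
  also have "(LINT x|U01. - (real n + 1) * ?f x + ?g x) = - (real n + 1) * (LINT x|U01. ?f x) + (LINT x|U01. ?g x)"
    by (subst Bochner_Integration.integral_add[OF integrable_mult_right[OF i(1)] i(2)])
      (simp only: integral_mult_right_zero)
  finally show ?thesis by (simp add: field_simps)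
qed

text \<open>Integrating by parts \<open>n\<close> times turns a polynomial of degree at most
  \<open>n\<close> into a constant and leaves the integral of a weight. Orthogonality is the case of
  degree less than \<open>n\<close>.\<close>

lemma jacobi_moment:
  assumes "a > -1" "b > -1" "degree q \<le> n"
  shows "(LINT x|U01. weight a b x * (jacobi_G n a b x * poly q x)) = coeff q n * Beta (b + real n + 1) (a + real n + 1)"
  using assms
proof (induction n arbitrary: a b q)
  case 0
  then obtain c where q: "q = [:c:]" by (metis degree_eq_zeroE le_zero_eq)
  have "(LINT x|U01. weight a b x * (jacobi_G 0 a b x * poly q x)) = (LINT x|U01. c * weight a b x)"
    by (simp add: q jacobi_G_def jacobi_P_def mult.commute)
  also have "\<dots> = c * Beta (b + 1) (a + 1)" using integrable_weight(2)[of a b] 0 by simp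
  finally show ?case by (simp add: q)
next
  case (Suc n)
  have "degree (pderiv q) \<le> n" using Suc.prems by (simp add: degree_pderiv)
  then have "(LINT x|U01. weight (a + 1) (b + 1) x * (jacobi_G n (a + 1) (b + 1) x * poly (pderiv q) x))
      = coeff (pderiv q) n * Beta (b + 1 + real n + 1) (a + 1 + real n + 1)"
    using Suc.prems by (intro Suc.IH) auto
  then show ?case
    using rodrigues_integration_by_parts[of a b n q] Suc.prems
    by (simp add: coeff_pderiv add_ac)
qed

definition jacobi_norm2 :: "nat \<Rightarrow> real \<Rightarrow> real \<Rightarrow> real" where
  "jacobi_norm2 n a b = ((2 * real n + a + b) gchoose n) * Beta (b + real n + 1) (a + real n + 1)"

lemma jacobi_norm2:
  assumes "a > -1" "b > -1"
  shows "(LINT x|U01. weight a b x * (jacobi_G n a b x * jacobi_G n a b x)) = jacobi_norm2 n a b"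
  using jacobi_moment[OF assms degree_jacobi_poly[of n a b]]
  by (simp add: poly_jacobi_poly coeff_jacobi_poly jacobi_norm2_def)

lemma lead_coeff_jacobi_pos:
  assumes "a > -1" "b > -1" shows "(2 * real n + a + b) gchoose n > 0"
proof -
  have "(\<Prod>i=0..<n. 2 * real n + a + b - real i) > 0"
    using assms by (intro prod_pos) auto
  then show ?thesis by (simp add: gbinomial_prod_rev)
qed

lemma Beta_pos: "x > 0 \<Longrightarrow> y > 0 \<Longrightarrow> Beta x y > (0::real)"
  by (simp add: Beta_def)

lemma jacobi_norm2_pos:
  assumes "a > -1" "b > -1" shows "jacobi_norm2 n a b > 0"
  unfolding jacobi_norm2_def using assms by (intro mult_pos_pos lead_coeff_jacobi_pos Beta_pos) auto

lemma jacobi_orthogonal: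
  assumes "a > -1" "b > -1" "m \<noteq> n"
  shows "(LINT x|U01. weight a b x * (jacobi_G m a b x * jacobi_G n a b x)) = 0"
proof -
  have *: "(LINT x|U01. weight a b x * (jacobi_G m a b x * jacobi_G n a b x)) = 0" if "n < m" for m n
    using jacobi_moment[OF assms(1,2), of "jacobi_poly n a b" m] degree_jacobi_poly[of n a b] that
    by (simp add: poly_jacobi_poly coeff_eq_0)
  show ?thesis using *[of n m] *[of m n] assms(3) by (cases "n < m") (auto simp: mult.commute)
qed

lemma U01_infinite: "\<not> (AE x in U01. False)"
proof
  assume "AE x in U01. False"
  then have "emeasure U01 (space U01) = 0"
    using AE_iff_measurable[OF sets.top, of U01 "\<lambda>x. False"] by blast
  moreover have "emeasure U01 (space U01) = 1" by (simp add: emeasure_restrict_space)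
  ultimately show False by simp
qed

lemma poly_weight_zero:
  assumes ab: "a > -1" "b > -1" and 0: "(LINT x|U01. weight a b x * (poly R x * poly R x)) = 0"
  shows "R = 0"
proof (rule ccontr)
  assume R: "R \<noteq> 0"
  have i: "integrable U01 (\<lambda>x. weight a b x * (poly R x * poly R x))"
    by (intro integrable_weight_mult ab continuous_intros)
  have "AE x in U01. 0 \<le> weight a b x * (poly R x * poly R x)"
    by (intro AE_I2 mult_nonneg_nonneg weight_nonneg zero_le_square)
  from integral_nonneg_eq_0_iff_AE[OF i this] 0
  have "AE x in U01. weight a b x * (poly R x * poly R x) = 0" by simp
  moreover have "AE x in U01. x \<in> {0<..<1}" by (rule AE_U01_I)
  moreover have "AE x in U01. x \<notin> {x. poly R x = 0}"
  proof -
    have "negligible {x. poly R x = 0}" using poly_roots_finite[OF R] by (rule negligible_finite)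
    then have "{x. poly R x = 0} \<in> null_sets lebesgue" by (simp add: negligible_iff_null_sets)
    then have "AE x in lebesgue. x \<notin> {x. poly R x = 0}" by (rule AE_not_in)
    then show ?thesis by (subst AE_restrict_space_iff) auto
  qed
  ultimately have "AE x in U01. False"
  proof eventually_elim
    case (elim x) then show ?case using weight_pos[of x a b] by auto
  qed
  then show False using U01_infinite by blast
qed

text \<open>The difference has lower degree and is orthogonal to itself. The lemma identifies an
  orthogonal polynomial from its leading coefficient alone.\<close>

lemma poly_orthogonal_unique:
  assumes ab: "a > -1" "b > -1" and dP: "degree P \<le> n" and dQ: "degree Q \<le> n"
    and c: "coeff P n = coeff Q n"
    and oP: "\<And>R. degree R < n \<Longrightarrow> (LINT x|U01. weight a b x * (poly P x * poly R x)) = 0"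
    and oQ: "\<And>R. degree R < n \<Longrightarrow> (LINT x|U01. weight a b x * (poly Q x * poly R x)) = 0"
  shows "P = Q"
proof -
  define R where "R = P - Q"
  have dR: "degree R \<le> n" unfolding R_def using dP dQ by (rule degree_diff_le)
  have cR: "coeff R n = 0" using c by (simp add: R_def)
  have "R = 0"
  proof (cases "degree R < n")
    case True
    have i: "integrable U01 (\<lambda>x. weight a b x * (poly S x * poly R x))" for S
      by (intro integrable_weight_mult ab continuous_intros)
    have "(LINT x|U01. weight a b x * (poly R x * poly R x))
        = (LINT x|U01. weight a b x * (poly P x * poly R x) - weight a b x * (poly Q x * poly R x))"
      by (simp add: R_def algebra_simps)
    also have "\<dots> = 0"
      by (subst Bochner_Integration.integral_diff[OF i i]) (simp add: oP[OF True] oQ[OF True])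
    finally show ?thesis by (rule poly_weight_zero[OF ab])
  next
    case False
    then have "degree R = n" using dR by simp
    then show ?thesis using cR by (simp flip: leading_coeff_0_iff)
  qed
  then show ?thesis by (simp add: R_def)
qed

text \<open>By uniqueness it suffices that the derivative is orthogonal to lower degrees for the raised
  weight. Integration by parts moves the derivative onto \<open>weight (a + 1) (b + 1)\<close>
  times the test polynomial, and the result is \<open>weight a b\<close> times a polynomial of degree
  too small to be seen by \<open>jacobi_poly (Suc n) a b\<close>.\<close>

lemma pderiv_jacobi_poly:
  assumes ab: "a > -1" "b > -1"
  shows "pderiv (jacobi_poly (Suc n) a b) = smult (real n + a + b + 2) (jacobi_poly n (a + 1) (b + 1))"
proof (rule poly_orthogonal_unique[of "a + 1" "b + 1" _ n])
  show "degree (pderiv (jacobi_poly (Suc n) a b)) \<le> n"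
    using degree_jacobi_poly[of "Suc n" a b] by (simp add: degree_pderiv)
  show "degree (smult (real n + a + b + 2) (jacobi_poly n (a + 1) (b + 1))) \<le> n"
    by (intro order.trans[OF degree_smult_le] degree_jacobi_poly)
  have "real (Suc n) * ((2 * real (Suc n) + a + b) gchoose Suc n) = (2 * real (Suc n) + a + b - real n) * ((2 * real (Suc n) + a + b) gchoose n)"
    by (rule gbinomial_step[symmetric])
  then show "coeff (pderiv (jacobi_poly (Suc n) a b)) n = coeff (smult (real n + a + b + 2) (jacobi_poly n (a + 1) (b + 1))) n"
    by (simp add: coeff_pderiv coeff_jacobi_poly algebra_simps)
next
  fix R :: "real poly" assume R: "degree R < n"
  show "(LINT x|U01. weight (a + 1) (b + 1) x * (poly (smult (real n + a + b + 2) (jacobi_poly n (a + 1) (b + 1))) x * poly R x)) = 0"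
    using jacobi_moment[of "a + 1" "b + 1" "smult (real n + a + b + 2) R" n] R ab
    by (simp add: poly_jacobi_poly coeff_eq_0 mult_ac)
  let ?P = "jacobi_poly (Suc n) a b"
  \<comment> \<open>The polynomial with \<open>weight a b * S\<close> equal to the derivative of
    \<open>weight (a + 1) (b + 1) * R\<close>.\<close>
  define S where "S = [:0, - (a + 1):] * R + [:b + 1, - (b + 1):] * R + [:0, 1, -1:] * pderiv R"
  have dS: "degree S \<le> n"
  proof (cases "degree R = 0")
    case True
    then have z: "pderiv R = 0" by (simp add: pderiv_eq_0_iff)
    show ?thesis unfolding S_def z mult_zero_right add_0_right using R True
      by (intro degree_add_le order.trans[OF degree_mult_le]) auto
  next
    case False
    then show ?thesis unfolding S_def using R
      by (intro degree_add_le order.trans[OF degree_mult_le]) (auto simp: degree_pderiv)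
  qed
  have S: "weight a b x * poly S x = - (a + 1) * weight a (b + 1) x * poly R x
      + (b + 1) * weight (a + 1) b x * poly R x + weight (a + 1) (b + 1) x * poly (pderiv R) x"
    if "x \<in> {0<..<1}" for x
    using that by (simp add: S_def weight_def powr_add algebra_simps)
  let ?f = "\<lambda>x. weight (a + 1) (b + 1) x * (poly (pderiv ?P) x * poly R x)"
  let ?g = "\<lambda>x. weight a b x * (poly ?P x * poly S x)"
  define \<Phi> where "\<Phi> x = poly ?P x * (weight (a + 1) (b + 1) x * poly R x)" for x
  have i: "integrable U01 ?f" "integrable U01 ?g"
    using ab by (intro integrable_weight_mult continuous_intros; simp)+
  have "(LINT x|U01. ?f x + ?g x) = \<Phi> 1 - \<Phi> 0"
  proof (rule integral_U01_derivative[where S = "{}"])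
    show "continuous_on {0..1} \<Phi>"
      unfolding \<Phi>_def[abs_def] using ab by (intro continuous_intros continuous_weight) auto
    show "integrable U01 (\<lambda>x. ?f x + ?g x)" by (intro Bochner_Integration.integrable_add i)
    fix x :: real assume "x \<in> {0<..<1} - {}"
    then have x: "x \<in> {0<..<1}" by simp
    have "((\<lambda>x. weight (a + 1) (b + 1) x) has_real_derivative
        (- (a + 1) * weight a (b + 1) x + (b + 1) * weight (a + 1) b x)) (at x)"
      unfolding weight_def using x by (auto intro!: derivative_eq_intros simp: algebra_simps)
    moreover have g: "?g x = poly ?P x * (- (a + 1) * weight a (b + 1) x * poly R x
      + (b + 1) * weight (a + 1) b x * poly R x + weight (a + 1) (b + 1) x * poly (pderiv R) x)"
      unfolding S[OF x, symmetric] by simp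
    ultimately show "(\<Phi> has_real_derivative ?f x + ?g x) (at x)"
      unfolding \<Phi>_def[abs_def] g
      by (intro DERIV_cong[OF DERIV_mult[OF poly_DERIV[of ?P] DERIV_mult[OF _ poly_DERIV[of R]]]])
        (assumption, simp add: algebra_simps)
  qed simp
  also have "\<Phi> 1 - \<Phi> 0 = 0" using ab by (simp add: \<Phi>_def weight_def)
  finally have "(LINT x|U01. ?f x) = - (LINT x|U01. ?g x)"
    by (subst (asm) Bochner_Integration.integral_add[OF i]) simp
  also have "(LINT x|U01. ?g x) = coeff S (Suc n) * Beta (b + real (Suc n) + 1) (a + real (Suc n) + 1)"
    unfolding poly_jacobi_poly
  proof (rule jacobi_moment[OF ab])
    show "degree S \<le> Suc n" using dS by simp
  qed
  also have "coeff S (Suc n) = 0" using dS by (intro coeff_eq_0) simp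
  finally show "(LINT x|U01. ?f x) = 0" by simp
qed (use ab in auto)

lemma wip_U01: "wip a b g h = (LINT x|U01. weight a b x * g x * h x)"
  by (simp add: wip_def set_integral_U01)

section \<open>Integrals of Euler type\<close>

lemma Gamma_reflection_real:
  fixes x :: real
  shows "Gamma x * Gamma (1 - x) = pi / sin (pi * x)"
proof -
  have "complex_of_real (Gamma x * Gamma (1 - x)) = complex_of_real (pi / sin (pi * x))"
    using Gamma_reflection_complex[of "complex_of_real x"]
    by (simp add: Gamma_complex_of_real[symmetric] flip: sin_of_real)
  then show ?thesis by (simp only: of_real_eq_iff)
qed

lemma nn_integral_U01:
  "(\<integral>\<^sup>+x. f x \<partial>U01) = (\<integral>\<^sup>+x. f x * indicator {0<..<1} x \<partial>lborel)"
  by (simp add: nn_integral_restrict_space nn_integral_completion)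

lemma nn_integral_U01_closed:
  "(\<integral>\<^sup>+x. f x * indicator {0..1} x \<partial>lborel) = (\<integral>\<^sup>+x. f x \<partial>U01)"
  unfolding nn_integral_U01
proof (rule nn_integral_cong_AE)
  have "AE x in lborel. x \<noteq> (0::real)" "AE x in lborel. x \<noteq> (1::real)" by (rule AE_lborel_singleton)+
  then show "AE x in lborel. f x * indicator {0..1} x = f x * indicator {0<..<1::real} x"
    by eventually_elim (auto simp: indicator_def)
qed

lemma borel_measurable_pair_U01:
  assumes "case_prod F \<in> borel_measurable (borel \<Otimes>\<^sub>M borel)"
  shows "(\<lambda>(x, y). F (x::real) (y::real)) \<in> borel_measurable (U01 \<Otimes>\<^sub>M U01)"
proof -
  have id: "(\<lambda>t. t) \<in> borel_measurable U01" by (rule borel_measurable_U01) simp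
  have "(\<lambda>z. (fst z, snd z)) \<in> U01 \<Otimes>\<^sub>M U01 \<rightarrow>\<^sub>M borel \<Otimes>\<^sub>M borel"
    by (intro measurable_Pair measurable_compose[OF measurable_fst id] measurable_compose[OF measurable_snd id])
  from measurable_compose[OF this assms] show ?thesis by (simp add: case_prod_unfold)
qed

lemma integrable_U01_nn:
  assumes f: "f \<in> borel_measurable borel" and nn: "\<And>x. x \<in> {0<..<1} \<Longrightarrow> 0 \<le> f x"
    and v: "(\<integral>\<^sup>+x. ennreal (f x) \<partial>U01) = ennreal v" "0 \<le> v"
  shows "integrable U01 f" "(LINT x|U01. f x) = v"
  using nn_integral_eq_integrable[of f U01 v] borel_measurable_U01[OF f] AE_U01_I[OF nn] v by auto

lemma nn_integral_weight:
  assumes "a > -1" "b > -1"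
  shows "(\<integral>\<^sup>+x. ennreal (weight a b x) \<partial>U01) = ennreal (Beta (b + 1) (a + 1))"
  using nn_integral_eq_integral[OF integrable_weight(1)[OF assms]] integrable_weight(2)[OF assms]
  by (simp add: weight_nonneg)

text \<open>The exponents are those for which the hypergeometric integral is elementary: the Moebius
  substitution \<open>t * (1 - \<sigma>) / (1 - \<sigma> * t)\<close> fixes 0 and 1 and
  absorbs the third factor. It is stated for the nonnegative integral so that it can be used inside
  Tonelli's theorem without integrability conditions.\<close>

lemma euler_integral_nn:
  fixes q c \<sigma> :: real
  assumes q: "q > -1" and c: "c > -1" and \<sigma>: "0 \<le> \<sigma>" "\<sigma> < 1"
  shows "(\<integral>\<^sup>+t. ennreal (t powr q * (1 - t) powr c * (1 - \<sigma> * t) powr (- (q + c + 2))) \<partial>U01)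
    = ennreal (Beta (q + 1) (c + 1) * (1 - \<sigma>) powr (- q - 1))"
proof -
  define F where "F t = t powr q * (1 - t) powr c * (1 - \<sigma> * t) powr (- (q + c + 2))" for t
  define f where "f \<tau> = \<tau> powr q * (1 - \<tau>) powr c" for \<tau> :: real
  define g where "g t = t * (1 - \<sigma>) / (1 - \<sigma> * t)" for t
  define g' where "g' t = (1 - \<sigma>) / (1 - \<sigma> * t)\<^sup>2" for t
  have [measurable]: "f \<in> borel_measurable borel" "F \<in> borel_measurable borel"
    unfolding f_def[abs_def] F_def[abs_def] by measurable
  have pos: "1 - \<sigma> * t > 0" if "t \<in> {0..1}" for t
    using mult_left_le[of t \<sigma>] that \<sigma> by auto
  have g01: "g 0 = 0" "g 1 = 1" using \<sigma> by (auto simp: g_def)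
  have eq: "f (g t) * g' t = (1 - \<sigma>) powr (q + 1) * F t" if t: "t \<in> {0..1}" for t
  proof -
    let ?d = "1 - \<sigma> * t"
    have d: "?d > 0" by (rule pos[OF t])
    have "1 - g t = (1 - t) / ?d" using d by (simp add: g_def field_simps)
    then have "f (g t) = (t powr q * (1 - \<sigma>) powr q / ?d powr q) * ((1 - t) powr c / ?d powr c)"
      using d t \<sigma> by (simp add: f_def g_def powr_mult powr_divide)
    moreover have "g' t = (1 - \<sigma>) powr 1 / ?d powr 2"
      using d \<sigma> by (simp add: g'_def powr_numeral)
    ultimately have "f (g t) * g' t = t powr q * (1 - t) powr c * ((1 - \<sigma>) powr q * (1 - \<sigma>) powr 1)
        / (?d powr q * ?d powr c * ?d powr 2)"
      by simp
    also have "(1 - \<sigma>) powr q * (1 - \<sigma>) powr 1 = (1 - \<sigma>) powr (q + 1)" by (simp only: powr_add)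
    also have "?d powr q * ?d powr c * ?d powr 2 = ?d powr (q + c + 2)" by (simp only: powr_add)
    finally show ?thesis by (simp only: F_def powr_minus divide_inverse mult_ac)
  qed
  have "(\<integral>\<^sup>+x. f x * indicator {g 0..g 1} x \<partial>lborel) = (\<integral>\<^sup>+x. f (g x) * g' x * indicator {0..1} x \<partial>lborel)"
  proof (rule nn_integral_substitution)
    show "set_borel_measurable borel {g 0..g 1} f" by (simp add: set_borel_measurable_def)
    fix t :: real assume t: "t \<in> {0..1}"
    show "(g has_real_derivative g' t) (at t)"
      unfolding g_def[abs_def] g'_def using pos[OF t]
      by (auto intro!: derivative_eq_intros simp: field_simps power2_eq_square)
    show "0 \<le> g' t" using \<sigma> by (simp add: g'_def)
  next
    have "1 - \<sigma> * x \<noteq> 0" if "x \<in> {0..1}" for x using pos[OF that] by simp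
    then show "continuous_on {0..1} g'"
      unfolding g'_def[abs_def] by (intro continuous_intros) auto
  qed simp
  also have "(\<integral>\<^sup>+x. f x * indicator {g 0..g 1} x \<partial>lborel) = (\<integral>\<^sup>+x. ennreal (f x) \<partial>U01)"
    unfolding g01 nn_integral_U01_closed[symmetric]
    by (intro nn_integral_cong) (auto simp: indicator_def)
  also have "\<dots> = (\<integral>\<^sup>+x. ennreal (weight c q x) \<partial>U01)" by (simp add: f_def weight_def mult.commute)
  also have "\<dots> = ennreal (Beta (q + 1) (c + 1))" by (rule nn_integral_weight[OF c q])
  also have "(\<integral>\<^sup>+x. f (g x) * g' x * indicator {0..1} x \<partial>lborel)
      = (\<integral>\<^sup>+x. ennreal ((1 - \<sigma>) powr (q + 1)) * ennreal (F x) * indicator {0..1} x \<partial>lborel)"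
    by (intro nn_integral_cong) (auto simp: indicator_def eq ennreal_mult'[symmetric])
  also have "\<dots> = ennreal ((1 - \<sigma>) powr (q + 1)) * (\<integral>\<^sup>+x. ennreal (F x) \<partial>U01)"
    unfolding nn_integral_U01_closed
    by (rule nn_integral_cmult) (intro measurable_compose[OF borel_measurable_U01 measurable_ennreal], simp)
  finally have A: "ennreal (Beta (q + 1) (c + 1)) = ennreal ((1 - \<sigma>) powr (q + 1)) * (\<integral>\<^sup>+x. ennreal (F x) \<partial>U01)" .
  have "(1 - \<sigma>) powr (- q - 1) * (1 - \<sigma>) powr (q + 1) = 1"
    using \<sigma> by (simp add: powr_add[symmetric])
  then have "(\<integral>\<^sup>+x. ennreal (F x) \<partial>U01) = ennreal ((1 - \<sigma>) powr (- q - 1)) * (ennreal ((1 - \<sigma>) powr (q + 1)) * (\<integral>\<^sup>+x. ennreal (F x) \<partial>U01))"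
    by (simp add: mult.assoc[symmetric] ennreal_mult'[symmetric])
  also have "\<dots> = ennreal (Beta (q + 1) (c + 1) * (1 - \<sigma>) powr (- q - 1))"
    unfolding A[symmetric] by (simp add: ennreal_mult''[symmetric] mult.commute)
  finally show ?thesis by (simp add: F_def)
qed

text \<open>The part of a weighted Riesz kernel to the right of its singularity \<open>s\<close>. The
  part to the left is obtained by the reflection of the unit interval. The parameters are the exponents
  at \<open>0\<close>, \<open>1\<close> and \<open>s\<close>.\<close>

definition rhalf :: "real \<Rightarrow> real \<Rightarrow> real \<Rightarrow> real \<Rightarrow> real \<Rightarrow> real" where
  "rhalf p q c s x = (if s < x then x powr p * (1 - x) powr q * (x - s) powr c else 0)"

lemma rhalf_measurable [measurable]: "rhalf p q c s \<in> borel_measurable borel"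
  unfolding rhalf_def[abs_def] by measurable

lemma rhalf_nonneg: "0 \<le> rhalf p q c s x" by (simp add: rhalf_def)

text \<open>The substitution \<open>x = 1 - (1 - s) * t\<close> maps the interval from
  \<open>s\<close> to 1 to the unit interval and gives an integral of Euler's type.\<close>

lemma nn_integral_rhalf:
  assumes s: "0 < s" "s < 1"
  shows "(\<integral>\<^sup>+x. ennreal (rhalf p q c s x) \<partial>U01)
    = ennreal ((1 - s) powr (q + c + 1)) * (\<integral>\<^sup>+t. ennreal (t powr q * (1 - t) powr c * (1 - (1 - s) * t) powr p) \<partial>U01)"
proof -
  let ?F = "\<lambda>t. t powr q * (1 - t) powr c * (1 - (1 - s) * t) powr p"
  have [measurable]: "?F \<in> borel_measurable borel" by measurable
  define X where "X t = 1 - (1 - s) * t" for t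
  have e: "1 + - (1 - s) * t = X t" for t by (simp add: X_def algebra_simps)
  have "(\<integral>\<^sup>+x. ennreal (rhalf p q c s x) \<partial>U01)
     = ennreal \<bar>- (1 - s)\<bar> * (\<integral>\<^sup>+t. ennreal (rhalf p q c s (X t)) * indicator {0<..<1} (X t) \<partial>lborel)"
    unfolding nn_integral_U01 e[symmetric]
    by (rule nn_integral_real_affine[where t = 1 and c = "- (1 - s)"]) (use s in auto)
  also have "(\<integral>\<^sup>+t. ennreal (rhalf p q c s (X t)) * indicator {0<..<1} (X t) \<partial>lborel)
     = (\<integral>\<^sup>+t. ennreal ((1 - s) powr (q + c)) * ennreal (?F t) * indicator {0<..<1} t \<partial>lborel)"
  proof (rule nn_integral_cong_AE)
    have *: "ennreal (rhalf p q c s (X t)) * indicator {0<..<1} (X t)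
       = ennreal ((1 - s) powr (q + c)) * ennreal (?F t) * indicator {0<..<1} t" if "t \<noteq> 0" for t
    proof (cases "0 < t \<and> t < 1")
      case True
      have x: "1 - X t = (1 - s) * t" "X t - s = (1 - s) * (1 - t)" by (simp_all add: X_def algebra_simps)
      have "(1 - s) * t < (1 - s) * 1" by (rule mult_strict_left_mono) (use s True in auto)
      then have gt: "s < X t" by (simp add: X_def)
      have lt: "X t < 1" using s True by (simp add: X_def)
      have "rhalf p q c s (X t) = X t powr p * ((1 - s) powr q * t powr q) * ((1 - s) powr c * (1 - t) powr c)"
        unfolding rhalf_def using gt s True by (simp only: x if_True powr_mult)
      also have "\<dots> = (1 - s) powr (q + c) * ?F t" by (simp add: powr_add mult_ac X_def)
      finally have "ennreal (rhalf p q c s (X t)) = ennreal ((1 - s) powr (q + c)) * ennreal (?F t)"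
        by (simp only: ennreal_mult'[OF powr_ge_zero])
      moreover have "X t \<in> {0<..<1}" "t \<in> {0<..<1}" using True gt lt s by auto
      ultimately show ?thesis by (simp only: indicator_simps)
    next
      case False
      have "rhalf p q c s (X t) = 0 \<or> X t \<notin> {0<..<1}"
      proof (cases "t < 0")
        case True
        then have "(1 - s) * t < 0" using s by (simp add: mult_less_0_iff)
        then have "X t > 1" unfolding X_def by linarith
        then show ?thesis by simp
      next
        case f: False
        then have "1 \<le> t" using False that by simp
        then have "(1 - s) * 1 \<le> (1 - s) * t" using s by (intro mult_left_mono) auto
        then have "1 - s \<le> (1 - s) * t" by (simp only: mult_1_right)
        then have "X t \<le> s" unfolding X_def by linarith
        then show ?thesis by (simp add: rhalf_def)
      qed
      then show ?thesis using False by auto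
    qed
    have "AE t in lborel. t \<noteq> (0::real)" by (rule AE_lborel_singleton)
    then show "AE t in lborel. ennreal (rhalf p q c s (X t)) * indicator {0<..<1} (X t)
       = ennreal ((1 - s) powr (q + c)) * ennreal (?F t) * indicator {0<..<1} t"
      by eventually_elim (rule *)
  qed
  also have "\<dots> = ennreal ((1 - s) powr (q + c)) * (\<integral>\<^sup>+t. ennreal (?F t) \<partial>U01)"
    unfolding nn_integral_U01 by (simp add: nn_integral_cmult mult.assoc)
  also have "ennreal \<bar>- (1 - s)\<bar> * \<dots> = ennreal (\<bar>- (1 - s)\<bar> * (1 - s) powr (q + c)) * (\<integral>\<^sup>+t. ennreal (?F t) \<partial>U01)"
    by (simp add: ennreal_mult' mult.assoc)
  also have "\<bar>- (1 - s)\<bar> * (1 - s) powr (q + c) = (1 - s) powr (q + c + 1)"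
    using s by (simp add: powr_add)
  finally show ?thesis .
qed

lemma rhalf_explicit:
  assumes s: "0 < s" "s < 1" and qc: "q > -1" "c > -1" and p: "p + q + c = -2"
  shows "integrable U01 (rhalf p q c s)"
    "(LINT x|U01. rhalf p q c s x) = (1 - s) powr (q + c + 1) * (Beta (q + 1) (c + 1) * s powr (- q - 1))"
proof -
  have "p = - (q + c + 2)" using p by simp
  then have "(\<integral>\<^sup>+x. ennreal (rhalf p q c s x) \<partial>U01)
     = ennreal ((1 - s) powr (q + c + 1) * (Beta (q + 1) (c + 1) * s powr (- q - 1)))"
    using nn_integral_rhalf[OF s, of p q c] euler_integral_nn[OF qc, of "1 - s"] s
    by (simp add: ennreal_mult'[symmetric])
  from integrable_U01_nn[OF rhalf_measurable rhalf_nonneg this]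
  show "integrable U01 (rhalf p q c s)"
    "(LINT x|U01. rhalf p q c s x) = (1 - s) powr (q + c + 1) * (Beta (q + 1) (c + 1) * s powr (- q - 1))"
    using Beta_pos[of "q + 1" "c + 1"] qc by auto
qed

text \<open>On \<open>x > s\<close> the factor \<open>x powr p\<close> is bounded above and below,
  so integrability for one value of \<open>p\<close>, the one with an elementary integral, gives it for
  all.\<close>

lemma rhalf_integrable:
  assumes s: "0 < s" "s < 1" and qc: "q > -1" "c > -1"
  shows "integrable U01 (rhalf p q c s)"
proof -
  \<comment> \<open>The exponent for which \<open>rhalf_explicit\<close> applies.\<close>
  let ?p = "- 2 - q - c"
  show ?thesis
  proof (rule integrable_U01_bound[OF rhalf_explicit(1)[OF s qc, of ?p], of _ "1 + s powr (p - ?p)"])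
    fix x :: real assume x: "x \<in> {0<..<1}"
    show "\<bar>rhalf p q c s x\<bar> \<le> (1 + s powr (p - ?p)) * rhalf ?p q c s x"
    proof (cases "s < x")
      case True
      have "x powr (p - ?p) \<le> 1 + s powr (p - ?p)"
      proof (cases "p - ?p \<ge> 0")
        case t: True
        then have "x powr (p - ?p) \<le> 1" using x by (intro powr_le1) auto
        then show ?thesis by (simp add: add_increasing2)
      next
        case False
        then have "x powr (p - ?p) \<le> s powr (p - ?p)" using True s by (intro powr_mono2') auto
        then show ?thesis by simp
      qed
      then have "x powr (p - ?p) * rhalf ?p q c s x \<le> (1 + s powr (p - ?p)) * rhalf ?p q c s x"
        by (intro mult_right_mono rhalf_nonneg)
      moreover have "x powr (p - ?p) * rhalf ?p q c s x = rhalf p q c s x"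
      proof -
        have "x powr (p - ?p) * x powr ?p = x powr p" by (simp only: powr_add[symmetric]) simp
        then show ?thesis by (simp add: rhalf_def mult.assoc[symmetric])
      qed
      ultimately show ?thesis using rhalf_nonneg[of p q c s x] by simp
    qed (simp add: rhalf_def)
  qed (simp_all add: borel_measurable_U01[OF rhalf_measurable])
qed

text \<open>For \<open>p = 0\<close> there is no dependence on \<open>s\<close>: the integral is
  complete after rescaling, and the reflection formula of the Gamma function evaluates it.\<close>

lemma rhalf_zero:
  assumes s: "0 < s" "s < 1" and q: "-1 < q" "q < 0"
  shows "(LINT x|U01. rhalf 0 q (-1 - q) s x) = pi / sin (pi * (q + 1))"
proof -
  have "(\<integral>\<^sup>+t. ennreal (t powr q * (1 - t) powr (-1 - q) * (1 - (1 - s) * t) powr 0) \<partial>U01)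
     = (\<integral>\<^sup>+t. ennreal (weight (-1 - q) q t) \<partial>U01)"
  proof (intro nn_integral_cong)
    fix t assume "t \<in> space U01"
    then have t: "0 < t" "t < 1" by auto
    have "(1 - s) * t < 1 * 1" using s t by (intro mult_strict_mono) auto
    then show "ennreal (t powr q * (1 - t) powr (-1 - q) * (1 - (1 - s) * t) powr 0) = ennreal (weight (-1 - q) q t)"
      by (simp add: weight_def mult.commute)
  qed
  also have "\<dots> = ennreal (Beta (q + 1) (- q))" using nn_integral_weight[of "-1 - q" q] q by simp
  finally have "(\<integral>\<^sup>+x. ennreal (rhalf 0 q (-1 - q) s x) \<partial>U01) = ennreal (Beta (q + 1) (- q))"
    using nn_integral_rhalf[OF s, of 0 q "-1 - q"] s by simp
  from integrable_U01_nn(2)[OF rhalf_measurable rhalf_nonneg this] Beta_pos[of "q + 1" "- q"] q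
  have "(LINT x|U01. rhalf 0 q (-1 - q) s x) = Beta (q + 1) (- q)" by simp
  also have "\<dots> = Gamma (q + 1) * Gamma (1 - (q + 1))" by (simp add: Beta_def)
  finally show ?thesis by (simp only: Gamma_reflection_real)
qed

text \<open>For these exponents the integral is hypergeometric and not elementary, but it equals an
  incomplete Beta integral up to a factor. To see this, one writes with
  \<open>\<sigma> = 1 - s\<close> the product of \<open>\<sigma> powr (-p)\<close> and
  \<open>(1 - \<sigma> * t) powr p\<close> as the integral of its derivative in
  \<open>\<sigma>\<close>. That derivative has the exponent \<open>p - 1\<close>, for which the inner
  integral is the elementary one of \<open>euler_integral_nn\<close>.\<close>

lemma rhalf_beta_split:
  assumes s: "0 < s" "s < 1" and q: "-1 < q" and p: "p < 0" and c: "c = -1 - p - q" "c > -1"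
  shows "(\<integral>\<^sup>+x. ennreal (rhalf p q c s x) \<partial>U01)
    = ennreal (- p * Beta (q + 1) (c + 1)) * (\<integral>\<^sup>+y. ennreal (weight (- q - 1) (- p - 1) y) * indicator {..<1 - s} y \<partial>U01)"
proof -
  define \<sigma> where "\<sigma> = 1 - s"
  have \<sigma>: "0 < \<sigma>" "\<sigma> < 1" using s by (auto simp: \<sigma>_def)
  define k where "k t = t powr q * (1 - t) powr c" for t :: real
  define w where "w y t = - p * y powr (- p - 1) * (1 - y * t) powr (p - 1)" for y t :: real
  \<comment> \<open>The function \<open>w\<close> is the derivative of
    \<open>y powr (- p) * (1 - y * t) powr p\<close> with respect to
    \<open>y\<close>.\<close>
  have inner: "(\<integral>\<^sup>+y. ennreal (w y t) * indicator {..<\<sigma>} y \<partial>U01) = ennreal (\<sigma> powr (- p) * (1 - \<sigma> * t) powr p)"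
    if t: "t \<in> {0<..<1}" for t
  proof -
    have pos: "1 - y * t > 0" if "y \<in> {0..\<sigma>}" for y
    proof -
      have "y * t \<le> \<sigma> * 1" using that t \<sigma> by (intro mult_mono) auto
      then show ?thesis using \<sigma> by simp
    qed
    define \<Phi> where "\<Phi> y = y powr (- p) * (1 - y * t) powr p" for y
    have "((\<lambda>y. w y t) has_integral \<Phi> \<sigma> - \<Phi> 0) {0..\<sigma>}"
    proof (rule fundamental_theorem_of_calculus_interior)
      have "1 - y * t \<noteq> 0" if "y \<in> {0..\<sigma>}" for y using pos[OF that] by simp
      then have "continuous_on {0..\<sigma>} (\<lambda>y. (1 - y * t) powr p)"
        by (intro continuous_on_powr continuous_intros) auto
      moreover have "continuous_on {0..\<sigma>} (\<lambda>y. y powr (- p))"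
        using p by (intro continuous_on_powr' continuous_intros) auto
      ultimately show "continuous_on {0..\<sigma>} \<Phi>" unfolding \<Phi>_def[abs_def] by (intro continuous_on_mult)
      fix y assume y: "y \<in> {0<..<\<sigma>}"
      then have y1: "1 - y * t > 0" by (intro pos) auto
      have a: "y powr (- p) = y powr (- p - 1) * y" using y by (simp add: powr_diff)
      have b: "(1 - y * t) powr p = (1 - y * t) powr (p - 1) * (1 - y * t)" using y1 by (simp add: powr_diff)
      have "(\<Phi> has_real_derivative
         (- p) * y powr (- p - 1) * (1 - y * t) powr p - p * t * (1 - y * t) powr (p - 1) * y powr (- p)) (at y)"
        unfolding \<Phi>_def[abs_def] using y y1 by (auto intro!: derivative_eq_intros simp: algebra_simps)
      also have "(- p) * y powr (- p - 1) * (1 - y * t) powr p - p * t * (1 - y * t) powr (p - 1) * y powr (- p) = w y t"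
        unfolding a b w_def by (simp add: algebra_simps)
      finally show "(\<Phi> has_vector_derivative w y t) (at y)"
        by (simp add: has_real_derivative_iff_has_vector_derivative)
    qed (use \<sigma> in auto)
    then have hi: "((\<lambda>y. w y t) has_integral \<Phi> \<sigma>) {0..\<sigma>}" by (simp add: \<Phi>_def)
    have wn: "0 \<le> w y t" for y unfolding w_def using p by (intro mult_nonneg_nonneg) auto
    have "(\<integral>\<^sup>+y. ennreal (w y t) * indicator {..<\<sigma>} y \<partial>U01) = (\<integral>\<^sup>+y. ennreal (indicator {0..\<sigma>} y * w y t) \<partial>lborel)"
      unfolding nn_integral_U01
    proof (rule nn_integral_cong_AE)
      have "AE x in lborel. x \<noteq> (0::real)" "AE x in lborel. x \<noteq> \<sigma>" by (rule AE_lborel_singleton)+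
      then show "AE y in lborel. ennreal (w y t) * indicator {..<\<sigma>} y * indicator {0<..<1} y = ennreal (indicator {0..\<sigma>} y * w y t)"
        by eventually_elim (use \<sigma> in \<open>auto simp: indicator_def\<close>)
    qed
    also have "\<dots> = ennreal (\<Phi> \<sigma>)"
    proof -
      have "(\<lambda>y. w y t) integrable_on {0..\<sigma>}" using hi by blast
      then have "set_integrable lebesgue {0..\<sigma>} (\<lambda>y. w y t)"
        by (rule nonnegative_absolutely_integrable_1) (rule wn)
      then have i: "integrable lebesgue (\<lambda>y. indicator {0..\<sigma>} y * w y t)" by (simp add: set_integrable_def)
      have "(LINT y|lebesgue. indicator {0..\<sigma>} y * w y t) = \<Phi> \<sigma>"
        using set_lebesgue_integral_eq_integral(2)[OF \<open>set_integrable lebesgue {0..\<sigma>} (\<lambda>y. w y t)\<close>] hi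
        by (simp add: set_lebesgue_integral_def integral_unique)
      then show ?thesis
        using nn_integral_eq_integral[OF i] wn by (simp add: nn_integral_completion)
    qed
    finally show ?thesis by (simp add: \<Phi>_def)
  qed
  interpret finite_measure U01 by (rule finite_measure_lebesgue_on) auto
  interpret P: pair_sigma_finite U01 U01 ..
  have id[measurable]: "(\<lambda>t. t) \<in> borel_measurable U01" by (rule borel_measurable_U01) simp
  have km[measurable]: "(\<lambda>t. ennreal (k t)) \<in> borel_measurable U01"
    unfolding k_def by measurable
  have "(\<integral>\<^sup>+x. ennreal (rhalf p q c s x) \<partial>U01)
     = ennreal (\<sigma> powr (q + c + 1)) * (\<integral>\<^sup>+t. ennreal (k t * (1 - \<sigma> * t) powr p) \<partial>U01)"
    unfolding nn_integral_rhalf[OF s] k_def \<sigma>_def ..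
  also have "\<dots> = (\<integral>\<^sup>+t. ennreal (\<sigma> powr (q + c + 1)) * ennreal (k t * (1 - \<sigma> * t) powr p) \<partial>U01)"
    by (rule nn_integral_cmult[symmetric]) (unfold k_def, measurable)
  also have "\<dots> = (\<integral>\<^sup>+t. (\<integral>\<^sup>+y. ennreal (k t) * (ennreal (w y t) * indicator {..<\<sigma>} y) \<partial>U01) \<partial>U01)"
  proof (rule nn_integral_cong)
    fix t assume "t \<in> space U01"
    then have t: "t \<in> {0<..<1}" by simp
    have e: "q + c + 1 = - p" using c by simp
    have "(\<integral>\<^sup>+y. ennreal (k t) * (ennreal (w y t) * indicator {..<\<sigma>} y) \<partial>U01)
        = ennreal (k t) * (\<integral>\<^sup>+y. ennreal (w y t) * indicator {..<\<sigma>} y \<partial>U01)"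
      by (rule nn_integral_cmult) (unfold w_def, measurable)
    then show "ennreal (\<sigma> powr (q + c + 1)) * ennreal (k t * (1 - \<sigma> * t) powr p)
       = (\<integral>\<^sup>+y. ennreal (k t) * (ennreal (w y t) * indicator {..<\<sigma>} y) \<partial>U01)"
      unfolding inner[OF t] e by (simp add: ennreal_mult'[symmetric] k_def mult_ac)
  qed
  also have "\<dots> = (\<integral>\<^sup>+y. (\<integral>\<^sup>+t. ennreal (k t) * (ennreal (w y t) * indicator {..<\<sigma>} y) \<partial>U01) \<partial>U01)"
    by (rule P.Fubini'[where f = "\<lambda>y t. ennreal (k t) * (ennreal (w y t) * indicator {..<\<sigma>} y)"])
      (rule borel_measurable_pair_U01, unfold w_def k_def, measurable)
  also have "\<dots> = (\<integral>\<^sup>+y. ennreal (- p * Beta (q + 1) (c + 1)) * (ennreal (weight (- q - 1) (- p - 1) y) * indicator {..<\<sigma>} y) \<partial>U01)"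
  proof (rule nn_integral_cong)
    fix y assume "y \<in> space U01"
    then have y: "0 < y" "y < 1" by auto
    have e: "p - 1 = - (q + c + 2)" using c by simp
    have B: "Beta (q + 1) (c + 1) > 0" using q c by (intro Beta_pos) auto
    have a0: "0 \<le> - p * y powr (- p - 1)" using p by (intro mult_nonneg_nonneg) auto
    have pB: "0 \<le> - p * Beta (q + 1) (c + 1)" using p B by (intro mult_nonneg_nonneg) auto
    have "(\<integral>\<^sup>+t. ennreal (k t) * (ennreal (w y t) * indicator {..<\<sigma>} y) \<partial>U01)
       = (\<integral>\<^sup>+t. (ennreal (- p * y powr (- p - 1)) * indicator {..<\<sigma>} y) * ennreal (t powr q * (1 - t) powr c * (1 - y * t) powr (- (q + c + 2))) \<partial>U01)"
    proof (rule nn_integral_cong)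
      fix t
      have "k t * w y t = (- p * y powr (- p - 1)) * (t powr q * (1 - t) powr c * (1 - y * t) powr (- (q + c + 2)))"
        unfolding k_def w_def e by (simp add: mult_ac)
      moreover have "0 \<le> k t" by (simp add: k_def)
      ultimately have "ennreal (k t) * ennreal (w y t)
        = ennreal (- p * y powr (- p - 1)) * ennreal (t powr q * (1 - t) powr c * (1 - y * t) powr (- (q + c + 2)))"
        by (simp only: ennreal_mult'[symmetric] a0)
      then show "ennreal (k t) * (ennreal (w y t) * indicator {..<\<sigma>} y)
        = (ennreal (- p * y powr (- p - 1)) * indicator {..<\<sigma>} y) * ennreal (t powr q * (1 - t) powr c * (1 - y * t) powr (- (q + c + 2)))"
        by (cases "y < \<sigma>") simp_all
    qed
    also have "\<dots> = (ennreal (- p * y powr (- p - 1)) * indicator {..<\<sigma>} y) * ennreal (Beta (q + 1) (c + 1) * (1 - y) powr (- q - 1))"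
      by (subst nn_integral_cmult) (measurable, subst euler_integral_nn, use q c y in auto)
    also have "\<dots> = ennreal (- p * Beta (q + 1) (c + 1)) * (ennreal (weight (- q - 1) (- p - 1) y) * indicator {..<\<sigma>} y)"
    proof -
      have "(- p * y powr (- p - 1)) * (Beta (q + 1) (c + 1) * (1 - y) powr (- q - 1))
        = (- p * Beta (q + 1) (c + 1)) * weight (- q - 1) (- p - 1) y" by (simp add: weight_def)
      then have "ennreal (- p * y powr (- p - 1)) * ennreal (Beta (q + 1) (c + 1) * (1 - y) powr (- q - 1))
        = ennreal (- p * Beta (q + 1) (c + 1)) * ennreal (weight (- q - 1) (- p - 1) y)"
        by (simp only: ennreal_mult'[OF a0, symmetric] ennreal_mult'[OF pB, symmetric])
      then show ?thesis by (cases "y < \<sigma>") simp_all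
    qed
    finally show "(\<integral>\<^sup>+t. ennreal (k t) * (ennreal (w y t) * indicator {..<\<sigma>} y) \<partial>U01)
       = ennreal (- p * Beta (q + 1) (c + 1)) * (ennreal (weight (- q - 1) (- p - 1) y) * indicator {..<\<sigma>} y)" .
  qed
  also have "\<dots> = ennreal (- p * Beta (q + 1) (c + 1)) * (\<integral>\<^sup>+y. ennreal (weight (- q - 1) (- p - 1) y) * indicator {..<1 - s} y \<partial>U01)"
    unfolding \<sigma>_def by (rule nn_integral_cmult) (unfold weight_def, measurable)
  finally show ?thesis .
qed

lemma rhalf_beta_split_integral:
  assumes s: "0 < s" "s < 1" and q: "-1 < q" "q < 0" and p: "p < 0" "-1 < p" and c: "c = -1 - p - q" "c > -1"
  shows "(LINT x|U01. rhalf p q c s x)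
    = - p * Beta (q + 1) (c + 1) * (LINT y|U01. weight (- q - 1) (- p - 1) y * indicator {..<1 - s} y)"
proof -
  have iw: "integrable U01 (weight (- q - 1) (- p - 1))" by (rule integrable_weight) (use p q in auto)
  have i: "integrable U01 (\<lambda>y. weight (- q - 1) (- p - 1) y * indicator {..<1 - s} y)"
  proof (rule integrable_U01_bound[OF iw, of _ 1])
    have "(\<lambda>y. indicator {..<1 - s} y :: real) \<in> borel_measurable U01" by (rule borel_measurable_U01) simp
    then show "(\<lambda>y. weight (- q - 1) (- p - 1) y * indicator {..<1 - s} y) \<in> borel_measurable U01"
      by (intro borel_measurable_times measurable_weight)
    show "\<bar>weight (- q - 1) (- p - 1) y * indicator {..<1 - s} y\<bar> \<le> 1 * weight (- q - 1) (- p - 1) y" for y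
      using weight_nonneg[of "- q - 1" "- p - 1" y] by (auto simp: indicator_def)
  qed
  let ?I = "LINT y|U01. weight (- q - 1) (- p - 1) y * indicator {..<1 - s} y"
  have I0: "?I \<ge> 0" by (intro integral_nonneg_AE AE_I2 mult_nonneg_nonneg weight_nonneg) simp
  have pB: "- p * Beta (q + 1) (c + 1) \<ge> 0"
    using p Beta_pos[of "q + 1" "c + 1"] q c by (intro mult_nonneg_nonneg) auto
  have "(\<integral>\<^sup>+y. ennreal (weight (- q - 1) (- p - 1) y) * indicator {..<1 - s} y \<partial>U01)
    = (\<integral>\<^sup>+y. ennreal (weight (- q - 1) (- p - 1) y * indicator {..<1 - s} y) \<partial>U01)"
    by (intro nn_integral_cong) (simp add: indicator_def)
  also have "\<dots> = ennreal ?I"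
    by (rule nn_integral_eq_integral[OF i]) (intro AE_I2 mult_nonneg_nonneg weight_nonneg, simp)
  finally have "(\<integral>\<^sup>+x. ennreal (rhalf p q c s x) \<partial>U01) = ennreal (- p * Beta (q + 1) (c + 1) * ?I)"
    by (simp only: rhalf_beta_split[OF s q(1) p(1) c] ennreal_mult'[OF pB])
  from integrable_U01_nn(2)[OF rhalf_measurable rhalf_nonneg this mult_nonneg_nonneg[OF pB I0]] show ?thesis .
qed

section \<open>The two-sided Riesz kernel\<close>

lemma integral_U01_reflect:
  fixes f :: "real \<Rightarrow> real"
  shows "integrable U01 (\<lambda>x. f (1 - x)) \<longleftrightarrow> integrable U01 f" "(LINT x|U01. f (1 - x)) = (LINT x|U01. f x)"
proof -
  let ?g = "\<lambda>x. indicator {0<..<1} x *\<^sub>R f x"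
  have e: "indicator {0<..<1} x *\<^sub>R f (1 - x) = ?g (1 + - 1 * x)" for x :: real by (auto simp: indicator_def)
  show "integrable U01 (\<lambda>x. f (1 - x)) \<longleftrightarrow> integrable U01 f"
    unfolding set_integrable_U01[symmetric] set_integrable_def e
    by (rule lebesgue_integrable_real_affine_iff) simp
  show "(LINT x|U01. f (1 - x)) = (LINT x|U01. f x)"
    unfolding set_integral_U01[symmetric] set_lebesgue_integral_def e
    using lebesgue_integral_real_affine[of "-1" ?g 1] by simp
qed

text \<open>The kernel of the two-sided fractional operator, normalized by the sines instead of by their
  quotients \<open>r\<close> and \<open>1 - r\<close>, which makes it symmetric under exchange of
  \<open>p\<close> and \<open>q\<close> together with that of the arguments.\<close>

definition riesz_kernel :: "real \<Rightarrow> real \<Rightarrow> real \<Rightarrow> real \<Rightarrow> real" where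
  "riesz_kernel p q x s = (if s < x then sin (pi * (q + 1)) else sin (pi * (p + 1))) * \<bar>x - s\<bar> powr (-1 - p - q)"

locale riesz_params =
  fixes p q :: real
  assumes p: "-1 < p" "p \<le> 0" and q: "-1 < q" "q \<le> 0" and pq: "-1 < p + q" "p + q < 0"
begin

abbreviation "c \<equiv> -1 - p - q"

lemma swap: "riesz_params q p" by unfold_locales (use p q pq in auto)

lemma c_gt: "c > -1" using pq by simp

lemma sin_nonneg: "0 \<le> sin (pi * (q + 1))" "0 \<le> sin (pi * (p + 1))"
  using p q by (intro sin_ge_zero; simp)+

lemma riesz_kernel_nonneg: "0 \<le> riesz_kernel p q x s"
  unfolding riesz_kernel_def using sin_nonneg by simp

lemma riesz_kernel_eq_halves:
  assumes "x \<in> {0<..<1}"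
  shows "weight q p x * riesz_kernel p q x s
    = sin (pi * (q + 1)) * rhalf p q c s x + sin (pi * (p + 1)) * rhalf q p c (1 - s) (1 - x)"
  using assms by (auto simp: riesz_kernel_def rhalf_def weight_def mult_ac abs_if)

text \<open>The reflection formula turns the sine into Gamma factors, which leaves an expression that is
  symmetric in \<open>p\<close> and \<open>q\<close>.\<close>

lemma sin_Beta: "sin (pi * (q + 1)) * - p * Beta (q + 1) (c + 1) * (Gamma (- p) * Gamma (- q)) = pi * Gamma (c + 1)"
  if "p < 0" "q < 0"
proof -
  have G: "Gamma (- p + 1) = - p * Gamma (- p)"
    using that p by (intro Gamma_plus1) (auto dest: nonpos_Ints_nonpos)
  have B: "Beta (q + 1) (c + 1) = Gamma (q + 1) * Gamma (c + 1) / (- p * Gamma (- p))"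
  proof -
    have "(q + 1) + (c + 1) = - p + 1" by simp
    then show ?thesis by (simp only: Beta_def G)
  qed
  have "sin (pi * (q + 1)) > 0" using that q by (intro sin_gt_zero) auto
  moreover have "Gamma (q + 1) * Gamma (1 - (q + 1)) = pi / sin (pi * (q + 1))" by (rule Gamma_reflection_real)
  moreover have "1 - (q + 1) = - q" by simp
  ultimately have R: "sin (pi * (q + 1)) * (Gamma (q + 1) * Gamma (- q)) = pi"
    by (metis less_irrefl nonzero_mult_div_cancel_left times_divide_eq_right)
  have "Gamma (- p) > 0" using that by (intro Gamma_real_pos) auto
  then have Gp: "Gamma (- p) \<noteq> 0" by simp
  have "S * - p * (a * d / (- p * Gamma (- p))) * (Gamma (- p) * b) = (S * (a * b)) * d" for S a b d
    using that(1) Gp by (simp add: field_simps)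
  then show ?thesis unfolding B by (simp only: R)
qed

text \<open>This balance between the two sides of the singularity is what singles out the constants of
  the kernel. It merges two incomplete Beta integrals into a complete one, and it cancels the elementary
  contributions to the first moment.\<close>

lemma sin_Beta_symmetric:
  "sin (pi * (q + 1)) * p * Beta (q + 1) (c + 1) = sin (pi * (p + 1)) * q * Beta (p + 1) (c + 1)"
proof (cases "p = 0 \<or> q = 0")
  case True
  then show ?thesis using sin_pi by auto
next
  case False
  then have pq0: "p < 0" "q < 0" using p q by auto
  interpret S: riesz_params q p by (rule swap)
  have "Gamma (- p) * Gamma (- q) \<noteq> 0"
  proof -
    have "Gamma (- p) > 0" "Gamma (- q) > 0" using pq0 by (intro Gamma_real_pos; simp)+
    then show ?thesis by simp
  qed
  moreover have "sin (pi * (q + 1)) * - p * Beta (q + 1) (c + 1) * (Gamma (- p) * Gamma (- q))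
      = sin (pi * (p + 1)) * - q * Beta (p + 1) (c + 1) * (Gamma (- p) * Gamma (- q))"
    using sin_Beta[OF pq0] S.sin_Beta[OF pq0(2,1)] by (simp add: mult.commute add_ac diff_diff_eq)
  ultimately have "sin (pi * (q + 1)) * - p * Beta (q + 1) (c + 1) = sin (pi * (p + 1)) * - q * Beta (p + 1) (c + 1)"
    by (rule mult_right_cancel[THEN iffD1])
  then show ?thesis by simp
qed

lemma riesz_integrable:
  assumes s: "0 < s" "s < 1"
  shows "integrable U01 (\<lambda>x. weight q p x * riesz_kernel p q x s)"
proof -
  have "integrable U01 (rhalf p q c s)" by (rule rhalf_integrable[OF s q(1) c_gt])
  moreover have "integrable U01 (\<lambda>x. rhalf q p c (1 - s) (1 - x))"
    by (rule integral_U01_reflect(1)[THEN iffD2, OF rhalf_integrable]) (use s p c_gt in auto)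
  ultimately have "integrable U01 (\<lambda>x. sin (pi * (q + 1)) * rhalf p q c s x + sin (pi * (p + 1)) * rhalf q p c (1 - s) (1 - x))"
    by (intro Bochner_Integration.integrable_add integrable_mult_right)
  then show ?thesis by (subst Bochner_Integration.integrable_cong[OF refl riesz_kernel_eq_halves]) auto
qed

lemma riesz_integral_halves:
  assumes s: "0 < s" "s < 1"
  shows "(LINT x|U01. weight q p x * riesz_kernel p q x s)
    = sin (pi * (q + 1)) * (LINT x|U01. rhalf p q c s x) + sin (pi * (p + 1)) * (LINT x|U01. rhalf q p c (1 - s) x)"
proof -
  have 1: "integrable U01 (rhalf p q c s)" by (rule rhalf_integrable[OF s q(1) c_gt])
  have 2: "integrable U01 (\<lambda>x. rhalf q p c (1 - s) (1 - x))"
    by (rule integral_U01_reflect(1)[THEN iffD2, OF rhalf_integrable]) (use s p c_gt in auto)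
  have "(LINT x|U01. weight q p x * riesz_kernel p q x s)
    = (LINT x|U01. sin (pi * (q + 1)) * rhalf p q c s x + sin (pi * (p + 1)) * rhalf q p c (1 - s) (1 - x))"
    by (rule Bochner_Integration.integral_cong[OF refl riesz_kernel_eq_halves]) auto
  also have "\<dots> = sin (pi * (q + 1)) * (LINT x|U01. rhalf p q c s x) + sin (pi * (p + 1)) * (LINT x|U01. rhalf q p c (1 - s) (1 - x))"
    by (subst Bochner_Integration.integral_add[OF integrable_mult_right[OF 1] integrable_mult_right[OF 2]])
      (simp only: integral_mult_right_zero)
  also have "(LINT x|U01. rhalf q p c (1 - s) (1 - x)) = (LINT x|U01. rhalf q p c (1 - s) x)"
    by (rule integral_U01_reflect(2))
  finally show ?thesis .
qed

text \<open>By \<open>rhalf_beta_split\<close> the two sides of the kernel give incomplete Beta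
  integrals over complementary intervals, with equal factors by \<open>sin_Beta_symmetric\<close>. They
  add up to a complete one, and so the dependence on \<open>s\<close> disappears.\<close>

lemma riesz_integral_generic:
  assumes s: "0 < s" "s < 1" and p0: "p < 0" and q0: "q < 0"
  shows "(LINT x|U01. weight q p x * riesz_kernel p q x s) = pi"
proof -
  let ?w = "weight (- q - 1) (- p - 1)"
  let ?D = "sin (pi * (q + 1)) * - p * Beta (q + 1) (c + 1)"
  have D': "sin (pi * (p + 1)) * - q * Beta (p + 1) (c + 1) = ?D" using sin_Beta_symmetric by simp
  have iw: "integrable U01 ?w" by (rule integrable_weight) (use p q p0 q0 in auto)
  have ind: "(\<lambda>y. indicator A y :: real) \<in> borel_measurable U01" if "A \<in> sets borel" for A :: "real set"
    by (rule borel_measurable_U01) (use that in simp)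
  have i: "integrable U01 (\<lambda>y. ?w y * indicator A y)" if "A \<in> sets borel" for A
  proof (rule integrable_U01_bound[OF iw, of _ 1])
    show "(\<lambda>y. ?w y * indicator A y) \<in> borel_measurable U01"
      by (intro borel_measurable_times measurable_weight ind that)
    show "\<bar>?w y * indicator A y\<bar> \<le> 1 * ?w y" for y
      using weight_nonneg[of "- q - 1" "- p - 1" y] by (auto simp: indicator_def)
  qed
  have A: "(LINT x|U01. rhalf p q c s x) = - p * Beta (q + 1) (c + 1) * (LINT y|U01. ?w y * indicator {..<1 - s} y)"
    by (rule rhalf_beta_split_integral) (use s p q p0 q0 c_gt in auto)
  have "(LINT x|U01. rhalf q p c (1 - s) x) = - q * Beta (p + 1) (c + 1) * (LINT y|U01. weight (- p - 1) (- q - 1) y * indicator {..<1 - (1 - s)} y)"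
    by (rule rhalf_beta_split_integral) (use s p q p0 q0 c_gt in auto)
  also have "(LINT y|U01. weight (- p - 1) (- q - 1) y * indicator {..<1 - (1 - s)} y)
     = (LINT y|U01. weight (- p - 1) (- q - 1) (1 - y) * indicator {..<1 - (1 - s)} (1 - y))"
    by (rule integral_U01_reflect(2)[symmetric])
  also have "\<dots> = (LINT y|U01. ?w y * indicator {1 - s<..} y)"
    by (intro Bochner_Integration.integral_cong refl) (auto simp: weight_def indicator_def mult.commute)
  finally have B: "(LINT x|U01. rhalf q p c (1 - s) x) = - q * Beta (p + 1) (c + 1) * (LINT y|U01. ?w y * indicator {1 - s<..} y)" .
  have "(LINT y|U01. ?w y * indicator {..<1 - s} y) + (LINT y|U01. ?w y * indicator {1 - s<..} y)
      = (LINT y|U01. ?w y * indicator {..<1 - s} y + ?w y * indicator {1 - s<..} y)"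
    by (rule Bochner_Integration.integral_add[symmetric]) (intro i, simp)+
  also have "\<dots> = (LINT y|U01. ?w y)"
  proof (rule integral_cong_AE)
    have "AE y in lebesgue. y \<noteq> 1 - s" by (auto intro!: AE_completion AE_lborel_singleton)
    then have "AE y in U01. y \<noteq> 1 - s" by (auto simp: AE_restrict_space_iff)
    then show "AE y in U01. ?w y * indicator {..<1 - s} y + ?w y * indicator {1 - s<..} y = ?w y"
      by eventually_elim (auto simp: indicator_def)
  qed (use i[of "{..<1 - s}"] i[of "{1 - s<..}"] measurable_weight in auto)
  also have "\<dots> = Beta (- p) (- q)" using integrable_weight(2)[of "- q - 1" "- p - 1"] p0 q0 by simp
  finally have sum: "(LINT y|U01. ?w y * indicator {..<1 - s} y) + (LINT y|U01. ?w y * indicator {1 - s<..} y) = Beta (- p) (- q)" .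
  have "(LINT x|U01. weight q p x * riesz_kernel p q x s)
     = ?D * (LINT y|U01. ?w y * indicator {..<1 - s} y) + (sin (pi * (p + 1)) * - q * Beta (p + 1) (c + 1)) * (LINT y|U01. ?w y * indicator {1 - s<..} y)"
    unfolding riesz_integral_halves[OF s] A B by (simp only: mult.assoc)
  also have "\<dots> = ?D * Beta (- p) (- q)" unfolding D' by (simp only: distrib_left[symmetric] sum)
  also have "\<dots> = ?D * (Gamma (- p) * Gamma (- q)) / Gamma (c + 1)" by (simp add: Beta_def add_ac diff_diff_eq)
  also have "\<dots> = pi"
  proof -
    have "Gamma (c + 1) > 0" by (rule Gamma_real_pos) (use c_gt in simp)
    then show ?thesis unfolding sin_Beta[OF p0 q0] by simp
  qed
  finally show ?thesis .
qed

text \<open>Here one of the two sines vanishes and the operator is one-sided.\<close>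

lemma riesz_integral_boundary:
  assumes s: "0 < s" "s < 1" and p0: "p = 0"
  shows "(LINT x|U01. weight q p x * riesz_kernel p q x s) = pi"
proof -
  have q0: "q < 0" using pq p0 by simp
  have "(LINT x|U01. rhalf p q c s x) = pi / sin (pi * (q + 1))"
    using rhalf_zero[OF s q(1) q0] p0 by simp
  moreover have "sin (pi * (q + 1)) > 0" using q q0 by (intro sin_gt_zero) auto
  ultimately show ?thesis unfolding riesz_integral_halves[OF s] by (simp add: p0)
qed

lemma riesz_integral:
  assumes s: "0 < s" "s < 1"
  shows "(LINT x|U01. weight q p x * riesz_kernel p q x s) = pi"
proof -
  consider "p < 0" "q < 0" | "p = 0" | "q = 0" using p q by linarith
  then show ?thesis
  proof cases
    case 1 then show ?thesis by (rule riesz_integral_generic[OF s])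
  next
    case 2 then show ?thesis by (rule riesz_integral_boundary[OF s])
  next
    case 3
    interpret S: riesz_params q p by (rule swap)
    have "(LINT x|U01. weight p q x * riesz_kernel q p x (1 - s)) = pi"
      by (rule S.riesz_integral_boundary) (use s 3 in auto)
    then show ?thesis unfolding riesz_integral_halves[OF s] S.riesz_integral_halves[of "1 - s", simplified, OF s(2,1)]
      by (simp add: add.commute diff_diff_eq)
  qed
qed

end

section \<open>Moments of the Riesz kernel and its action on Jacobi polynomials\<close>

lemma triple_power_deriv_right:
  fixes x s A B C :: real
  assumes "0 < x" "x < 1" "s < x"
  shows "((\<lambda>x. x powr (A + 1) * (1 - x) powr (B + 1) * (x - s) powr (C + 1)) has_real_derivative
    x powr A * (1 - x) powr B * (x - s) powr C
      * ((A + 1) * (1 - x) * (x - s) - (B + 1) * x * (x - s) + (C + 1) * x * (1 - x))) (at x)"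
proof -
  have e: "x powr (A + 1) = x powr A * x" "(1 - x) powr (B + 1) = (1 - x) powr B * (1 - x)"
    "(x - s) powr (C + 1) = (x - s) powr C * (x - s)" using assms by (simp_all add: powr_add)
  have "((\<lambda>x. x powr (A + 1) * (1 - x) powr (B + 1) * (x - s) powr (C + 1)) has_real_derivative
     ((A + 1) * x powr A * (1 - x) powr (B + 1) + - (B + 1) * (1 - x) powr B * x powr (A + 1)) * (x - s) powr (C + 1)
      + (C + 1) * (x - s) powr C * (x powr (A + 1) * (1 - x) powr (B + 1))) (at x)"
    using assms by (auto intro!: derivative_eq_intros simp: algebra_simps)
  then show ?thesis by (rule DERIV_cong) (simp only: e, algebra)
qed

lemma triple_power_deriv_left:
  fixes x s A B C :: real
  assumes "0 < x" "x < 1" "x < s"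
  shows "((\<lambda>x. x powr (A + 1) * (1 - x) powr (B + 1) * (s - x) powr (C + 1)) has_real_derivative
    x powr A * (1 - x) powr B * (s - x) powr C
      * ((A + 1) * (1 - x) * (s - x) - (B + 1) * x * (s - x) - (C + 1) * x * (1 - x))) (at x)"
proof -
  have e: "x powr (A + 1) = x powr A * x" "(1 - x) powr (B + 1) = (1 - x) powr B * (1 - x)"
    "(s - x) powr (C + 1) = (s - x) powr C * (s - x)" using assms by (simp_all add: powr_add)
  have "((\<lambda>x. x powr (A + 1) * (1 - x) powr (B + 1) * (s - x) powr (C + 1)) has_real_derivative
     ((A + 1) * x powr A * (1 - x) powr (B + 1) + - (B + 1) * (1 - x) powr B * x powr (A + 1)) * (s - x) powr (C + 1)
      + - (C + 1) * (s - x) powr C * (x powr (A + 1) * (1 - x) powr (B + 1))) (at x)"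
    using assms by (auto intro!: derivative_eq_intros simp: algebra_simps)
  then show ?thesis by (rule DERIV_cong) (simp only: e, algebra)
qed

lemma rhalf_shift: "x \<in> {0<..<1} \<Longrightarrow> rhalf (p + 1) q c s x = x * rhalf p q c s x"
  by (auto simp: rhalf_def powr_add)

text \<open>A contiguity relation between hypergeometric integrals: the total derivative of
  \<open>x powr p * (1 - x) powr (q + 1) * (x - s) powr (c + 1)\<close> integrates to
  0.\<close>

lemma rhalf_recurrence:
  assumes s: "0 < s" "s < 1" and qc: "q > -1" "c > -1" and p: "p + q + c = -1"
  shows "(LINT x|U01. rhalf (p + 1) q c s x)
    = (- q - c * s) * (LINT x|U01. rhalf p q c s x) - p * s * (LINT x|U01. rhalf (p - 1) q c s x)"
proof -
  \<comment> \<open>The maxima extend the function by 0 continuously to \<open>x \<le> s\<close> and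
    keep the first factor regular at 0.\<close>
  define \<Phi> where "\<Phi> x = (max x s) powr p * (1 - x) powr (q + 1) * (max (x - s) 0) powr (c + 1)" for x
  let ?\<phi> = "\<lambda>x. - rhalf (p + 1) q c s x + (- q - c * s) * rhalf p q c s x + (- p * s) * rhalf (p - 1) q c s x"
  note i = rhalf_integrable[OF s qc]
  have "(LINT x|U01. ?\<phi> x) = \<Phi> 1 - \<Phi> 0"
  proof (rule integral_U01_derivative[where S = "{s}"])
    have "continuous_on {0..1} (\<lambda>x. (max x s) powr p)"
      by (intro continuous_on_powr continuous_intros) (use s in auto)
    moreover have "continuous_on {0..1} (\<lambda>x. (1 - x) powr (q + 1))"
      by (intro continuous_on_powr' continuous_intros) (use qc in auto)
    moreover have "continuous_on {0..1} (\<lambda>x. (max (x - s) 0) powr (c + 1))"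
      by (intro continuous_on_powr' continuous_intros) (use qc in auto)
    ultimately show "continuous_on {0..1} \<Phi>" unfolding \<Phi>_def[abs_def] by (intro continuous_on_mult)
    show "integrable U01 ?\<phi>" by (intro Bochner_Integration.integrable_add integrable_mult_right integrable_minus i)
    fix x :: real assume "x \<in> {0<..<1} - {s}"
    then have x: "0 < x" "x < 1" "x \<noteq> s" by auto
    show "(\<Phi> has_real_derivative ?\<phi> x) (at x)"
    proof (cases "s < x")
      case True
      have "((\<lambda>x. x powr (p - 1 + 1) * (1 - x) powr (q + 1) * (x - s) powr (c + 1)) has_real_derivative
        x powr (p - 1) * (1 - x) powr q * (x - s) powr c
          * ((p - 1 + 1) * (1 - x) * (x - s) - (q + 1) * x * (x - s) + (c + 1) * x * (1 - x))) (at x)"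
        by (rule triple_power_deriv_right[OF x(1,2) True])
      also have "x powr (p - 1) * (1 - x) powr q * (x - s) powr c
          * ((p - 1 + 1) * (1 - x) * (x - s) - (q + 1) * x * (x - s) + (c + 1) * x * (1 - x)) = ?\<phi> x"
      proof -
        have c: "c = -1 - p - q" using p by simp
        have "x powr (p - 1 + 1) = x powr (p - 1) * x" "x powr (p - 1 + 1 + 1) = x powr (p - 1) * x * x"
          using x by (simp_all add: powr_add powr_diff)
        then have "rhalf p q c s x = rhalf (p - 1) q c s x * x" "rhalf (p + 1) q c s x = rhalf (p - 1) q c s x * x * x"
          by (simp_all add: rhalf_def)
        moreover have "x powr (p - 1) * (1 - x) powr q * (x - s) powr c = rhalf (p - 1) q c s x"
          using True by (simp add: rhalf_def)
        ultimately have e: "?\<phi> x = - (rhalf (p - 1) q c s x * x * x) + (- q - c * s) * (rhalf (p - 1) q c s x * x) + (- p * s) * rhalf (p - 1) q c s x"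
          and f: "x powr (p - 1) * (1 - x) powr q * (x - s) powr c = rhalf (p - 1) q c s x" by simp_all
        have "y * ((p - 1 + 1) * (1 - x) * (x - s) - (q + 1) * x * (x - s) + (-1 - p - q + 1) * x * (1 - x))
          = - (y * x * x) + (- q - (-1 - p - q) * s) * (y * x) + (- p * s) * y" for y by algebra
        then show ?thesis unfolding e f unfolding c .
      qed
      finally show ?thesis
        by (rule has_field_derivative_transform_within_open[of _ _ _ "{s<..}"])
          (use True in \<open>auto simp: \<Phi>_def max_def\<close>)
    next
      case False
      then have "x < s" using x by simp
      have "((\<lambda>x. 0) has_real_derivative 0) (at x)" by simp
      then have "(\<Phi> has_real_derivative 0) (at x)"
        by (rule has_field_derivative_transform_within_open[of _ _ _ "{..<s}"])
          (use \<open>x < s\<close> in \<open>auto simp: \<Phi>_def max_def\<close>)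
      then show ?thesis using False by (simp add: rhalf_def)
    qed
  qed simp
  also have "\<Phi> 1 - \<Phi> 0 = 0" using s qc by (simp add: \<Phi>_def max_def)
  also have "(LINT x|U01. ?\<phi> x) = - (LINT x|U01. rhalf (p + 1) q c s x)
    + (- q - c * s) * (LINT x|U01. rhalf p q c s x) + (- p * s) * (LINT x|U01. rhalf (p - 1) q c s x)"
  proof -
    note j = integrable_minus[OF i, of "p + 1"] integrable_mult_right[OF i, of "- q - c * s" p]
      integrable_mult_right[OF i, of "- p * s" "p - 1"]
    show ?thesis
      by (simp only: Bochner_Integration.integral_add[OF Bochner_Integration.integrable_add[OF j(1,2)] j(3)]
          Bochner_Integration.integral_add[OF j(1,2)] integral_mult_right_zero integral_minus)
  qed
  finally show ?thesis by simp
qed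

text \<open>The moments of the kernel divided by \<open>\<pi>\<close>, as polynomials in the position
  \<open>s\<close> of the singularity.\<close>

fun riesz_moment :: "real \<Rightarrow> real \<Rightarrow> nat \<Rightarrow> real poly" where
  "riesz_moment p q 0 = 1"
| "riesz_moment p q (Suc 0) = [:- q, 1 + p + q:]"
| "riesz_moment p q (Suc (Suc k)) = smult (1 / (real k + 2))
     ([:real k + 1 - q, p + q + real k + 2:] * riesz_moment p q (Suc k)
      - smult (p + real k + 1) ([:0, 1:] * riesz_moment p q k))"

lemma degree_riesz_moment: "degree (riesz_moment p q k) \<le> k"
proof (induction p q k rule: riesz_moment.induct)
  case (3 p q k)
  have a: "degree ([:real k + 1 - q, p + q + real k + 2:] * riesz_moment p q (Suc k)) \<le> Suc (Suc k)"
    using 3(1) by (intro order.trans[OF degree_mult_le]) (simp split: if_splits)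
  have b: "degree (smult (p + real k + 1) ([:0, 1:] * riesz_moment p q k)) \<le> Suc (Suc k)"
    using 3(2) by (intro order.trans[OF degree_smult_le] order.trans[OF degree_mult_le]) simp
  show ?case unfolding riesz_moment.simps
    by (rule order.trans[OF degree_smult_le degree_diff_le[OF a b]])
qed auto

lemma coeff_riesz_moment: "coeff (riesz_moment p q k) k = pochhammer (1 + p + q) k / fact k"
proof (induction p q k rule: riesz_moment.induct)
  case (3 p q k)
  have 0: "coeff (riesz_moment p q (Suc k)) (Suc (Suc k)) = 0" "coeff (riesz_moment p q k) (Suc k) = 0"
    using degree_riesz_moment[of p q "Suc k"] degree_riesz_moment[of p q k] by (auto intro: coeff_eq_0)
  have "coeff (riesz_moment p q (Suc (Suc k))) (Suc (Suc k))
    = (p + q + real k + 2) * coeff (riesz_moment p q (Suc k)) (Suc k) / (real k + 2)"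
    using 0 by (simp add: coeff_pCons)
  also have "\<dots> = pochhammer (1 + p + q) (Suc (Suc k)) / fact (Suc (Suc k))"
    unfolding 3(1) pochhammer_Suc[of _ "Suc k"] fact_Suc[of "Suc k"] by (simp add: divide_simps add_ac)
  finally show ?case .
qed (auto simp: add_ac)

text \<open>The linear extension of \<open>riesz_moment\<close>, that is, the action of the kernel on
  polynomials.\<close>

definition riesz_image :: "real \<Rightarrow> real \<Rightarrow> real poly \<Rightarrow> real poly" where
  "riesz_image p q R = (\<Sum>k\<le>degree R. smult (coeff R k) (riesz_moment p q k))"

lemma degree_riesz_image: "degree (riesz_image p q R) \<le> degree R"
  unfolding riesz_image_def
  by (intro degree_sum_le order.trans[OF degree_smult_le] order.trans[OF degree_riesz_moment]) auto

text \<open>The factor in front of the leading coefficient is, up to \<open>\<pi>\<close>, the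
  eigenvalue of the kernel in degree \<open>n\<close>, because the action is triangular with respect to
  the degree.\<close>

lemma coeff_riesz_image:
  assumes "degree R \<le> n"
  shows "coeff (riesz_image p q R) n = coeff R n * (pochhammer (1 + p + q) n / fact n)"
proof (cases "degree R = n")
  case True
  have "coeff (riesz_image p q R) n = (\<Sum>k\<le>n. coeff R k * coeff (riesz_moment p q k) n)"
    by (simp add: riesz_image_def coeff_sum True)
  also have "\<dots> = (\<Sum>k\<le>n. if k = n then coeff R n * coeff (riesz_moment p q n) n else 0)"
  proof (intro sum.cong refl)
    fix k assume "k \<in> {..n}"
    then show "coeff R k * coeff (riesz_moment p q k) n = (if k = n then coeff R n * coeff (riesz_moment p q n) n else 0)"
      using degree_riesz_moment[of p q k] by (auto intro!: coeff_eq_0)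
  qed
  finally show ?thesis by (simp add: coeff_riesz_moment)
next
  case False
  then have "degree R < n" using assms by simp
  then show ?thesis using degree_riesz_image[of p q R] by (simp add: coeff_eq_0)
qed

context riesz_params begin

lemma riesz_poly_integrable:
  assumes s: "0 < s" "s < 1"
  shows "integrable U01 (\<lambda>x. weight q p x * riesz_kernel p q x s * poly R x)"
    "\<exists>C\<ge>0. \<forall>x\<in>{0..1}. \<bar>poly R x\<bar> \<le> C"
proof -
  have "compact (poly R ` {0..1})" by (intro compact_continuous_image continuous_intros) simp
  from compact_imp_bounded[OF this] obtain C where "\<forall>y\<in>poly R ` {0..1}. norm y \<le> C"
    unfolding bounded_iff by blast
  then have C: "\<forall>x\<in>{0..1}. \<bar>poly R x\<bar> \<le> C" by simp
  then have "C \<ge> 0" using abs_ge_zero[of "poly R 0"] by (force intro: order.trans)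
  with C show "\<exists>C\<ge>0. \<forall>x\<in>{0..1}. \<bar>poly R x\<bar> \<le> C" by blast
  show "integrable U01 (\<lambda>x. weight q p x * riesz_kernel p q x s * poly R x)"
  proof (rule integrable_U01_bound[OF riesz_integrable[OF s], of _ C])
    show "(\<lambda>x. weight q p x * riesz_kernel p q x s * poly R x) \<in> borel_measurable U01"
      by (rule borel_measurable_times[OF borel_measurable_integrable[OF riesz_integrable[OF s]]
            continuous_measurable_U01]) (intro continuous_intros)
    fix x :: real assume "x \<in> {0<..<1}"
    then have "\<bar>poly R x\<bar> \<le> C" using C by auto
    have W: "0 \<le> weight q p x * riesz_kernel p q x s"
      by (intro mult_nonneg_nonneg weight_nonneg riesz_kernel_nonneg)
    have "(weight q p x * riesz_kernel p q x s) * \<bar>poly R x\<bar> \<le> (weight q p x * riesz_kernel p q x s) * C"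
      by (rule mult_left_mono[OF _ W]) fact
    then show "\<bar>weight q p x * riesz_kernel p q x s * poly R x\<bar> \<le> C * (weight q p x * riesz_kernel p q x s)"
      by (simp only: abs_mult[of "weight q p x * riesz_kernel p q x s"] abs_of_nonneg[OF W] mult.commute[of C])
  qed
qed

lemma riesz_power_integrable:
  assumes s: "0 < s" "s < 1"
  shows "integrable U01 (\<lambda>x. weight q p x * riesz_kernel p q x s * x ^ k)"
  using riesz_poly_integrable(1)[OF s, of "monom 1 k"] by (simp add: poly_monom)

text \<open>The recurrence for higher moments starts from two values, so the first moment needs a
  separate computation. The contiguity relation applied to both sides yields the same multiple of the
  respective zeroth moments, and two elementary terms that cancel by
  \<open>sin_Beta_symmetric\<close>.\<close>

lemma riesz_integral_1:
  assumes s: "0 < s" "s < 1"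
  shows "(LINT x|U01. weight q p x * riesz_kernel p q x s * x) = pi * (- q - c * s)"
proof -
  interpret S: riesz_params q p by (rule swap)
  have s': "0 < 1 - s" "1 - s < 1" using s by auto
  let ?kp = "sin (pi * (q + 1))" and ?km = "sin (pi * (p + 1))"
  let ?H0 = "LINT x|U01. rhalf p q c s x" and ?L0 = "LINT x|U01. rhalf q p c (1 - s) x"
  note iH = rhalf_integrable[OF s q(1) c_gt]
  note iL = integral_U01_reflect(1)[THEN iffD2, OF rhalf_integrable[OF s' p(1) c_gt]]
  have "(LINT x|U01. weight q p x * riesz_kernel p q x s * x)
    = (LINT x|U01. ?kp * rhalf (p + 1) q c s x + ?km * (rhalf q p c (1 - s) (1 - x) - rhalf (q + 1) p c (1 - s) (1 - x)))"
  proof (intro Bochner_Integration.integral_cong refl)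
    fix x assume "x \<in> space U01"
    then have x: "x \<in> {0<..<1}" "1 - x \<in> {0<..<1}" by auto
    show "weight q p x * riesz_kernel p q x s * x
      = ?kp * rhalf (p + 1) q c s x + ?km * (rhalf q p c (1 - s) (1 - x) - rhalf (q + 1) p c (1 - s) (1 - x))"
      unfolding riesz_kernel_eq_halves[OF x(1)] rhalf_shift[OF x(1)] rhalf_shift[OF x(2)] by (simp add: algebra_simps)
  qed
  also have "\<dots> = ?kp * (LINT x|U01. rhalf (p + 1) q c s x)
     + ?km * ((LINT x|U01. rhalf q p c (1 - s) (1 - x)) - (LINT x|U01. rhalf (q + 1) p c (1 - s) (1 - x)))"
    by (subst Bochner_Integration.integral_add)
      (intro integrable_mult_right Bochner_Integration.integrable_diff iH iL
        | simp only: integral_mult_right_zero Bochner_Integration.integral_diff[OF iL iL])+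
  also have "(LINT x|U01. rhalf q p c (1 - s) (1 - x)) = ?L0" by (rule integral_U01_reflect(2))
  also have "(LINT x|U01. rhalf (q + 1) p c (1 - s) (1 - x)) = (LINT x|U01. rhalf (q + 1) p c (1 - s) x)"
    by (rule integral_U01_reflect(2))
  also have "\<dots> = (- p - c * (1 - s)) * ?L0 - q * (1 - s) * (LINT x|U01. rhalf (q - 1) p c (1 - s) x)"
    by (rule rhalf_recurrence[OF s' p(1) c_gt]) simp
  also have "(LINT x|U01. rhalf (p + 1) q c s x) = (- q - c * s) * ?H0 - p * s * (LINT x|U01. rhalf (p - 1) q c s x)"
    by (rule rhalf_recurrence[OF s q(1) c_gt]) simp
  also have "(LINT x|U01. rhalf (p - 1) q c s x) = (1 - s) powr (q + c + 1) * (Beta (q + 1) (c + 1) * s powr (- q - 1))"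
    by (rule rhalf_explicit(2)[OF s q(1) c_gt]) simp
  also have "(LINT x|U01. rhalf (q - 1) p c (1 - s) x) = (1 - (1 - s)) powr (p + c + 1) * (Beta (p + 1) (c + 1) * (1 - s) powr (- p - 1))"
    by (rule rhalf_explicit(2)[OF s' p(1) c_gt]) simp
  also have "?kp * ((- q - c * s) * ?H0 - p * s * ((1 - s) powr (q + c + 1) * (Beta (q + 1) (c + 1) * s powr (- q - 1))))
     + ?km * (?L0 - ((- p - c * (1 - s)) * ?L0 - q * (1 - s) * ((1 - (1 - s)) powr (p + c + 1) * (Beta (p + 1) (c + 1) * (1 - s) powr (- p - 1)))))
     = (- q - c * s) * (?kp * ?H0 + ?km * ?L0)
       - (?kp * p * Beta (q + 1) (c + 1) - ?km * q * Beta (p + 1) (c + 1)) * ((1 - s) powr (- p) * s powr (- q))"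
  proof -
    have e: "q + c + 1 = - p" "p + c + 1 = - q" "1 - (1 - s) = s" by simp_all
    have f: "(1 - s) powr (- p - 1) * (1 - s) = (1 - s) powr (- p)" "s powr (- q - 1) * s = s powr (- q)"
      using s by (simp_all add: powr_diff)
    have "kp * ((- q - (-1 - p - q) * s) * H - p * s * (P * (B * u))) + km * (L - ((- p - (-1 - p - q) * (1 - s)) * L - q * (1 - s) * (Q * (B' * v))))
      = (- q - (-1 - p - q) * s) * (kp * H + km * L) - (kp * p * B * (P * (u * s)) - km * q * B' * ((v * (1 - s)) * Q))"
      for kp km H L P Q B B' u v by algebra
    from this[of ?kp ?H0 "(1 - s) powr (- p)" "Beta (q + 1) (c + 1)" "s powr (- q - 1)" ?km ?L0 "s powr (- q)" "Beta (p + 1) (c + 1)" "(1 - s) powr (- p - 1)"]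
    show ?thesis unfolding e f by (simp only: mult_ac left_diff_distrib right_diff_distrib)
  qed
  also have "?kp * p * Beta (q + 1) (c + 1) - ?km * q * Beta (p + 1) (c + 1) = 0"
    using sin_Beta_symmetric by simp
  also have "?kp * ?H0 + ?km * ?L0 = pi" using riesz_integral[OF s] riesz_integral_halves[OF s] by simp
  finally show ?thesis by simp
qed

text \<open>The integral over the whole interval of the derivative of
  \<open>x powr (p + k + 1) * (1 - x) powr (q + 1) * \<bar>x - s\<bar> powr (c + 1)\<close>,
  with the constants and signs of the two sides. The differentiated function is continuous, being 0 at
  \<open>s\<close>, and vanishes at both end points.\<close>

lemma riesz_integral_Suc_Suc:
  fixes k :: nat
  assumes s: "0 < s" "s < 1"
  defines "M \<equiv> (\<lambda>k. LINT x|U01. weight q p x * riesz_kernel p q x s * x ^ k)"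
  shows "(real k + 2) * M (Suc (Suc k))
    = (real k + 1 - q + s * (p + q + real k + 2)) * M (Suc k) - (p + real k + 1) * s * M k"
proof -
  let ?kp = "sin (pi * (q + 1))" and ?km = "sin (pi * (p + 1))"
  define A where "A = p + real k"
  let ?W = "\<lambda>k x. weight q p x * riesz_kernel p q x s * x ^ k"
  define \<Phi> where "\<Phi> x = x powr (A + 1) * (1 - x) powr (q + 1) *
     (?kp * (max (x - s) 0) powr (c + 1) - ?km * (max (s - x) 0) powr (c + 1))" for x
  let ?a = "real k + 1 - q + s * (p + q + real k + 2)"
  let ?\<phi> = "\<lambda>x. - (real k + 2) * ?W (Suc (Suc k)) x + ?a * ?W (Suc k) x + (- ((p + real k + 1) * s)) * ?W k x"
  note i = riesz_power_integrable[OF s]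
  have "(LINT x|U01. ?\<phi> x) = \<Phi> 1 - \<Phi> 0"
  proof (rule integral_U01_derivative[where S = "{s}"])
    have "continuous_on {0..1} (\<lambda>x. x powr (A + 1))"
      by (intro continuous_on_powr' continuous_intros) (use p in \<open>auto simp: A_def\<close>)
    moreover have "continuous_on {0..1} (\<lambda>x. (1 - x) powr (q + 1))"
      by (intro continuous_on_powr' continuous_intros) (use q in auto)
    moreover have "continuous_on {0..1} (\<lambda>x. (max (x - s) 0) powr (c + 1))" "continuous_on {0..1} (\<lambda>x. (max (s - x) 0) powr (c + 1))"
      by (intro continuous_on_powr' continuous_intros; use c_gt in auto)+
    ultimately show "continuous_on {0..1} \<Phi>" unfolding \<Phi>_def[abs_def]
      by (intro continuous_on_mult continuous_on_diff continuous_on_const)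
    show "integrable U01 ?\<phi>" by (intro Bochner_Integration.integrable_add integrable_mult_right i)
    fix x :: real assume "x \<in> {0<..<1} - {s}"
    then have x: "0 < x" "x < 1" "x \<noteq> s" by auto
    have xA: "x powr A = x powr p * x ^ k" using x by (simp add: A_def powr_add powr_realpow)
    have alg: "y * ((A + 1) * (1 - x) * (x - s) - (q + 1) * x * (x - s) + (c + 1) * x * (1 - x))
       = - (real k + 2) * (y * x * x) + ?a * (y * x) + (- ((p + real k + 1) * s)) * y" for y
      unfolding A_def by algebra
    show "(\<Phi> has_real_derivative ?\<phi> x) (at x)"
    proof (cases "s < x")
      case True
      have "((\<lambda>x. ?kp * (x powr (A + 1) * (1 - x) powr (q + 1) * (x - s) powr (c + 1))) has_real_derivative
        ?kp * (x powr A * (1 - x) powr q * (x - s) powr c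
          * ((A + 1) * (1 - x) * (x - s) - (q + 1) * x * (x - s) + (c + 1) * x * (1 - x)))) (at x)"
        by (rule DERIV_cmult[OF triple_power_deriv_right[OF x(1,2) True]])
      also have "?kp * (x powr A * (1 - x) powr q * (x - s) powr c
          * ((A + 1) * (1 - x) * (x - s) - (q + 1) * x * (x - s) + (c + 1) * x * (1 - x))) = ?\<phi> x"
      proof -
        have "?kp * (x powr A * (1 - x) powr q * (x - s) powr c) = ?W k x"
          using True by (simp add: weight_def riesz_kernel_def xA mult_ac)
        then show ?thesis using alg[of "?W k x"] by (simp only: mult.assoc[symmetric] power_Suc2)
      qed
      finally show ?thesis
        by (rule has_field_derivative_transform_within_open[of _ _ _ "{s<..}"])
          (use True c_gt in \<open>auto simp: \<Phi>_def max_def\<close>)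
    next
      case False
      then have lt: "x < s" using x by simp
      have "((\<lambda>x. - ?km * (x powr (A + 1) * (1 - x) powr (q + 1) * (s - x) powr (c + 1))) has_real_derivative
        - ?km * (x powr A * (1 - x) powr q * (s - x) powr c
          * ((A + 1) * (1 - x) * (s - x) - (q + 1) * x * (s - x) - (c + 1) * x * (1 - x)))) (at x)"
        by (rule DERIV_cmult[OF triple_power_deriv_left[OF x(1,2) lt]])
      also have "- ?km * (x powr A * (1 - x) powr q * (s - x) powr c
          * ((A + 1) * (1 - x) * (s - x) - (q + 1) * x * (s - x) - (c + 1) * x * (1 - x))) = ?\<phi> x"
      proof -
        have w: "?km * (x powr A * (1 - x) powr q * (s - x) powr c) = ?W k x"
          using lt by (simp add: weight_def riesz_kernel_def xA mult_ac)
        have "- ?km * (x powr A * (1 - x) powr q * (s - x) powr c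
          * ((A + 1) * (1 - x) * (s - x) - (q + 1) * x * (s - x) - (c + 1) * x * (1 - x)))
          = (?km * (x powr A * (1 - x) powr q * (s - x) powr c)) * ((A + 1) * (1 - x) * (x - s) - (q + 1) * x * (x - s) + (c + 1) * x * (1 - x))"
          by algebra
        then show ?thesis unfolding w using alg[of "?W k x"] by (simp only: mult.assoc[symmetric] power_Suc2)
      qed
      finally show ?thesis
        by (rule has_field_derivative_transform_within_open[of _ _ _ "{..<s}"])
          (use lt c_gt in \<open>auto simp: \<Phi>_def max_def\<close>)
    qed
  qed simp
  also have "\<Phi> 1 - \<Phi> 0 = 0" using s p q by (simp add: \<Phi>_def A_def)
  also have "(LINT x|U01. ?\<phi> x) = - (real k + 2) * M (Suc (Suc k)) + ?a * M (Suc k) + (- ((p + real k + 1) * s)) * M k"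
    unfolding M_def
    by (subst Bochner_Integration.integral_add,
        intro Bochner_Integration.integrable_add integrable_mult_right i,
        intro integrable_mult_right i,
        subst Bochner_Integration.integral_add,
        intro integrable_mult_right i, intro integrable_mult_right i)
      (simp only: integral_mult_right_zero)
  finally show ?thesis by (simp add: algebra_simps)
qed

lemma riesz_integral_power:
  assumes s: "0 < s" "s < 1"
  shows "(LINT x|U01. weight q p x * riesz_kernel p q x s * x ^ k) = pi * poly (riesz_moment p q k) s"
proof (induction k rule: less_induct)
  case (less k)
  consider "k = 0" | "k = 1" | m where "k = Suc (Suc m)"
    by (metis One_nat_def not0_implies_Suc)
  then show ?case
  proof cases
    case 1 then show ?thesis using riesz_integral[OF s] by simp
  next
    case 2 then show ?thesis using riesz_integral_1[OF s] by (simp add: algebra_simps)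
  next
    case 3
    have e: "poly (riesz_moment p q (Suc (Suc m))) s * (real m + 2)
      = (real m + 1 - q + s * (p + q + real m + 2)) * poly (riesz_moment p q (Suc m)) s - (p + real m + 1) * s * poly (riesz_moment p q m) s"
    proof -
      have "poly (riesz_moment p q (Suc (Suc m))) s
        = 1 / (real m + 2) * ((real m + 1 - q + s * (p + q + real m + 2)) * poly (riesz_moment p q (Suc m)) s
            - (p + real m + 1) * (s * poly (riesz_moment p q m) s))"
        by (simp only: riesz_moment.simps poly_smult poly_diff poly_mult poly_pCons poly_0
            mult_zero_right add_0_right mult_1_right add_0_left)
      moreover have "X = 1 / z * Y \<Longrightarrow> z \<noteq> 0 \<Longrightarrow> X * z = Y" for X Y z :: real by simp
      ultimately show ?thesis by (simp only: mult.assoc)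
    qed
    have "(real m + 2) * (LINT x|U01. weight q p x * riesz_kernel p q x s * x ^ Suc (Suc m))
      = (real m + 1 - q + s * (p + q + real m + 2)) * (pi * poly (riesz_moment p q (Suc m)) s) - (p + real m + 1) * s * (pi * poly (riesz_moment p q m) s)"
      unfolding riesz_integral_Suc_Suc[OF s] using less[of "Suc m"] less[of m] 3 by simp
    also have "\<dots> = (real m + 2) * (pi * poly (riesz_moment p q (Suc (Suc m))) s)"
    proof -
      have "A * (pi * P) - B * (pi * Q) = pi * (A * P - B * Q)" for A B P Q :: real by (simp add: algebra_simps)
      then show ?thesis unfolding e[symmetric] by (simp only: e[symmetric]) (simp only: mult_ac)
    qed
    finally show ?thesis unfolding 3 by (rule mult_left_cancel[THEN iffD1, rotated]) simp
  qed
qed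

lemma riesz_integral_poly:
  assumes s: "0 < s" "s < 1"
  shows "(LINT x|U01. weight q p x * riesz_kernel p q x s * poly R x) = pi * poly (riesz_image p q R) s"
proof -
  have "(LINT x|U01. weight q p x * riesz_kernel p q x s * poly R x)
    = (LINT x|U01. (\<Sum>k\<le>degree R. coeff R k * (weight q p x * riesz_kernel p q x s * x ^ k)))"
    by (simp add: poly_altdef sum_distrib_left mult_ac)
  also have "\<dots> = (\<Sum>k\<le>degree R. (LINT x|U01. coeff R k * (weight q p x * riesz_kernel p q x s * x ^ k)))"
    by (rule Bochner_Integration.integral_sum) (intro integrable_mult_right riesz_power_integrable s)
  also have "\<dots> = (\<Sum>k\<le>degree R. coeff R k * (pi * poly (riesz_moment p q k) s))"
    by (simp only: integral_mult_right_zero riesz_integral_power[OF s])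
  also have "\<dots> = pi * poly (riesz_image p q R) s"
    by (simp add: riesz_image_def poly_sum sum_distrib_left mult_ac)
  finally show ?thesis .
qed

text \<open>The kernel is nonnegative and its zeroth moment is a constant; so the double integral
  converges absolutely for every integrable \<open>h\<close>. As a by-product, the fractional integrals
  of \<open>h\<close> exist almost everywhere.\<close>

lemma riesz_Fubini:
  assumes h: "integrable U01 h"
  shows "integrable U01 (\<lambda>x. weight q p x * poly R x * (LINT s|U01. h s * riesz_kernel p q x s))"
    and "(LINT x|U01. weight q p x * poly R x * (LINT s|U01. h s * riesz_kernel p q x s))
      = pi * (LINT s|U01. h s * poly (riesz_image p q R) s)"
    and "AE x in U01. integrable U01 (\<lambda>s. h s * riesz_kernel p q x s)"
proof -
  interpret finite_measure U01 by (rule finite_measure_lebesgue_on) auto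
  interpret P: pair_sigma_finite U01 U01 ..
  have hm[measurable]: "h \<in> borel_measurable U01" using h by simp
  have F: "integrable (U01 \<Otimes>\<^sub>M U01) (\<lambda>(s, x). h s * (weight q p x * riesz_kernel p q x s * poly R x))" for R
  proof (rule P.Fubini_integrable)
    have k: "(\<lambda>(s, x). weight q p x * riesz_kernel p q x s * poly R x) \<in> borel_measurable (U01 \<Otimes>\<^sub>M U01)"
    proof (rule borel_measurable_pair_U01)
      have "poly R \<in> borel_measurable borel" by (intro borel_measurable_continuous_onI continuous_intros)
      then have [measurable]: "(\<lambda>z. poly R (snd z)) \<in> borel_measurable (borel \<Otimes>\<^sub>M borel)"
        by (rule measurable_compose[OF measurable_snd])
      have "(\<lambda>(s::real, x). weight q p x * riesz_kernel p q x s) \<in> borel_measurable (borel \<Otimes>\<^sub>M borel)"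
        unfolding weight_def riesz_kernel_def by measurable
      then have "(\<lambda>z. (case z of (s::real, x) \<Rightarrow> weight q p x * riesz_kernel p q x s) * poly R (snd z)) \<in> borel_measurable (borel \<Otimes>\<^sub>M borel)"
        by measurable
      then show "(\<lambda>(s::real, x). weight q p x * riesz_kernel p q x s * poly R x) \<in> borel_measurable (borel \<Otimes>\<^sub>M borel)"
        by (simp add: case_prod_unfold)
    qed
    have "(\<lambda>z. h (fst z) * (case z of (s, x) \<Rightarrow> weight q p x * riesz_kernel p q x s * poly R x)) \<in> borel_measurable (U01 \<Otimes>\<^sub>M U01)"
      by (rule borel_measurable_times[OF measurable_compose[OF measurable_fst hm] k])
    then show m: "(\<lambda>(s, x). h s * (weight q p x * riesz_kernel p q x s * poly R x)) \<in> borel_measurable (U01 \<Otimes>\<^sub>M U01)"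
      by (simp add: case_prod_unfold)
    have i: "integrable U01 (\<lambda>x. h s * (weight q p x * riesz_kernel p q x s * poly R x))" if "s \<in> space U01" for s
      using that by (intro integrable_mult_right riesz_poly_integrable(1)) auto
    then show "AE s in U01. integrable U01 (\<lambda>x. case (s, x) of (s, x) \<Rightarrow> h s * (weight q p x * riesz_kernel p q x s * poly R x))"
      by (intro AE_I2) simp
    obtain C where C: "C \<ge> 0" "\<forall>x\<in>{0..1}. \<bar>poly R x\<bar> \<le> C"
      using riesz_poly_integrable(2)[of "1/2" R] by auto
    show "integrable U01 (\<lambda>s. LINT x|U01. norm (case (s, x) of (s, x) \<Rightarrow> h s * (weight q p x * riesz_kernel p q x s * poly R x)))"
    proof (rule integrable_U01_bound[of "\<lambda>s. \<bar>h s\<bar>" _ "C * pi"])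
      show "integrable U01 (\<lambda>s. \<bar>h s\<bar>)" using h by simp
      have "(\<lambda>(s, x). norm (h s * (weight q p x * riesz_kernel p q x s * poly R x))) \<in> borel_measurable (U01 \<Otimes>\<^sub>M U01)"
        using measurable_compose[OF m borel_measurable_norm] by (simp add: case_prod_unfold)
      then show "(\<lambda>s. LINT x|U01. norm (case (s, x) of (s, x) \<Rightarrow> h s * (weight q p x * riesz_kernel p q x s * poly R x))) \<in> borel_measurable U01"
        by (intro borel_measurable_lebesgue_integral) simp
      fix s :: real assume s: "s \<in> {0<..<1}"
      then have s': "0 < s" "s < 1" by auto
      have "(LINT x|U01. norm (case (s, x) of (s, x) \<Rightarrow> h s * (weight q p x * riesz_kernel p q x s * poly R x)))
        \<le> (LINT x|U01. (\<bar>h s\<bar> * C) * (weight q p x * riesz_kernel p q x s))"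
      proof (rule integral_mono)
        show "integrable U01 (\<lambda>x. norm (case (s, x) of (s, x) \<Rightarrow> h s * (weight q p x * riesz_kernel p q x s * poly R x)))"
          using integrable_norm[OF i[of s]] s by simp
        show "integrable U01 (\<lambda>x. (\<bar>h s\<bar> * C) * (weight q p x * riesz_kernel p q x s))"
          by (intro integrable_mult_right riesz_integrable s')
        fix x :: real assume "x \<in> space U01"
        then have "\<bar>poly R x\<bar> \<le> C" using C by auto
        moreover have W: "0 \<le> weight q p x * riesz_kernel p q x s"
          by (intro mult_nonneg_nonneg weight_nonneg riesz_kernel_nonneg)
        ultimately have "\<bar>h s\<bar> * ((weight q p x * riesz_kernel p q x s) * \<bar>poly R x\<bar>) \<le> \<bar>h s\<bar> * ((weight q p x * riesz_kernel p q x s) * C)"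
          by (intro mult_left_mono) auto
        then show "norm (case (s, x) of (s, x) \<Rightarrow> h s * (weight q p x * riesz_kernel p q x s * poly R x))
          \<le> (\<bar>h s\<bar> * C) * (weight q p x * riesz_kernel p q x s)"
          by (simp only: prod.case real_norm_def abs_mult[of "h s"] abs_mult[of "weight q p x * riesz_kernel p q x s"] abs_of_nonneg[OF W])
            (simp only: mult_ac)
      qed
      also have "\<dots> = (\<bar>h s\<bar> * C) * pi" by (simp only: integral_mult_right_zero riesz_integral[OF s'])
      finally show "\<bar>LINT x|U01. norm (case (s, x) of (s, x) \<Rightarrow> h s * (weight q p x * riesz_kernel p q x s * poly R x))\<bar> \<le> C * pi * \<bar>h s\<bar>"
        by (subst abs_of_nonneg) (auto simp: mult_ac intro!: integral_nonneg_AE)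
    qed
  qed
  have e: "(LINT s|U01. h s * (weight q p x * riesz_kernel p q x s * poly R x))
    = weight q p x * poly R x * (LINT s|U01. h s * riesz_kernel p q x s)" for x
  proof -
    have "(LINT s|U01. h s * (weight q p x * riesz_kernel p q x s * poly R x)) = (LINT s|U01. (weight q p x * poly R x) * (h s * riesz_kernel p q x s))"
      by (simp only: mult_ac)
    then show ?thesis by (simp only: integral_mult_right_zero)
  qed
  show "integrable U01 (\<lambda>x. weight q p x * poly R x * (LINT s|U01. h s * riesz_kernel p q x s))"
    using P.integrable_snd[OF F[of R]] by (simp only: e)
  have "(LINT x|U01. weight q p x * poly R x * (LINT s|U01. h s * riesz_kernel p q x s))
    = (LINT s|U01. LINT x|U01. h s * (weight q p x * riesz_kernel p q x s * poly R x))"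
    unfolding e[symmetric] by (rule P.Fubini_integral[OF F])
  also have "\<dots> = (LINT s|U01. pi * (h s * poly (riesz_image p q R) s))"
  proof (intro Bochner_Integration.integral_cong refl)
    fix s assume "s \<in> space U01"
    then have s: "0 < s" "s < 1" by auto
    show "(LINT x|U01. h s * (weight q p x * riesz_kernel p q x s * poly R x)) = pi * (h s * poly (riesz_image p q R) s)"
      by (simp only: integral_mult_right_zero riesz_integral_poly[OF s] mult.left_commute)
  qed
  finally show "(LINT x|U01. weight q p x * poly R x * (LINT s|U01. h s * riesz_kernel p q x s))
      = pi * (LINT s|U01. h s * poly (riesz_image p q R) s)" by (simp only: integral_mult_right_zero)
  have "AE x in U01. integrable U01 (\<lambda>s. h s * (weight q p x * riesz_kernel p q x s * poly 1 x))"
    using P.AE_integrable_snd[OF F[of 1]] .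
  moreover have "AE x in U01. x \<in> {0<..<1}" by (rule AE_U01_I)
  ultimately show "AE x in U01. integrable U01 (\<lambda>s. h s * riesz_kernel p q x s)"
  proof eventually_elim
    case (elim x)
    have "integrable U01 (\<lambda>s. (1 / weight q p x) * (h s * (weight q p x * riesz_kernel p q x s * poly 1 x)))"
      by (rule integrable_mult_right[OF elim(1)])
    then show ?case using weight_pos[OF elim(2), of q p] by (simp add: mult_ac)
  qed
qed

lemma riesz_kernel_dual: "x \<noteq> s \<Longrightarrow> riesz_kernel q p s x = riesz_kernel p q x s"
  by (auto simp: riesz_kernel_def abs_minus_commute diff_diff_eq add.commute)

text \<open>Tested against a polynomial \<open>T\<close> of lower degree, the kernel can be moved from
  the Jacobi polynomial to \<open>T\<close> with the roles of \<open>p\<close> and \<open>q\<close>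
  exchanged. It maps \<open>T\<close> to a polynomial of lower degree, which is orthogonal to the Jacobi
  polynomial. So the image is an orthogonal polynomial, and its leading coefficient determines
  it.\<close>

lemma riesz_image_jacobi:
  "riesz_image p q (jacobi_poly n q p) = smult (pochhammer (1 + p + q) n / fact n) (jacobi_poly n p q)"
proof (rule poly_orthogonal_unique[of p q _ n])
  interpret S: riesz_params q p by (rule swap)
  let ?J = "jacobi_poly n q p"
  show "p > -1" "q > -1" using p q by auto
  show "degree (riesz_image p q ?J) \<le> n"
    using degree_riesz_image[of p q ?J] degree_jacobi_poly[of n q p] by simp
  show "degree (smult (pochhammer (1 + p + q) n / fact n) (jacobi_poly n p q)) \<le> n"
    by (intro order.trans[OF degree_smult_le] degree_jacobi_poly)
  show "coeff (riesz_image p q ?J) n = coeff (smult (pochhammer (1 + p + q) n / fact n) (jacobi_poly n p q)) n"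
    by (simp add: coeff_riesz_image degree_jacobi_poly coeff_jacobi_poly add_ac)
  fix T :: "real poly" assume T: "degree T < n"
  show "(LINT x|U01. weight p q x * (poly (smult (pochhammer (1 + p + q) n / fact n) (jacobi_poly n p q)) x * poly T x)) = 0"
    using jacobi_moment[OF p(1) q(1), of "smult (pochhammer (1 + p + q) n / fact n) T" n] T
    by (simp add: poly_jacobi_poly coeff_eq_0 mult_ac)
  have h: "integrable U01 (\<lambda>s. weight p q s * poly T s)"
    by (intro integrable_weight_mult p q continuous_intros)
  have "pi * (LINT s|U01. weight p q s * poly T s * poly (riesz_image p q ?J) s)
    = (LINT x|U01. weight q p x * poly ?J x * (LINT s|U01. weight p q s * poly T s * riesz_kernel p q x s))"
    by (rule riesz_Fubini(2)[OF h, symmetric])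
  also have "\<dots> = (LINT x|U01. pi * (weight q p x * (poly ?J x * poly (riesz_image q p T) x)))"
  proof (intro Bochner_Integration.integral_cong refl)
    fix x assume "x \<in> space U01"
    then have x: "0 < x" "x < 1" by auto
    have "(LINT s|U01. weight p q s * poly T s * riesz_kernel p q x s) = (LINT s|U01. weight p q s * riesz_kernel q p s x * poly T s)"
    proof (rule integral_cong_AE)
      have "AE s in lebesgue. s \<noteq> x" by (auto intro!: AE_completion AE_lborel_singleton)
      then have "AE s in U01. s \<noteq> x" by (auto simp: AE_restrict_space_iff)
      then show ae: "AE s in U01. weight p q s * poly T s * riesz_kernel p q x s = weight p q s * riesz_kernel q p s x * poly T s"
        by eventually_elim (simp add: riesz_kernel_dual)
      show "(\<lambda>s. weight p q s * riesz_kernel q p s x * poly T s) \<in> borel_measurable U01"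
        by (rule borel_measurable_integrable[OF S.riesz_poly_integrable(1)[OF x]])
      have "(\<lambda>s. riesz_kernel p q x s) \<in> borel_measurable U01"
        unfolding riesz_kernel_def by (rule borel_measurable_U01) measurable
      then show "(\<lambda>s. weight p q s * poly T s * riesz_kernel p q x s) \<in> borel_measurable U01"
        by (rule borel_measurable_times[OF borel_measurable_integrable[OF h]])
    qed
    also have "\<dots> = pi * poly (riesz_image q p T) x" by (rule S.riesz_integral_poly[OF x])
    finally show "weight q p x * poly ?J x * (LINT s|U01. weight p q s * poly T s * riesz_kernel p q x s)
      = pi * (weight q p x * (poly ?J x * poly (riesz_image q p T) x))" by (simp only: mult_ac)
  qed
  also have "\<dots> = 0"
  proof -
    have "degree (riesz_image q p T) < n" using degree_riesz_image[of q p T] T by simp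
    then have "(LINT x|U01. weight q p x * (jacobi_G n q p x * poly (riesz_image q p T) x)) = 0"
      using jacobi_moment[OF q(1) p(1), of "riesz_image q p T" n] by (simp add: coeff_eq_0)
    then show ?thesis by (simp only: poly_jacobi_poly integral_mult_right_zero mult_zero_right)
  qed
  finally show "(LINT s|U01. weight p q s * (poly (riesz_image p q ?J) s * poly T s)) = 0"
    by (simp add: mult_ac)
qed

end

section \<open>Jacobi expansions in weighted spaces\<close>

lemma wL2_iff: "v \<in> wL2 a b \<longleftrightarrow> v \<in> borel_measurable U01 \<and> integrable U01 (\<lambda>x. weight a b x * v x * v x)"
  by (simp add: wL2_def set_integrable_U01)

lemma wL2_mult_integrable:
  assumes "v \<in> wL2 a b" "w \<in> wL2 a b"
  shows "integrable U01 (\<lambda>x. weight a b x * v x * w x)"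
proof -
  have i: "integrable U01 (\<lambda>x. weight a b x * v x * v x + weight a b x * w x * w x)"
    using assms by (intro Bochner_Integration.integrable_add) (auto simp: wL2_iff)
  show ?thesis
  proof (rule integrable_U01_bound[OF i, of _ 1])
    show "(\<lambda>x. weight a b x * v x * w x) \<in> borel_measurable U01"
      using assms measurable_weight by (auto simp: wL2_iff)
    fix x :: real
    have "\<bar>v x * w x\<bar> \<le> v x * v x + w x * w x"
    proof -
      have "0 \<le> (\<bar>v x\<bar> - \<bar>w x\<bar>)\<^sup>2" by simp
      then have "2 * \<bar>v x * w x\<bar> \<le> v x * v x + w x * w x"
        by (simp add: power2_eq_square algebra_simps abs_mult abs_mult_self_eq)
      then show ?thesis by linarith
    qed
    then have "weight a b x * \<bar>v x * w x\<bar> \<le> weight a b x * (v x * v x + w x * w x)"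
      by (intro mult_left_mono weight_nonneg)
    then show "\<bar>weight a b x * v x * w x\<bar> \<le> 1 * (weight a b x * v x * v x + weight a b x * w x * w x)"
      using weight_nonneg[of a b x] by (simp add: abs_mult algebra_simps)
  qed
qed

lemma continuous_in_wL2:
  assumes "a > -1" "b > -1" "continuous_on {0..1} f"
  shows "f \<in> wL2 a b"
proof -
  have "integrable U01 (\<lambda>x. weight a b x * (f x * f x))"
    using assms by (intro integrable_weight_mult continuous_intros)
  moreover have "f \<in> borel_measurable U01"
    by (intro continuous_measurable_U01 continuous_on_subset[OF assms(3)]) auto
  ultimately show ?thesis by (simp add: wL2_iff mult.assoc)
qed

lemma poly_in_wL2: "a > -1 \<Longrightarrow> b > -1 \<Longrightarrow> poly R \<in> wL2 a b"
  by (intro continuous_in_wL2 continuous_intros)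

lemma jacobi_in_wL2: "a > -1 \<Longrightarrow> b > -1 \<Longrightarrow> jacobi_G n a b \<in> wL2 a b"
  by (intro continuous_in_wL2 continuous_jacobi_G)

lemma jacobi_expansion_error:
  assumes ab: "a > -1" "b > -1" and v: "v \<in> wL2 a b"
  shows "integrable U01 (\<lambda>x. weight a b x * (v x - (\<Sum>k\<in>I. r k * jacobi_G k a b x))\<^sup>2)" (is ?A)
    and "finite I \<Longrightarrow> (LINT x|U01. weight a b x * (v x - (\<Sum>k\<in>I. r k * jacobi_G k a b x))\<^sup>2)
      = (LINT x|U01. weight a b x * v x * v x)
        - 2 * (\<Sum>k\<in>I. r k * (LINT x|U01. weight a b x * v x * jacobi_G k a b x))
        + (\<Sum>k\<in>I. (r k)\<^sup>2 * jacobi_norm2 k a b)" (is "_ \<Longrightarrow> ?B")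
proof -
  let ?R = "\<lambda>x. \<Sum>k\<in>I. r k * jacobi_G k a b x"
  have R: "?R \<in> wL2 a b"
    by (intro continuous_in_wL2 ab continuous_on_sum continuous_on_mult continuous_on_const continuous_jacobi_G)
  note i = v[unfolded wL2_iff, THEN conjunct2] wL2_mult_integrable[OF v R] R[unfolded wL2_iff, THEN conjunct2]
  have e: "weight a b x * (v x - ?R x)\<^sup>2
    = weight a b x * v x * v x - 2 * (weight a b x * v x * ?R x) + weight a b x * ?R x * ?R x" for x
    by (simp add: power2_eq_square algebra_simps)
  have i2: "integrable U01 (\<lambda>x. 2 * (weight a b x * v x * ?R x))" by (rule integrable_mult_right[OF i(2)])
  show ?A unfolding e by (intro Bochner_Integration.integrable_add[OF Bochner_Integration.integrable_diff[OF i(1) i2] i(3)])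
  assume I: "finite I"
  have vR: "(LINT x|U01. weight a b x * v x * ?R x) = (\<Sum>k\<in>I. r k * (LINT x|U01. weight a b x * v x * jacobi_G k a b x))"
  proof -
    have "(LINT x|U01. weight a b x * v x * ?R x) = (LINT x|U01. (\<Sum>k\<in>I. r k * (weight a b x * v x * jacobi_G k a b x)))"
      by (simp only: sum_distrib_left mult_ac)
    also have "\<dots> = (\<Sum>k\<in>I. (LINT x|U01. r k * (weight a b x * v x * jacobi_G k a b x)))"
      by (rule Bochner_Integration.integral_sum) (intro integrable_mult_right wL2_mult_integrable v jacobi_in_wL2 ab)
    finally show ?thesis by (simp only: integral_mult_right_zero)
  qed
  have RG: "(LINT x|U01. weight a b x * ?R x * jacobi_G l a b x) = r l * jacobi_norm2 l a b" if "l \<in> I" for l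
  proof -
    have "(LINT x|U01. weight a b x * ?R x * jacobi_G l a b x)
        = (LINT x|U01. (\<Sum>k\<in>I. r k * (weight a b x * jacobi_G k a b x * jacobi_G l a b x)))"
      by (simp only: sum_distrib_left sum_distrib_right mult_ac)
    also have "\<dots> = (\<Sum>k\<in>I. (LINT x|U01. r k * (weight a b x * jacobi_G k a b x * jacobi_G l a b x)))"
      by (rule Bochner_Integration.integral_sum) (intro integrable_mult_right wL2_mult_integrable jacobi_in_wL2 ab)
    also have "\<dots> = (\<Sum>k\<in>I. r k * (LINT x|U01. weight a b x * (jacobi_G k a b x * jacobi_G l a b x)))"
      by (simp only: integral_mult_right_zero mult.assoc)
    also have "\<dots> = (\<Sum>k\<in>I. if k = l then r l * jacobi_norm2 l a b else 0)"
      by (intro sum.cong refl) (auto simp: jacobi_norm2[OF ab] jacobi_orthogonal[OF ab])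
    finally show ?thesis using I that by simp
  qed
  have RR: "(LINT x|U01. weight a b x * ?R x * ?R x) = (\<Sum>k\<in>I. (r k)\<^sup>2 * jacobi_norm2 k a b)"
  proof -
    have "(LINT x|U01. weight a b x * ?R x * ?R x) = (LINT x|U01. (\<Sum>k\<in>I. r k * (weight a b x * ?R x * jacobi_G k a b x)))"
      by (intro Bochner_Integration.integral_cong refl) (simp add: sum_distrib_left mult_ac)
    also have "\<dots> = (\<Sum>k\<in>I. (LINT x|U01. r k * (weight a b x * ?R x * jacobi_G k a b x)))"
      by (rule Bochner_Integration.integral_sum) (intro integrable_mult_right wL2_mult_integrable R jacobi_in_wL2 ab)
    also have "\<dots> = (\<Sum>k\<in>I. r k * (r k * jacobi_norm2 k a b))"
      by (simp only: integral_mult_right_zero) (intro sum.cong refl, simp only: RG)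
    finally show ?thesis by (simp add: power2_eq_square mult.assoc)
  qed
  show ?B unfolding e
    by (simp only: Bochner_Integration.integral_add[OF Bochner_Integration.integrable_diff[OF i(1) i2] i(3)]
        Bochner_Integration.integral_diff[OF i(1) i2] integral_mult_right_zero vR RR)
qed

definition fourier_jacobi :: "real \<Rightarrow> real \<Rightarrow> (real \<Rightarrow> real) \<Rightarrow> nat \<Rightarrow> real" where
  "fourier_jacobi a b v k = (LINT x|U01. weight a b x * v x * jacobi_G k a b x) / jacobi_norm2 k a b"

definition jacobi_error :: "real \<Rightarrow> real \<Rightarrow> (real \<Rightarrow> real) \<Rightarrow> nat \<Rightarrow> real" where
  "jacobi_error a b v N = (LINT x|U01. weight a b x * (v x - (\<Sum>k\<le>N. fourier_jacobi a b v k * jacobi_G k a b x))\<^sup>2)"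

lemma jacobi_error_eq:
  assumes ab: "a > -1" "b > -1" and v: "v \<in> wL2 a b"
  shows "jacobi_error a b v N = (LINT x|U01. weight a b x * v x * v x)
    - (\<Sum>k\<le>N. (fourier_jacobi a b v k)\<^sup>2 * jacobi_norm2 k a b)"
proof -
  have "fourier_jacobi a b v k * (LINT x|U01. weight a b x * v x * jacobi_G k a b x)
    = (fourier_jacobi a b v k)\<^sup>2 * jacobi_norm2 k a b" for k
    using jacobi_norm2_pos[OF ab, of k] by (simp add: fourier_jacobi_def power2_eq_square)
  then show ?thesis
    unfolding jacobi_error_def by (subst jacobi_expansion_error(2)[OF ab v]) simp_all
qed

lemma jacobi_error_nonneg: "jacobi_error a b v N \<ge> 0"
  unfolding jacobi_error_def by (intro integral_nonneg_AE AE_I2 mult_nonneg_nonneg weight_nonneg) simp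

lemma bessel_jacobi:
  assumes ab: "a > -1" "b > -1" and v: "v \<in> wL2 a b"
  shows "(\<Sum>k\<le>N. (fourier_jacobi a b v k)\<^sup>2 * jacobi_norm2 k a b) \<le> (LINT x|U01. weight a b x * v x * v x)"
  using jacobi_error_nonneg[of a b v N] jacobi_error_eq[OF assms, of N] by simp

lemma poly_jacobi_span:
  assumes ab: "a > -1" "b > -1" and "degree R \<le> N"
  shows "\<exists>r. R = (\<Sum>k\<le>N. smult (r k) (jacobi_poly k a b))"
  using assms(3)
proof (induction N arbitrary: R)
  case 0
  have l: "coeff (jacobi_poly 0 a b) 0 \<noteq> 0" using lead_coeff_jacobi_pos[OF ab, of 0] by (simp add: coeff_jacobi_poly)
  have "degree (jacobi_poly 0 a b) = 0" using degree_jacobi_poly[of 0 a b] by simp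
  then obtain c where c: "jacobi_poly 0 a b = [:c:]" by (metis degree_eq_zeroE)
  obtain d where d: "R = [:d:]" using 0 by (metis degree_eq_zeroE le_zero_eq)
  show ?case using l by (intro exI[of _ "\<lambda>_. d / c"]) (simp add: c d)
next
  case (Suc N)
  define l where "l = coeff (jacobi_poly (Suc N) a b) (Suc N)"
  have l: "l \<noteq> 0" unfolding l_def coeff_jacobi_poly using lead_coeff_jacobi_pos[OF ab, of "Suc N"] by linarith
  define c where "c = coeff R (Suc N) / l"
  let ?S = "R - smult c (jacobi_poly (Suc N) a b)"
  have "degree ?S \<le> Suc N"
    by (intro degree_diff_le Suc.prems order.trans[OF degree_smult_le] degree_jacobi_poly)
  moreover have "coeff ?S (Suc N) = 0" using l by (simp add: c_def l_def[symmetric])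
  ultimately have "degree ?S \<le> N"
    by (metis degree_0 le_SucE le0 leading_coeff_0_iff)
  from Suc.IH[OF this] obtain r where r: "?S = (\<Sum>k\<le>N. smult (r k) (jacobi_poly k a b))" by blast
  have "R = ?S + smult c (jacobi_poly (Suc N) a b)" by simp
  also have "\<dots> = (\<Sum>k\<le>Suc N. smult ((r(Suc N := c)) k) (jacobi_poly k a b))"
    unfolding r by simp
  finally show ?case by blast
qed

text \<open>The truncated expansion is the best approximation among polynomials of its degree.\<close>

lemma jacobi_error_le_poly:
  assumes ab: "a > -1" "b > -1" and v: "v \<in> wL2 a b" and R: "degree R \<le> N"
  shows "jacobi_error a b v N \<le> (LINT x|U01. weight a b x * (v x - poly R x)\<^sup>2)"
proof -
  obtain r where r: "R = (\<Sum>k\<le>N. smult (r k) (jacobi_poly k a b))" using poly_jacobi_span[OF ab R] by blast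
  let ?c = "fourier_jacobi a b v" and ?h = "\<lambda>k. jacobi_norm2 k a b"
  have m: "(LINT x|U01. weight a b x * v x * jacobi_G k a b x) = ?c k * ?h k" for k
    using jacobi_norm2_pos[OF ab, of k] by (simp add: fourier_jacobi_def)
  have "(LINT x|U01. weight a b x * (v x - poly R x)\<^sup>2) = (LINT x|U01. weight a b x * (v x - (\<Sum>k\<le>N. r k * jacobi_G k a b x))\<^sup>2)"
    by (simp add: r poly_sum poly_jacobi_poly)
  also have "\<dots> = (LINT x|U01. weight a b x * v x * v x) - 2 * (\<Sum>k\<le>N. r k * (?c k * ?h k)) + (\<Sum>k\<le>N. (r k)\<^sup>2 * ?h k)"
    by (subst jacobi_expansion_error(2)[OF ab v]) (simp_all only: m finite_atMost)
  finally have L: "(LINT x|U01. weight a b x * (v x - poly R x)\<^sup>2)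
    = (LINT x|U01. weight a b x * v x * v x) - 2 * (\<Sum>k\<le>N. r k * (?c k * ?h k)) + (\<Sum>k\<le>N. (r k)\<^sup>2 * ?h k)" .
  have "(LINT x|U01. weight a b x * (v x - poly R x)\<^sup>2) - jacobi_error a b v N = (\<Sum>k\<le>N. (r k - ?c k)\<^sup>2 * ?h k)"
    unfolding jacobi_error_eq[OF ab v] L
    by (simp add: sum_distrib_left sum.distrib[symmetric] sum_subtractf[symmetric])
      (simp add: power2_eq_square algebra_simps sum.distrib sum_subtractf sum_distrib_left)
  moreover have "0 \<le> (\<Sum>k\<le>N. (r k - ?c k)\<^sup>2 * ?h k)"
    by (intro sum_nonneg mult_nonneg_nonneg zero_le_power2 less_imp_le[OF jacobi_norm2_pos[OF ab]])
  ultimately show ?thesis by linarith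
qed

lemma real_polynomial_function_poly:
  assumes "real_polynomial_function (f :: real \<Rightarrow> real)" shows "\<exists>R. f = poly R"
proof -
  obtain c n where "f = (\<lambda>x. \<Sum>i\<le>n. c i * x ^ i)"
    using assms unfolding real_polynomial_function_iff_sum by blast
  then have "f = poly (\<Sum>i\<le>n. monom (c i) i)" by (auto simp: poly_sum poly_monom)
  then show ?thesis by blast
qed

text \<open>Quotients of a continuous function by the weight have a direct approximation: replacing the
  denominator by its maximum with \<open>1 / n\<close> gives continuous functions that converge by
  dominated convergence and that Weierstrass' theorem approximates uniformly.\<close>

lemma poly_dense_quotient:
  assumes ab: "a > 0" "b > 0" and u: "continuous_on {0..1} u"
    and v: "(\<lambda>x. u x / weight a b x) \<in> wL2 a b" and e: "e > 0"
  shows "\<exists>R. (LINT x|U01. weight a b x * (u x / weight a b x - poly R x)\<^sup>2) < e"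
proof -
  define v where "v x = u x / weight a b x" for x
  have vL2: "v \<in> wL2 a b" using v by (simp add: v_def[abs_def])
  define vn where "vn n x = u x / max (weight a b x) (inverse (real (Suc n)))" for n x
  have vnc: "continuous_on {0..1} (vn n)" for n
  proof -
    have "0 < max (weight a b x) (inverse (real (Suc n)))" for x by (simp add: less_max_iff_disj)
    then have "max (weight a b x) (inverse (real (Suc n))) \<noteq> 0" for x by (metis less_irrefl)
    then show ?thesis unfolding vn_def[abs_def]
      by (intro continuous_on_divide continuous_on_max continuous_on_const u continuous_weight ab) auto
  qed
  have vnL2: "vn n \<in> wL2 a b" for n using vnc ab by (intro continuous_in_wL2) auto
  have "(\<lambda>n. LINT x|U01. weight a b x * (v x - vn n x)\<^sup>2) \<longlonglongrightarrow> (LINT x|U01. 0)"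
  proof (rule integral_dominated_convergence[where w = "\<lambda>x. weight a b x * v x * v x"])
    show "integrable U01 (\<lambda>x. weight a b x * v x * v x)" using vL2 by (simp add: wL2_iff)
    show "(\<lambda>x. weight a b x * (v x - vn n x)\<^sup>2) \<in> borel_measurable U01" for n
      using vL2 vnL2[of n] measurable_weight by (auto simp: wL2_iff)
    show "AE x in U01. (\<lambda>n. weight a b x * (v x - vn n x)\<^sup>2) \<longlonglongrightarrow> 0"
    proof (rule AE_U01_I)
      fix x :: real assume "x \<in> {0<..<1}"
      then have w: "0 < weight a b x" by (rule weight_pos)
      have "(\<lambda>n. vn n x) \<longlonglongrightarrow> u x / max (weight a b x) 0"
        unfolding vn_def using w by (intro tendsto_intros LIMSEQ_inverse_real_of_nat) auto
      then have "(\<lambda>n. weight a b x * (v x - vn n x)\<^sup>2) \<longlonglongrightarrow> weight a b x * (v x - u x / max (weight a b x) 0)\<^sup>2"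
        by (intro tendsto_intros)
      then show "(\<lambda>n. weight a b x * (v x - vn n x)\<^sup>2) \<longlonglongrightarrow> 0" using w by (simp add: v_def)
    qed
    show "AE x in U01. norm (weight a b x * (v x - vn n x)\<^sup>2) \<le> weight a b x * v x * v x" for n
    proof (rule AE_U01_I)
      fix x :: real assume "x \<in> {0<..<1}"
      then have w: "0 < weight a b x" by (rule weight_pos)
      define t where "t = weight a b x / max (weight a b x) (inverse (real (Suc n)))"
      have t: "0 \<le> t" "t \<le> 1" using w by (auto simp: t_def max_def)
      have "vn n x = t * v x" using w by (simp add: vn_def v_def t_def)
      then have "v x - vn n x = (1 - t) * v x" by (simp add: algebra_simps)
      then have "(v x - vn n x)\<^sup>2 = (1 - t)\<^sup>2 * (v x)\<^sup>2" by (simp add: power_mult_distrib)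
      also have "\<dots> \<le> 1 * (v x)\<^sup>2" using t by (intro mult_right_mono power_le_one) auto
      finally have "weight a b x * (v x - vn n x)\<^sup>2 \<le> weight a b x * (v x)\<^sup>2"
        using w by (intro mult_left_mono) auto
      then show "norm (weight a b x * (v x - vn n x)\<^sup>2) \<le> weight a b x * v x * v x"
        using w by (simp add: abs_mult power2_eq_square mult.assoc)
    qed
  qed auto
  then have lim: "(\<lambda>n. LINT x|U01. weight a b x * (v x - vn n x)\<^sup>2) \<longlonglongrightarrow> 0" by simp
  have "eventually (\<lambda>n. (LINT x|U01. weight a b x * (v x - vn n x)\<^sup>2) < e / 4) sequentially"
    using order_tendstoD(2)[OF lim, of "e / 4"] e by simp
  then obtain n where n: "(LINT x|U01. weight a b x * (v x - vn n x)\<^sup>2) < e / 4"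
    by (auto simp: eventually_sequentially)
  define B where "B = Beta (b + 1) (a + 1)"
  have B: "B > 0" unfolding B_def using ab by (intro Beta_pos) auto
  have iw: "integrable U01 (weight a b)" "(LINT x|U01. weight a b x) = B"
    unfolding B_def using ab by (intro integrable_weight; simp)+
  \<comment> \<open>A uniform error \<open>d\<close> contributes \<open>d\<^sup>2\<close> times the
    total mass \<open>B\<close> of the weight to the squared error.\<close>
  define d where "d = sqrt (e / (4 * B))"
  have d: "d > 0" "d\<^sup>2 * B = e / 4" using e B by (auto simp: d_def)
  obtain g where "real_polynomial_function g" and g: "\<And>x. x \<in> {0..1} \<Longrightarrow> \<bar>vn n x - g x\<bar> < d"
    using Stone_Weierstrass_real_polynomial_function[OF _ vnc d(1), of n] by auto
  then obtain R where R: "g = poly R" using real_polynomial_function_poly by blast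
  have i1: "integrable U01 (\<lambda>x. 2 * (weight a b x * (v x - vn n x)\<^sup>2))"
  proof (rule integrable_mult_right)
    have "(\<lambda>x. weight a b x * v x * v x - 2 * (weight a b x * v x * vn n x) + weight a b x * vn n x * vn n x)
      = (\<lambda>x. weight a b x * (v x - vn n x)\<^sup>2)" by (simp add: power2_eq_square algebra_simps)
    moreover have "integrable U01 (\<lambda>x. weight a b x * v x * v x - 2 * (weight a b x * v x * vn n x) + weight a b x * vn n x * vn n x)"
      by (intro Bochner_Integration.integrable_add Bochner_Integration.integrable_diff integrable_mult_right wL2_mult_integrable vL2 vnL2)
    ultimately show "integrable U01 (\<lambda>x. weight a b x * (v x - vn n x)\<^sup>2)" by simp
  qed
  have i2: "integrable U01 (\<lambda>x. 2 * d\<^sup>2 * weight a b x)" by (rule integrable_mult_right[OF iw(1)])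
  have RL2: "poly R \<in> wL2 a b" using ab by (intro poly_in_wL2) auto
  have le: "weight a b x * (v x - poly R x)\<^sup>2 \<le> 2 * (weight a b x * (v x - vn n x)\<^sup>2) + 2 * d\<^sup>2 * weight a b x"
    if "x \<in> {0<..<1}" for x
  proof -
    have "\<bar>vn n x - poly R x\<bar> \<le> d" using g[of x] that R by auto
    then have "(vn n x - poly R x)\<^sup>2 \<le> d\<^sup>2" using d(1) by (simp add: abs_le_square_iff[symmetric])
    moreover have "(v x - poly R x)\<^sup>2 \<le> 2 * (v x - vn n x)\<^sup>2 + 2 * (vn n x - poly R x)\<^sup>2"
    proof -
      have "0 \<le> ((v x - vn n x) - (vn n x - poly R x))\<^sup>2" by simp
      then show ?thesis by (simp add: power2_eq_square algebra_simps)
    qed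
    ultimately have "(v x - poly R x)\<^sup>2 \<le> 2 * (v x - vn n x)\<^sup>2 + 2 * d\<^sup>2" by linarith
    from mult_left_mono[OF this weight_nonneg[of a b x]] show ?thesis by (simp add: algebra_simps)
  qed
  have "(LINT x|U01. weight a b x * (v x - poly R x)\<^sup>2)
    \<le> (LINT x|U01. 2 * (weight a b x * (v x - vn n x)\<^sup>2) + 2 * d\<^sup>2 * weight a b x)"
  proof (rule integral_mono)
    show "integrable U01 (\<lambda>x. 2 * (weight a b x * (v x - vn n x)\<^sup>2) + 2 * d\<^sup>2 * weight a b x)"
      by (rule Bochner_Integration.integrable_add[OF i1 i2])
    then show "integrable U01 (\<lambda>x. weight a b x * (v x - poly R x)\<^sup>2)"
    proof (rule integrable_U01_bound[of _ _ 1])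
      show "(\<lambda>x. weight a b x * (v x - poly R x)\<^sup>2) \<in> borel_measurable U01"
        using vL2 RL2 measurable_weight by (auto simp: wL2_iff)
      show "\<bar>weight a b x * (v x - poly R x)\<^sup>2\<bar> \<le> 1 * (2 * (weight a b x * (v x - vn n x)\<^sup>2) + 2 * d\<^sup>2 * weight a b x)"
        if "x \<in> {0<..<1}" for x
        using le[OF that] weight_nonneg[of a b x] by (simp add: abs_mult)
    qed
  qed (use le in auto)
  also have "\<dots> = 2 * (LINT x|U01. weight a b x * (v x - vn n x)\<^sup>2) + 2 * d\<^sup>2 * B"
    by (simp only: Bochner_Integration.integral_add[OF i1 i2] integral_mult_right_zero iw(2))
  also have "\<dots> < e" using n d(2) e by (simp add: mult.assoc)
  finally show ?thesis by (auto simp: v_def)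
qed

text \<open>Density makes the error tend to 0, so it equals the sum of the omitted squared
  coefficients.\<close>

lemma jacobi_error_bound:
  assumes ab: "a > 0" "b > 0" and u: "continuous_on {0..1} u"
    and v: "(\<lambda>x. u x / weight a b x) \<in> wL2 a b"
    and B: "\<And>M. (\<Sum>k\<in>{N<..M}. (fourier_jacobi a b (\<lambda>x. u x / weight a b x) k)\<^sup>2 * jacobi_norm2 k a b) \<le> B"
  shows "jacobi_error a b (\<lambda>x. u x / weight a b x) N \<le> B"
proof (rule field_le_epsilon)
  let ?v = "\<lambda>x. u x / weight a b x"
  let ?t = "\<lambda>k. (fourier_jacobi a b ?v k)\<^sup>2 * jacobi_norm2 k a b"
  fix e :: real assume e: "e > 0"
  have ab': "a > -1" "b > -1" using ab by auto
  obtain R where R: "(LINT x|U01. weight a b x * (?v x - poly R x)\<^sup>2) < e"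
    using poly_dense_quotient[OF ab u v e] by blast
  define M where "M = max N (degree R)"
  have "jacobi_error a b ?v M < e"
    using jacobi_error_le_poly[OF ab' v, of R M] R by (simp add: M_def)
  moreover have "jacobi_error a b ?v N = jacobi_error a b ?v M + (\<Sum>k\<in>{N<..M}. ?t k)"
  proof -
    have "{..M} = {..N} \<union> {N<..M}" by (auto simp: M_def)
    then have "(\<Sum>k\<le>M. ?t k) = (\<Sum>k\<le>N. ?t k) + (\<Sum>k\<in>{N<..M}. ?t k)"
      by (simp only: sum.union_disjoint[OF finite_atMost finite_greaterThanAtMost] ivl_disj_int)
    then show ?thesis unfolding jacobi_error_eq[OF ab' v] by simp
  qed
  ultimately show "jacobi_error a b ?v N \<le> B + e" using B[of M] by linarith
qed

section \<open>Decay of Jacobi coefficients of weakly differentiable functions\<close>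

lemma ac_deriv_AE_cong:
  assumes g: "ac_deriv g h" and l: "locally_integrable h'" and ae: "AE x in U01. h x = h' x"
  shows "ac_deriv g h'"
  unfolding ac_deriv_def
proof (intro conjI l allI impI)
  fix x y :: real assume xy: "0 < x \<and> x \<le> y \<and> y < 1"
  have "g y - g x = (LINT t:{x..y}|lebesgue. h t)" using ac_derivD(2)[OF g, of x y] xy by simp
  also have "\<dots> = (LINT t:{x..y}|lebesgue. h' t)"
    unfolding set_lebesgue_integral_def
  proof (rule integral_cong_AE)
    have "AE t in lebesgue. t \<in> {0<..<1} \<longrightarrow> h t = h' t" using ae by (simp add: AE_restrict_space_iff)
    then show "AE t in lebesgue. indicator {x..y} t *\<^sub>R h t = indicator {x..y} t *\<^sub>R h' t"
      by eventually_elim (use xy in \<open>auto simp: indicator_def\<close>)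
    have "set_integrable lebesgue {x..y} h" by (rule ac_derivD(1)[OF g]) (use xy in auto)
    then show "(\<lambda>t. indicator {x..y} t *\<^sub>R h t) \<in> borel_measurable lebesgue" by (auto simp: set_integrable_def)
    have "set_integrable lebesgue {x..y} h'" using l xy by (auto simp: locally_integrable_def)
    then show "(\<lambda>t. indicator {x..y} t *\<^sub>R h' t) \<in> borel_measurable lebesgue" by (auto simp: set_integrable_def)
  qed
  finally show "g y - g x = (LINT t:{x..y}|lebesgue. h' t)" .
qed

text \<open>A single chain of representatives: every member but the last is chosen absolutely continuous
  with the next one as its derivative.\<close>

lemma weak_deriv_chain:
  assumes h: "\<And>j. j \<le> m \<Longrightarrow> has_weak_deriv j v (h j)"
  obtains d where "\<And>j. j < m \<Longrightarrow> ac_deriv (d j) (d (Suc j))"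
    "\<And>j. j \<le> m \<Longrightarrow> AE x in U01. h j x = d j x" "\<And>j. j \<le> m \<Longrightarrow> locally_integrable (d j)"
proof -
  have "\<exists>G. ac_deriv G (h (Suc j)) \<and> (AE x in U01. h j x = G x)" if "j < m" for j
  proof -
    have "has_weak_deriv 1 (h j) (h (Suc j))"
      by (rule has_weak_deriv_step[OF h h]) (use that in auto)
    then show ?thesis using has_weak_deriv_AE_ac_deriv by blast
  qed
  then obtain G where G: "\<And>j. j < m \<Longrightarrow> ac_deriv (G j) (h (Suc j))" "\<And>j. j < m \<Longrightarrow> AE x in U01. h j x = G j x"
    by metis
  define d where "d j = (if j < m then G j else h j)" for j
  have ae: "AE x in U01. h j x = d j x" if "j \<le> m" for j
    using G(2)[of j] by (simp add: d_def)
  have li: "locally_integrable (d j)" if "j \<le> m" for j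
  proof (cases "j < m")
    case True
    then show ?thesis using locally_integrable_continuous[OF ac_deriv_continuous[OF G(1)]] by (simp add: d_def)
  next
    case False
    then show ?thesis using h[OF that] by (simp add: d_def has_weak_deriv_def)
  qed
  have "ac_deriv (d j) (d (Suc j))" if "j < m" for j
    using ac_deriv_AE_cong[OF G(1)[OF that] li ae] that by (simp add: d_def)
  then show ?thesis using that ae li by blast
qed

lemma locally_integrable_measurable:
  assumes "locally_integrable g" shows "g \<in> borel_measurable U01"
proof -
  let ?g = "\<lambda>n x. indicator {1 / (real n + 2)..1 - 1 / (real n + 2)} x *\<^sub>R g x"
  have m: "?g n \<in> borel_measurable U01" for n
  proof -
    have "1 - 1 / (real n + 2) < 1" "0 < 1 / (real n + 2)" by simp_all
    then have "set_integrable lebesgue {1 / (real n + 2)..1 - 1 / (real n + 2)} g"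
      using assms unfolding locally_integrable_def by blast
    then have "?g n \<in> borel_measurable lebesgue" unfolding set_integrable_def by (rule borel_measurable_integrable)
    then show ?thesis by (rule measurable_restrict_space1)
  qed
  show ?thesis
  proof (rule borel_measurable_LIMSEQ_metric[OF m])
    fix x assume "x \<in> space U01"
    then have x: "0 < x" "x < 1" by auto
    obtain N where N: "inverse (real (Suc N)) < min x (1 - x)"
      using reals_Archimedean[of "min x (1 - x)"] x by auto
    have "?g n x = g x" if "n \<ge> N" for n
    proof -
      have "1 / (real n + 2) \<le> inverse (real (Suc N))"
        using that by (simp add: field_simps)
      then have "1 / (real n + 2) < x" "1 / (real n + 2) < 1 - x" using N by auto
      then show ?thesis by (simp add: indicator_def)
    qed
    then have "eventually (\<lambda>n. ?g n x = g x) sequentially" unfolding eventually_sequentially by blast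
    then show "(\<lambda>n. ?g n x) \<longlonglongrightarrow> g x" by (rule tendsto_eventually)
  qed
qed

text \<open>Test functions that tend to 1. The support keeps the distance \<open>e\<close> from the end
  points and the transition from 0 to 1 has the scale \<open>e\<close>; the shift by 3 ensures
  \<open>e < 1 / 2\<close>.\<close>

definition cutoff :: "nat \<Rightarrow> real \<Rightarrow> real" where
  "cutoff n = (let e = 1 / (real n + 3) in bump_fun e e (1 - e))"

lemma test_function_cutoff: "test_function (cutoff n)"
  unfolding cutoff_def Let_def by (rule test_function_bump) auto

lemma cutoff_bounds: "0 \<le> cutoff n x" "cutoff n x \<le> 1"
proof -
  let ?e = "1 / (real n + 3)"
  have b: "0 \<le> bump_fun ?e ?e (1 - ?e) x \<and> bump_fun ?e ?e (1 - ?e) x \<le> indicator {?e..1 - ?e} x"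
    by (rule bump_fun_bounds) simp
  have i: "indicator {?e..1 - ?e} x \<le> (1::real)" by (simp add: indicator_def)
  show "0 \<le> cutoff n x" using b by (simp add: cutoff_def Let_def)
  show "cutoff n x \<le> 1" unfolding cutoff_def Let_def by (rule order.trans[OF conjunct2[OF b] i])
qed

lemma cutoff_margin_tendsto_0: "(\<lambda>n. 1 / (real n + 3)) \<longlonglongrightarrow> 0"
proof -
  have "(\<lambda>n. inverse (real (Suc (n + 2)))) \<longlonglongrightarrow> 0"
    using LIMSEQ_ignore_initial_segment[OF LIMSEQ_inverse_real_of_nat, of 2] by simp
  then show ?thesis by (simp add: inverse_eq_divide add_ac)
qed

lemma flat_shift_tendsto:
  assumes "0 < y"
  shows "(\<lambda>n. flat (1 / (real n + 3)) m (y - 1 / (real n + 3))) \<longlonglongrightarrow> 1 / y ^ m"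
proof -
  have "(\<lambda>n. exp (- (1 / (real n + 3)) / (y - 1 / (real n + 3))) / (y - 1 / (real n + 3)) ^ m)
      \<longlonglongrightarrow> exp (- 0 / (y - 0)) / (y - 0) ^ m"
    using assms by (intro tendsto_intros cutoff_margin_tendsto_0) auto
  moreover have "eventually (\<lambda>n. 1 / (real n + 3) < y) sequentially"
    using order_tendstoD(2)[OF cutoff_margin_tendsto_0 assms] .
  then have "eventually (\<lambda>n. exp (- (1 / (real n + 3)) / (y - 1 / (real n + 3))) / (y - 1 / (real n + 3)) ^ m
      = flat (1 / (real n + 3)) m (y - 1 / (real n + 3))) sequentially"
    by eventually_elim (simp add: flat_def)
  ultimately show ?thesis by (simp add: Lim_transform_eventually)
qed

lemma cutoff_eq: "cutoff n x = flat (1 / (real n + 3)) 0 (x - 1 / (real n + 3)) * flat (1 / (real n + 3)) 0 ((1 - x) - 1 / (real n + 3))"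
  by (simp add: cutoff_def Let_def bump_fun_def algebra_simps)

lemma cutoff_tendsto:
  assumes "x \<in> {0<..<1}" shows "(\<lambda>n. cutoff n x) \<longlonglongrightarrow> 1"
  using tendsto_mult[OF flat_shift_tendsto[of x 0] flat_shift_tendsto[of "1 - x" 0]] assms
  by (simp add: cutoff_eq)

lemma deriv_cutoff:
  fixes n :: nat
  defines "e \<equiv> 1 / (real n + 3)"
  shows "deriv (cutoff n) x = e * flat e 2 (x - e) * flat e 0 ((1 - x) - e) - e * flat e 0 (x - e) * flat e 2 ((1 - x) - e)"
proof -
  have e: "e > 0" by (simp add: e_def)
  have 1: "((\<lambda>x. flat e 0 (x - e)) has_real_derivative (e * flat e 2 (x - e)) * 1) (at x)"
    by (rule DERIV_chain2[OF DERIV_cong[OF flat_deriv[OF e, of 0]]]) (auto intro!: derivative_eq_intros simp: numeral_2_eq_2)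
  have 2: "((\<lambda>x. flat e 0 ((1 - x) - e)) has_real_derivative (e * flat e 2 ((1 - x) - e)) * (-1)) (at x)"
    by (rule DERIV_chain2[OF DERIV_cong[OF flat_deriv[OF e, of 0]]]) (auto intro!: derivative_eq_intros simp: numeral_2_eq_2)
  have "(cutoff n has_real_derivative
     (e * flat e 2 (x - e)) * 1 * flat e 0 ((1 - x) - e) + (e * flat e 2 ((1 - x) - e)) * (-1) * flat e 0 (x - e)) (at x)"
    unfolding cutoff_eq[abs_def] e_def[symmetric] by (rule DERIV_mult[OF 1 2])
  then have "deriv (cutoff n) x = (e * flat e 2 (x - e)) * 1 * flat e 0 ((1 - x) - e) + (e * flat e 2 ((1 - x) - e)) * (-1) * flat e 0 (x - e)"
    by (rule DERIV_imp_deriv)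
  then show ?thesis by simp
qed

lemma flat_0_bounds: "e > 0 \<Longrightarrow> 0 \<le> flat e 0 y \<and> flat e 0 y \<le> 1"
  by (auto simp: flat_def)

text \<open>With \<open>t = e / (y - e)\<close> the quantity is
  \<open>(t + t\<^sup>2) * exp (- t)\<close>, uniformly bounded in \<open>e\<close>.\<close>

lemma flat_2_bound:
  assumes e: "e > 0" shows "0 \<le> flat e 2 (y - e)" "0 < y \<Longrightarrow> y * (e * flat e 2 (y - e)) \<le> 3"
proof -
  show "0 \<le> flat e 2 (y - e)" by (simp add: flat_def)
  assume y: "0 < y"
  show "y * (e * flat e 2 (y - e)) \<le> 3"
  proof (cases "y > e")
    case True
    define t where "t = e / (y - e)"
    have t: "t > 0" using e True by (simp add: t_def)
    have "y * (e * flat e 2 (y - e)) = (t + t\<^sup>2) * exp (- t)"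
    proof -
      have "y / (y - e) = 1 + t" using True by (simp add: t_def field_simps)
      moreover have "y * (e * flat e 2 (y - e)) = (y / (y - e)) * t * exp (- t)"
        using True by (simp add: flat_def t_def power2_eq_square)
      ultimately show ?thesis by (simp add: algebra_simps power2_eq_square)
    qed
    also have "\<dots> = (t + t\<^sup>2) / exp t" by (simp add: exp_minus divide_inverse)
    also have "\<dots> \<le> 3"
    proof -
      have ex: "1 + t + t\<^sup>2 / 2 \<le> exp t" using t by (intro exp_lower_Taylor_quadratic) simp
      have "3 * (1 + t + t\<^sup>2 / 2) = (t + t\<^sup>2) + (3 + 2 * t + t\<^sup>2 / 2)" by (simp add: field_simps)
      moreover have "0 \<le> 3 + 2 * t + t\<^sup>2 / 2" using t by simp
      ultimately have "t + t\<^sup>2 \<le> 3 * (1 + t + t\<^sup>2 / 2)" by simp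
      also have "\<dots> \<le> 3 * exp t" using ex by simp
      finally have "t + t\<^sup>2 \<le> 3 * exp t" .
      then show ?thesis by (simp add: divide_le_eq)
    qed
    finally show ?thesis .
  qed (simp add: flat_def)
qed

text \<open>The bound is independent of \<open>n\<close>, so derivatives of cutoffs are dominated by the
  reciprocal of \<open>weight 1 1\<close>. This is precisely the factor that the raised weight in a
  Rodrigues step provides. Each of the two slopes contributes 3.\<close>

lemma deriv_cutoff_bound:
  assumes x: "x \<in> {0<..<1}" shows "\<bar>(1 - x) * x * deriv (cutoff n) x\<bar> \<le> 6"
proof -
  define e where "e = 1 / (real n + 3)"
  have e: "e > 0" by (simp add: e_def)
  define A B F G where "A = x * (e * flat e 2 (x - e))" and "B = (1 - x) * (e * flat e 2 ((1 - x) - e))"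
    and "F = flat e 0 (x - e)" and "G = flat e 0 ((1 - x) - e)"
  have A: "0 \<le> A" "A \<le> 3" unfolding A_def using flat_2_bound[OF e, of x] e x by auto
  have B: "0 \<le> B" "B \<le> 3" unfolding B_def using flat_2_bound[OF e, of "1 - x"] e x by auto
  have F: "0 \<le> F" "F \<le> 1" and G: "0 \<le> G" "G \<le> 1"
    unfolding F_def G_def using flat_0_bounds[OF e] by auto
  have "(1 - x) * x * deriv (cutoff n) x = (1 - x) * (A * G) - x * (B * F)"
    unfolding deriv_cutoff e_def[symmetric] A_def B_def F_def G_def by (simp add: algebra_simps)
  moreover have AG: "A * G \<le> 3 * 1" "B * F \<le> 3 * 1" using A B F G by (intro mult_mono; simp)+
  moreover have nn: "0 \<le> A * G" "0 \<le> B * F" using A B F G by (intro mult_nonneg_nonneg; simp)+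
  moreover have "(1 - x) * (A * G) \<le> 1 * 3" "x * (B * F) \<le> 1 * 3"
    using x AG nn by (intro mult_mono; simp)+
  moreover have "0 \<le> (1 - x) * (A * G)" "0 \<le> x * (B * F)" using x nn by simp_all
  ultimately show ?thesis by linarith
qed

lemma deriv_cutoff_tendsto:
  assumes x: "x \<in> {0<..<1}" shows "(\<lambda>n. deriv (cutoff n) x) \<longlonglongrightarrow> 0"
proof -
  have "(\<lambda>n. 1 / (real n + 3) * flat (1 / (real n + 3)) 2 (x - 1 / (real n + 3)) * flat (1 / (real n + 3)) 0 ((1 - x) - 1 / (real n + 3))
     - 1 / (real n + 3) * flat (1 / (real n + 3)) 0 (x - 1 / (real n + 3)) * flat (1 / (real n + 3)) 2 ((1 - x) - 1 / (real n + 3)))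
     \<longlonglongrightarrow> 0 * (1 / x ^ 2) * (1 / (1 - x) ^ 0) - 0 * (1 / x ^ 0) * (1 / (1 - x) ^ 2)"
    using x by (intro tendsto_diff tendsto_mult cutoff_margin_tendsto_0 flat_shift_tendsto) auto
  then show ?thesis by (simp add: deriv_cutoff)
qed

text \<open>Integration by parts when nothing is known about the boundary values of \<open>d\<close>.
  The product of \<open>d\<close> with the raised weight and the Jacobi polynomial is tested against
  cutoffs; the terms with derivatives of cutoffs tend to 0 by dominated convergence, the integrability
  of \<open>weight a b * d\<close> supplying the dominating function.\<close>

lemma rodrigues_ac_step:
  assumes ab: "a > -1" "b > -1" and d: "ac_deriv d d'"
    and i0: "integrable U01 (\<lambda>x. weight a b x * d x)"
    and i1: "integrable U01 (\<lambda>x. weight (a + 1) (b + 1) x * d' x)"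
  shows "(LINT x|U01. weight a b x * d x * jacobi_G (Suc n) a b x)
    = (LINT x|U01. weight (a + 1) (b + 1) x * d' x * jacobi_G n (a + 1) (b + 1) x) / (real n + 1)"
proof -
  define P where "P x = weight (a + 1) (b + 1) x * jacobi_G n (a + 1) (b + 1) x" for x
  define p where "p x = - (real n + 1) * (weight a b x * jacobi_G (Suc n) a b x)" for x
  have cw: "continuous_on {0<..<1} (weight A B)" for A B
    unfolding weight_def[abs_def] by (intro continuous_intros) auto
  have acP: "ac_deriv P p"
    unfolding P_def[abs_def] p_def[abs_def]
    by (rule ac_deriv_of_C1[OF rodrigues_step]) (assumption, intro continuous_intros cw continuous_jacobi_G)
  define \<phi> where "\<phi> x = d' x * P x + d x * p x" for x
  have ac: "ac_deriv (\<lambda>x. d x * P x) \<phi>" unfolding \<phi>_def[abs_def] by (rule ac_deriv_mult[OF d acP])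
  have bnd: "\<exists>C. \<forall>x\<in>{0..1}. \<bar>jacobi_G k A B x\<bar> \<le> C" for k A B
  proof -
    have "bounded (jacobi_G k A B ` {0..1})"
      by (intro compact_imp_bounded compact_continuous_image continuous_jacobi_G compact_Icc)
    then show ?thesis unfolding bounded_iff by simp
  qed
  have iG: "integrable U01 (\<lambda>x. f x * jacobi_G k A B x)" if f: "integrable U01 f" for f k A B
  proof -
    obtain C where C: "\<forall>x\<in>{0..1}. \<bar>jacobi_G k A B x\<bar> \<le> C" using bnd by blast
    have "integrable U01 (\<lambda>x. \<bar>f x\<bar>)" using f by simp
    then show ?thesis
    proof (rule integrable_U01_bound[of _ _ C])
      show "(\<lambda>x. f x * jacobi_G k A B x) \<in> borel_measurable U01"
        by (intro borel_measurable_times borel_measurable_integrable[OF f] continuous_measurable_U01 continuous_jacobi_G)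
      fix x :: real assume "x \<in> {0<..<1}"
      then have "\<bar>jacobi_G k A B x\<bar> \<le> C" using C by auto
      then show "\<bar>f x * jacobi_G k A B x\<bar> \<le> C * \<bar>f x\<bar>"
        using mult_left_mono[of "\<bar>jacobi_G k A B x\<bar>" C "\<bar>f x\<bar>"] by (simp add: abs_mult mult.commute)
    qed
  qed
  let ?f0 = "\<lambda>x. weight a b x * d x * jacobi_G (Suc n) a b x"
  let ?f1 = "\<lambda>x. weight (a + 1) (b + 1) x * d' x * jacobi_G n (a + 1) (b + 1) x"
  have I0: "integrable U01 ?f0" and I1: "integrable U01 ?f1" by (rule iG[OF i0], rule iG[OF i1])
  have \<phi>_eq: "\<phi> x = ?f1 x - (real n + 1) * ?f0 x" for x
    unfolding \<phi>_def P_def p_def by (simp add: algebra_simps)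
  have i\<phi>: "integrable U01 \<phi>" unfolding \<phi>_eq[abs_def]
    by (intro Bochner_Integration.integrable_diff I1 integrable_mult_right I0)
  have id0: "integrable U01 (\<lambda>x. weight a b x * d x * jacobi_G n (a + 1) (b + 1) x)" by (rule iG[OF i0])
  have cut: "(LINT x|U01. (d x * P x) * deriv (cutoff k) x) = - (LINT x|U01. \<phi> x * cutoff k x)" for k
    by (rule ac_deriv_test_function[OF ac test_function_cutoff])
  have tm: "f \<in> borel_measurable U01" if "test_function f" for f
    by (intro continuous_measurable_U01 test_function_continuous that)
  have L1: "(\<lambda>k. LINT x|U01. \<phi> x * cutoff k x) \<longlonglongrightarrow> (LINT x|U01. \<phi> x)"
  proof (rule integral_dominated_convergence[where w = "\<lambda>x. \<bar>\<phi> x\<bar>"])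
    show "\<phi> \<in> borel_measurable U01" using i\<phi> by simp
    show "(\<lambda>x. \<phi> x * cutoff k x) \<in> borel_measurable U01" for k
      by (intro borel_measurable_times borel_measurable_integrable[OF i\<phi>] tm test_function_cutoff)
    show "integrable U01 (\<lambda>x. \<bar>\<phi> x\<bar>)" using i\<phi> by simp
    show "AE x in U01. (\<lambda>k. \<phi> x * cutoff k x) \<longlonglongrightarrow> \<phi> x"
    proof (rule AE_U01_I)
      fix x :: real assume "x \<in> {0<..<1}"
      from tendsto_mult[OF tendsto_const[of "\<phi> x"] cutoff_tendsto[OF this]]
      show "(\<lambda>k. \<phi> x * cutoff k x) \<longlonglongrightarrow> \<phi> x" by simp
    qed
    show "AE x in U01. norm (\<phi> x * cutoff k x) \<le> \<bar>\<phi> x\<bar>" for k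
      using cutoff_bounds[of k] by (intro AE_I2) (simp add: abs_mult mult_left_le)
  qed
  have L0: "(\<lambda>k. LINT x|U01. (d x * P x) * deriv (cutoff k) x) \<longlonglongrightarrow> (LINT x|U01. 0)"
  proof (rule integral_dominated_convergence[where w = "\<lambda>x. 6 * \<bar>weight a b x * d x * jacobi_G n (a + 1) (b + 1) x\<bar>"])
    have dP: "(\<lambda>x. d x * P x) \<in> borel_measurable U01"
      by (intro continuous_measurable_U01 ac_deriv_continuous[OF ac])
    show "(\<lambda>x. (d x * P x) * deriv (cutoff k) x) \<in> borel_measurable U01" for k
      by (intro borel_measurable_times[OF dP] tm test_function_deriv(2)[OF test_function_cutoff])
    show "integrable U01 (\<lambda>x. 6 * \<bar>weight a b x * d x * jacobi_G n (a + 1) (b + 1) x\<bar>)"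
      by (intro integrable_mult_right integrable_abs id0)
    show "AE x in U01. (\<lambda>k. (d x * P x) * deriv (cutoff k) x) \<longlonglongrightarrow> 0"
    proof (rule AE_U01_I)
      fix x :: real assume "x \<in> {0<..<1}"
      from tendsto_mult[OF tendsto_const[of "d x * P x"] deriv_cutoff_tendsto[OF this]]
      show "(\<lambda>k. (d x * P x) * deriv (cutoff k) x) \<longlonglongrightarrow> 0" by simp
    qed
    show "AE x in U01. norm ((d x * P x) * deriv (cutoff k) x) \<le> 6 * \<bar>weight a b x * d x * jacobi_G n (a + 1) (b + 1) x\<bar>" for k
    proof (rule AE_U01_I)
      fix x :: real assume x: "x \<in> {0<..<1}"
      have "(d x * P x) * deriv (cutoff k) x
        = (weight a b x * d x * jacobi_G n (a + 1) (b + 1) x) * ((1 - x) * x * deriv (cutoff k) x)"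
        unfolding P_def weight_Suc[OF x] by (simp add: mult_ac)
      then have "norm ((d x * P x) * deriv (cutoff k) x)
        = \<bar>weight a b x * d x * jacobi_G n (a + 1) (b + 1) x\<bar> * \<bar>(1 - x) * x * deriv (cutoff k) x\<bar>"
        by (simp only: real_norm_def abs_mult)
      also have "\<dots> \<le> \<bar>weight a b x * d x * jacobi_G n (a + 1) (b + 1) x\<bar> * 6"
        by (intro mult_left_mono deriv_cutoff_bound x) simp
      finally show "norm ((d x * P x) * deriv (cutoff k) x) \<le> 6 * \<bar>weight a b x * d x * jacobi_G n (a + 1) (b + 1) x\<bar>" by simp
    qed
  qed simp
  have "(\<lambda>k. - (LINT x|U01. \<phi> x * cutoff k x)) \<longlonglongrightarrow> 0" using L0 unfolding cut by simp
  with tendsto_minus[OF L1] have "(LINT x|U01. \<phi> x) = 0"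
    using LIMSEQ_unique by fastforce
  moreover have "(LINT x|U01. \<phi> x) = (LINT x|U01. ?f1 x) - (real n + 1) * (LINT x|U01. ?f0 x)"
    unfolding \<phi>_eq by (simp only: Bochner_Integration.integral_diff[OF I1 integrable_mult_right[OF I0]] integral_mult_right_zero)
  ultimately show ?thesis by (simp add: field_simps)
qed

lemma rodrigues_ac_iterate:
  assumes ab: "a > -1" "b > -1" and d: "\<And>j. j < m \<Longrightarrow> ac_deriv (d j) (d (Suc j))"
    and i: "\<And>j. j \<le> m \<Longrightarrow> integrable U01 (\<lambda>x. weight (a + real j) (b + real j) x * d j x)"
    and n: "m \<le> n"
  shows "(LINT x|U01. weight a b x * d 0 x * jacobi_G n a b x)
    = (fact (n - m) / fact n) * (LINT x|U01. weight (a + real m) (b + real m) x * d m x * jacobi_G (n - m) (a + real m) (b + real m) x)"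
  using d i n
proof (induction m)
  case (Suc m)
  have k: "n - m = Suc (n - Suc m)" using Suc.prems(3) by simp
  have e: "a + real m + 1 = a + real (Suc m)" "b + real m + 1 = b + real (Suc m)" by simp_all
  have "(LINT x|U01. weight (a + real m) (b + real m) x * d m x * jacobi_G (Suc (n - Suc m)) (a + real m) (b + real m) x)
    = (LINT x|U01. weight (a + real m + 1) (b + real m + 1) x * d (Suc m) x * jacobi_G (n - Suc m) (a + real m + 1) (b + real m + 1) x) / (real (n - Suc m) + 1)"
  proof (rule rodrigues_ac_step)
    show "integrable U01 (\<lambda>x. weight (a + real m) (b + real m) x * d m x)" using Suc.prems(2)[of m] by simp
    show "integrable U01 (\<lambda>x. weight (a + real m + 1) (b + real m + 1) x * d (Suc m) x)"
      unfolding e by (rule Suc.prems(2)) simp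
  qed (use ab Suc.prems(1) in auto)
  then have step: "(LINT x|U01. weight (a + real m) (b + real m) x * d m x * jacobi_G (n - m) (a + real m) (b + real m) x)
    = (LINT x|U01. weight (a + real (Suc m)) (b + real (Suc m)) x * d (Suc m) x * jacobi_G (n - Suc m) (a + real (Suc m)) (b + real (Suc m)) x) / (real (n - Suc m) + 1)"
    by (simp only: k e)
  have f: "(fact (n - m) :: real) = (real (n - Suc m) + 1) * fact (n - Suc m)"
    unfolding k by (simp add: algebra_simps)
  have IH: "(LINT x|U01. weight a b x * d 0 x * jacobi_G n a b x)
    = (fact (n - m) / fact n) * (LINT x|U01. weight (a + real m) (b + real m) x * d m x * jacobi_G (n - m) (a + real m) (b + real m) x)"
    using Suc.prems by (intro Suc.IH) auto
  have "(c * g) / F * (X / c) = g / F * X" if "c \<noteq> 0" for c g F X :: real using that by simp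
  then show ?case unfolding IH step f by simp
qed simp

lemma fact_ratio_bound: "\<exists>C>0. \<forall>n\<ge>m. fact (n - m) * real n ^ m \<le> C * (fact n :: real)"
proof (induction m)
  case 0 show ?case by (intro exI[of _ 1]) auto
next
  case (Suc m)
  then obtain C where C: "C > 0" "\<And>n. n \<ge> m \<Longrightarrow> fact (n - m) * real n ^ m \<le> C * (fact n :: real)" by blast
  have "fact (n - Suc m) * real n ^ Suc m \<le> (C * (real m + 1)) * (fact n :: real)" if n: "n \<ge> Suc m" for n
  proof -
    have k: "n - m = Suc (n - Suc m)" using n by simp
    have f: "(fact (n - m) :: real) = real (n - m) * fact (n - Suc m)" unfolding k fact_Suc by simp
    have "real n \<le> (real m + 1) * real (n - m)"
    proof -
      have "n = m + (n - m)" using n by simp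
      moreover have "m * 1 \<le> m * (n - m)" using n by (intro mult_le_mono2) simp
      ultimately have "n \<le> (m + 1) * (n - m)" unfolding add_mult_distrib by linarith
      then have "real n \<le> real ((m + 1) * (n - m))" by (rule of_nat_mono)
      then show ?thesis by (simp only: of_nat_mult of_nat_add of_nat_1)
    qed
    then have "fact (n - Suc m) * real n ^ m * real n \<le> fact (n - Suc m) * real n ^ m * ((real m + 1) * real (n - m))"
      by (intro mult_left_mono) auto
    also have "\<dots> = (real m + 1) * (fact (n - m) * real n ^ m)" unfolding f by simp
    also have "\<dots> \<le> (real m + 1) * (C * fact n)" using C(2)[of n] n by (intro mult_left_mono) auto
    finally show ?thesis by (simp add: mult_ac)
  qed
  then show ?case using C(1) by (intro exI[of _ "C * (real m + 1)"]) auto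
qed

lemma falling_product_bound:
  fixes a b :: real
  assumes ab: "a > -1" "b > -1" "a + b \<ge> -1" and "m \<le> n"
  shows "(\<Prod>i<n - m. 2 * real n + a + b - real i) * real n ^ m \<le> (\<Prod>i<n. 2 * real n + a + b - real i)"
  using assms(4)
proof (induction m)
  case (Suc m)
  let ?P = "\<lambda>k. \<Prod>i<k. 2 * real n + a + b - real i"
  have k: "n - m = Suc (n - Suc m)" using Suc.prems by simp
  have P: "?P (n - m) = ?P (n - Suc m) * (2 * real n + a + b - real (n - Suc m))" unfolding k by simp
  have "?P (n - Suc m) \<ge> 0"
  proof (rule prod_nonneg)
    fix i assume "i \<in> {..<n - Suc m}"
    then have "real i + 1 \<le> real n" by auto
    then show "0 \<le> 2 * real n + a + b - real i" using ab by simp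
  qed
  moreover have "real n \<le> 2 * real n + a + b - real (n - Suc m)" using ab Suc.prems by (simp add: of_nat_diff)
  ultimately have "?P (n - Suc m) * real n \<le> ?P (n - m)" unfolding P by (intro mult_left_mono)
  then have "?P (n - Suc m) * real n * real n ^ m \<le> ?P (n - m) * real n ^ m" by (intro mult_right_mono) auto
  also have "\<dots> \<le> ?P n" using Suc by simp
  finally show ?case by (simp add: mult_ac)
qed simp

text \<open>The two norms have the same Beta factor, so only binomials and factorials are to be
  compared. The bound says that \<open>m\<close> Rodrigues steps gain \<open>m\<close> powers of
  \<open>n\<close> in the normalized coefficients.\<close>

lemma jacobi_norm2_ratio_bound:
  fixes a b :: real
  assumes ab: "a > -1" "b > -1" "a + b \<ge> -1"
  shows "\<exists>C>0. \<forall>n\<ge>m. jacobi_norm2 (n - m) (a + real m) (b + real m) * (fact (n - m) / fact n)\<^sup>2 * real n ^ (2 * m)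
     \<le> C * jacobi_norm2 n a b"
proof -
  obtain C where C: "C > 0" "\<And>n. n \<ge> m \<Longrightarrow> fact (n - m) * real n ^ m \<le> C * (fact n :: real)"
    using fact_ratio_bound[of m] by blast
  have "jacobi_norm2 (n - m) (a + real m) (b + real m) * (fact (n - m) / fact n)\<^sup>2 * real n ^ (2 * m)
     \<le> C * jacobi_norm2 n a b" if n: "n \<ge> m" for n
  proof -
    let ?X = "2 * real n + a + b"
    let ?P = "\<lambda>k. \<Prod>i<k. ?X - real i"
    define B where "B = Beta (b + real n + 1) (a + real n + 1)"
    have B: "B > 0" unfolding B_def using ab by (intro Beta_pos) auto
    have g: "?X gchoose k = ?P k / fact k" for k by (simp add: gbinomial_prod_rev atLeast0LessThan)
    have x: "2 * real (n - m) + (a + real m) + (b + real m) = ?X" using n by (simp add: of_nat_diff)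
    have y: "b + real m + real (n - m) + 1 = b + real n + 1" "a + real m + real (n - m) + 1 = a + real n + 1"
      using n by (simp_all add: of_nat_diff)
    have H: "jacobi_norm2 (n - m) (a + real m) (b + real m) = ?P (n - m) / fact (n - m) * B"
      unfolding jacobi_norm2_def x y g B_def ..
    have M: "jacobi_norm2 n a b = ?P n / fact n * B" unfolding jacobi_norm2_def g B_def ..
    have Pn: "?P n \<ge> 0"
    proof (rule prod_nonneg)
      fix i assume "i \<in> {..<n}"
      then have "real i + 1 \<le> real n" by auto
      then show "0 \<le> ?X - real i" using ab by simp
    qed
    have alg: "P / f1 * B * (f1 / f2)\<^sup>2 * (r * r) = ((P * r) * (f1 * r)) * (B / (f2 * f2))"
      if "f1 \<noteq> 0" "f2 \<noteq> 0" for P B f1 f2 r :: real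
      using that by (simp add: power2_eq_square)
    have "?P (n - m) / fact (n - m) * B * (fact (n - m) / fact n)\<^sup>2 * real n ^ (2 * m)
      = ((?P (n - m) * real n ^ m) * (fact (n - m) * real n ^ m)) * (B / (fact n * fact n))"
      unfolding mult_2 power_add by (rule alg) auto
    also have "\<dots> \<le> (?P n * (C * fact n)) * (B / (fact n * fact n))"
    proof (rule mult_right_mono)
      show "(?P (n - m) * real n ^ m) * (fact (n - m) * real n ^ m) \<le> ?P n * (C * fact n)"
        by (rule mult_mono[OF falling_product_bound[OF ab n] C(2)[OF n] Pn]) simp
    qed (use B in simp)
    also have "\<dots> = C * (?P n / fact n * B)" by simp
    finally show ?thesis unfolding H M .
  qed
  then show ?thesis using C(1) by blast
qed

section \<open>Regularity of the right-hand side\<close>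

lemma weight_antimono:
  assumes "x \<in> {0<..<1}" "a \<le> a'" "b \<le> b'" shows "weight a' b' x \<le> weight a b x"
  unfolding weight_def using assms by (intro mult_mono powr_mono') auto

text \<open>What the \<open>l\<close>-th member of a chain of derivatives must satisfy for the Rodrigues
  steps: integrability with the weight of every step from \<open>l\<close> on, and square integrability
  from \<open>l\<close> on, for Bessel's inequality after the last step. Step 0 is exempt from square
  integrability, because the primitive of \<open>f\<close> may just fail to be square integrable for
  \<open>weight a b\<close>. Demanding this for all later steps makes the condition monotone in
  \<open>l\<close> and thus compatible with the Leibniz rule.\<close>

definition admissible :: "real \<Rightarrow> real \<Rightarrow> nat \<Rightarrow> (real \<Rightarrow> real) \<Rightarrow> bool" where
  "admissible a b l F \<longleftrightarrow> F \<in> borel_measurable U01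
     \<and> (\<forall>j\<ge>l. integrable U01 (\<lambda>x. weight (a + real j) (b + real j) x * F x))
     \<and> (\<forall>j\<ge>max 1 l. F \<in> wL2 (a + real j) (b + real j))"

lemma admissible_mono: "admissible a b l F \<Longrightarrow> l \<le> l' \<Longrightarrow> admissible a b l' F"
  unfolding admissible_def by auto

lemma wL2_add: "v \<in> wL2 a b \<Longrightarrow> w \<in> wL2 a b \<Longrightarrow> (\<lambda>x. v x + w x) \<in> wL2 a b"
proof -
  assume v: "v \<in> wL2 a b" and w: "w \<in> wL2 a b"
  have "integrable U01 (\<lambda>x. (weight a b x * v x * v x + weight a b x * w x * w x) + 2 * (weight a b x * v x * w x))"
    by (intro Bochner_Integration.integrable_add integrable_mult_right wL2_mult_integrable v w)
  moreover have "(weight a b x * v x * v x + weight a b x * w x * w x) + 2 * (weight a b x * v x * w x)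
    = weight a b x * (v x + w x) * (v x + w x)" for x by (simp add: algebra_simps)
  moreover have "(\<lambda>x. v x + w x) \<in> borel_measurable U01" using v w by (auto simp: wL2_iff)
  ultimately show ?thesis by (simp only: wL2_iff)
qed

lemma admissible_add:
  assumes F: "admissible a b l F" and G: "admissible a b l G"
  shows "admissible a b l (\<lambda>x. F x + G x)"
proof -
  have "integrable U01 (\<lambda>x. weight (a + real j) (b + real j) x * (F x + G x))" if "j \<ge> l" for j
    using assms that unfolding admissible_def distrib_left by (intro Bochner_Integration.integrable_add) auto
  moreover have "(\<lambda>x. F x + G x) \<in> wL2 (a + real j) (b + real j)" if "j \<ge> max 1 l" for j
    using assms that unfolding admissible_def by (intro wL2_add) auto
  ultimately show ?thesis using assms unfolding admissible_def by auto
qed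

lemma admissible_bounded_mult:
  assumes F: "admissible a b l F" and k: "k \<in> borel_measurable U01" and C: "AE x in U01. \<bar>k x\<bar> \<le> C"
  shows "admissible a b l (\<lambda>x. k x * F x)"
proof -
  have Fm: "F \<in> borel_measurable U01" using F by (simp add: admissible_def)
  have kF: "(\<lambda>x. k x * F x) \<in> borel_measurable U01" by (intro borel_measurable_times k Fm)
  have 1: "integrable U01 (\<lambda>x. weight (a + real j) (b + real j) x * (k x * F x))" if "j \<ge> l" for j
  proof (rule Bochner_Integration.integrable_bound[of _ "\<lambda>x. C * (weight (a + real j) (b + real j) x * F x)"])
    show "integrable U01 (\<lambda>x. C * (weight (a + real j) (b + real j) x * F x))"
      using F that by (intro integrable_mult_right) (auto simp: admissible_def)
    show "(\<lambda>x. weight (a + real j) (b + real j) x * (k x * F x)) \<in> borel_measurable U01"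
      by (intro borel_measurable_times measurable_weight k Fm)
    show "AE x in U01. norm (weight (a + real j) (b + real j) x * (k x * F x)) \<le> norm (C * (weight (a + real j) (b + real j) x * F x))"
      using C
    proof eventually_elim
      case (elim x)
      have "\<bar>k x\<bar> * \<bar>weight (a + real j) (b + real j) x * F x\<bar> \<le> \<bar>C\<bar> * \<bar>weight (a + real j) (b + real j) x * F x\<bar>"
        using elim by (intro mult_right_mono) auto
      then show ?case by (simp add: abs_mult mult_ac)
    qed
  qed
  have 2: "(\<lambda>x. k x * F x) \<in> wL2 (a + real j) (b + real j)" if "j \<ge> max 1 l" for j
    unfolding wL2_iff
  proof (intro conjI kF)
    let ?w = "\<lambda>x. weight (a + real j) (b + real j) x"
    have "integrable U01 (\<lambda>x. ?w x * F x * F x)" using F that by (auto simp: admissible_def wL2_iff)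
    then have i: "integrable U01 (\<lambda>x. C\<^sup>2 * (?w x * F x * F x))" by (rule integrable_mult_right)
    show "integrable U01 (\<lambda>x. ?w x * (k x * F x) * (k x * F x))"
    proof (rule Bochner_Integration.integrable_bound[OF i])
      show "(\<lambda>x. ?w x * (k x * F x) * (k x * F x)) \<in> borel_measurable U01"
        by (intro borel_measurable_times measurable_weight k Fm)
      show "AE x in U01. norm (?w x * (k x * F x) * (k x * F x)) \<le> norm (C\<^sup>2 * (?w x * F x * F x))"
        using C
      proof eventually_elim
        case (elim x)
        have "(k x)\<^sup>2 \<le> C\<^sup>2" using elim by (metis abs_ge_zero order.trans power2_abs power_mono)
        then have le: "(k x)\<^sup>2 * (?w x * F x * F x) \<le> C\<^sup>2 * (?w x * F x * F x)"
          by (intro mult_right_mono) (simp_all add: mult.assoc weight_nonneg)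
        have n: "0 \<le> (k x)\<^sup>2 * (?w x * F x * F x)" "0 \<le> C\<^sup>2 * (?w x * F x * F x)"
          by (simp_all add: mult.assoc weight_nonneg)
        have e: "?w x * (k x * F x) * (k x * F x) = (k x)\<^sup>2 * (?w x * F x * F x)" by (simp add: power2_eq_square mult_ac)
        show ?case unfolding e real_norm_def abs_of_nonneg[OF n(1)] abs_of_nonneg[OF n(2)] by (rule le)
      qed
    qed
  qed
  show ?thesis unfolding admissible_def using kF 1 2 by blast
qed

lemma admissible_sum:
  assumes "finite I" "\<And>i. i \<in> I \<Longrightarrow> admissible a b l (F i)"
  shows "admissible a b l (\<lambda>x. \<Sum>i\<in>I. F i x)"
  using assms
proof (induction I rule: finite_induct)
  case empty
  show ?case by (simp add: admissible_def wL2_iff)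
next
  case (insert i I)
  then show ?case by (simp add: admissible_add)
qed

lemma admissible_of_growth:
  assumes ab: "a > -1" "b > -1" and F: "F \<in> borel_measurable U01"
    and C: "\<And>x. x \<in> {0<..<1} \<Longrightarrow> \<bar>F x\<bar> \<le> C * weight (- (a + 1) / 2) (- (b + 1) / 2) x"
  shows "admissible a b 0 F"
proof -
  have 1: "integrable U01 (\<lambda>x. weight (a + real j) (b + real j) x * F x)" for j
  proof (rule integrable_U01_bound[of "weight (a + real j + - (a + 1) / 2) (b + real j + - (b + 1) / 2)" _ C])
    show "integrable U01 (weight (a + real j + - (a + 1) / 2) (b + real j + - (b + 1) / 2))"
      using ab by (intro integrable_weight) (auto simp: field_simps)
    show "(\<lambda>x. weight (a + real j) (b + real j) x * F x) \<in> borel_measurable U01"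
      by (intro borel_measurable_times measurable_weight F)
    fix x :: real assume "x \<in> {0<..<1}"
    from mult_left_mono[OF C[OF this] weight_nonneg[of "a + real j" "b + real j" x]]
    show "\<bar>weight (a + real j) (b + real j) x * F x\<bar> \<le> C * weight (a + real j + - (a + 1) / 2) (b + real j + - (b + 1) / 2) x"
      unfolding weight_add by (simp add: abs_mult weight_nonneg mult_ac)
  qed
  have 2: "F \<in> wL2 (a + real j) (b + real j)" if "j \<ge> 1" for j
    unfolding wL2_iff
  proof (intro conjI F)
    show "integrable U01 (\<lambda>x. weight (a + real j) (b + real j) x * F x * F x)"
    proof (rule integrable_U01_bound[of "weight (a + real j + (- (a + 1) / 2 + - (a + 1) / 2)) (b + real j + (- (b + 1) / 2 + - (b + 1) / 2))" _ "C\<^sup>2"])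
      show "integrable U01 (weight (a + real j + (- (a + 1) / 2 + - (a + 1) / 2)) (b + real j + (- (b + 1) / 2 + - (b + 1) / 2)))"
        using that by (intro integrable_weight) (auto simp: field_simps)
      show "(\<lambda>x. weight (a + real j) (b + real j) x * F x * F x) \<in> borel_measurable U01"
        by (intro borel_measurable_times measurable_weight F)
      fix x :: real assume x: "x \<in> {0<..<1}"
      let ?g = "weight (- (a + 1) / 2) (- (b + 1) / 2) x"
      have "\<bar>F x\<bar> * \<bar>F x\<bar> \<le> (C * ?g) * (C * ?g)"
        using C[OF x] by (intro mult_mono) auto
      then have "weight (a + real j) (b + real j) x * (\<bar>F x\<bar> * \<bar>F x\<bar>) \<le> weight (a + real j) (b + real j) x * ((C * ?g) * (C * ?g))"
        by (intro mult_left_mono weight_nonneg)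
      then show "\<bar>weight (a + real j) (b + real j) x * F x * F x\<bar>
        \<le> C\<^sup>2 * weight (a + real j + (- (a + 1) / 2 + - (a + 1) / 2)) (b + real j + (- (b + 1) / 2 + - (b + 1) / 2)) x"
        unfolding weight_add by (simp add: abs_mult weight_nonneg power2_eq_square mult_ac)
    qed
  qed
  show ?thesis unfolding admissible_def using F 1 2 by simp
qed

lemma admissible_of_wL2:
  assumes ab: "a > -1" "b > -1" and l: "l \<ge> 1" and F: "F \<in> wL2 (a + real l) (b + real l)"
  shows "admissible a b l F"
proof -
  have Fm: "F \<in> borel_measurable U01" using F by (simp add: wL2_iff)
  have 2: "F \<in> wL2 (a + real j) (b + real j)" if "j \<ge> l" for j
    unfolding wL2_iff
  proof (intro conjI Fm)
    show "integrable U01 (\<lambda>x. weight (a + real j) (b + real j) x * F x * F x)"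
    proof (rule integrable_U01_bound[of "\<lambda>x. weight (a + real l) (b + real l) x * F x * F x" _ 1])
      show "integrable U01 (\<lambda>x. weight (a + real l) (b + real l) x * F x * F x)" using F by (simp add: wL2_iff)
      show "(\<lambda>x. weight (a + real j) (b + real j) x * F x * F x) \<in> borel_measurable U01"
        by (intro borel_measurable_times measurable_weight Fm)
      fix x :: real assume "x \<in> {0<..<1}"
      then have "weight (a + real j) (b + real j) x \<le> weight (a + real l) (b + real l) x"
        using that by (intro weight_antimono) auto
      from mult_right_mono[OF this, of "F x * F x"]
      show "\<bar>weight (a + real j) (b + real j) x * F x * F x\<bar> \<le> 1 * (weight (a + real l) (b + real l) x * F x * F x)"
        by (simp add: abs_mult weight_nonneg mult.assoc)
    qed
  qed
  have 1: "integrable U01 (\<lambda>x. weight (a + real j) (b + real j) x * F x)" if "j \<ge> l" for j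
  proof -
    have "(\<lambda>x. 1) \<in> wL2 (a + real j) (b + real j)" using ab by (intro continuous_in_wL2) auto
    from wL2_mult_integrable[OF 2[OF that] this] show ?thesis by simp
  qed
  show ?thesis unfolding admissible_def using Fm 1 2 l by auto
qed

lemma wL2_AE_cong:
  assumes "h \<in> wL2 a b" "AE x in U01. h x = d x" "d \<in> borel_measurable U01"
  shows "d \<in> wL2 a b"
  unfolding wL2_iff
proof (intro conjI assms(3))
  have "integrable U01 (\<lambda>x. weight a b x * h x * h x)" "h \<in> borel_measurable U01" using assms by (auto simp: wL2_iff)
  then show "integrable U01 (\<lambda>x. weight a b x * d x * d x)"
  proof (rule_tac Bochner_Integration.integrable_cong_AE[THEN iffD1, rotated 3])
    show "AE x in U01. weight a b x * h x * h x = weight a b x * d x * d x"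
      using assms(2) by eventually_elim simp
  qed (use assms(3) measurable_weight in auto)
qed

text \<open>The Cauchy-Schwarz inequality on the interval between \<open>1 / 2\<close> and
  \<open>x\<close>, in the form of a pointwise quadratic inequality. There the weight is at least a
  constant times its value at \<open>x\<close>.\<close>

lemma primitive_growth:
  assumes ab: "a > -1" "b > -1" and F: "ac_deriv F f" and f: "f \<in> wL2 (a + 1) (b + 1)"
  shows "\<exists>C. \<forall>x\<in>{0<..<1}. \<bar>F x\<bar> \<le> C * weight (- (a + 1) / 2) (- (b + 1) / 2) x"
proof -
  let ?W = "weight (a + 1) (b + 1)"
  define V where "V = (LINT x|U01. ?W x * f x * f x)"
  \<comment> \<open>Between \<open>1 / 2\<close> and \<open>x\<close> one factor of the weight is
    monotone in the favourable direction and the other is at least a power of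
    \<open>1 / 2\<close>.\<close>
  define c where "c = (1 / 2 :: real) powr (a + 1 + (b + 1))"
  have c: "c > 0" by (simp add: c_def)
  have iV: "integrable U01 (\<lambda>x. ?W x * f x * f x)" and fm: "f \<in> borel_measurable U01" using f by (auto simp: wL2_iff)
  have V0: "V \<ge> 0" unfolding V_def by (intro integral_nonneg_AE AE_I2) (simp add: mult.assoc weight_nonneg)
  have half: "(1 / 2 :: real) powr t \<le> 1" if "t > 0" for t using that by (intro powr_le1) auto
  have cW: "c * ?W x \<le> ?W t" if x: "x \<in> {0<..<1}" and t: "1 / 2 \<le> t \<and> t \<le> x \<or> x \<le> t \<and> t \<le> 1 / 2" for x t
  proof -
    have cc: "c = (1 / 2) powr (a + 1) * (1 / 2) powr (b + 1)" by (simp only: c_def powr_add)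
    have 1: "(1 / 2) powr (a + 1) * (1 - x) powr (a + 1) \<le> (1 - t) powr (a + 1)"
      using t
    proof
      assume t': "1 / 2 \<le> t \<and> t \<le> x"
      have "(1 / 2) powr (a + 1) * (1 - x) powr (a + 1) \<le> 1 * (1 - t) powr (a + 1)"
        using t' x ab half[of "a + 1"] by (intro mult_mono powr_mono2) auto
      then show ?thesis by simp
    next
      assume t': "x \<le> t \<and> t \<le> 1 / 2"
      have "(1 / 2) powr (a + 1) * (1 - x) powr (a + 1) \<le> (1 - t) powr (a + 1) * 1"
        using t' x ab by (intro mult_mono powr_mono2 powr_le1) auto
      then show ?thesis by simp
    qed
    have 2: "(1 / 2) powr (b + 1) * x powr (b + 1) \<le> t powr (b + 1)"
      using t
    proof
      assume t': "1 / 2 \<le> t \<and> t \<le> x"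
      have "(1 / 2) powr (b + 1) * x powr (b + 1) \<le> t powr (b + 1) * 1"
        using t' x ab by (intro mult_mono powr_mono2 powr_le1) auto
      then show ?thesis by simp
    next
      assume t': "x \<le> t \<and> t \<le> 1 / 2"
      have "(1 / 2) powr (b + 1) * x powr (b + 1) \<le> 1 * t powr (b + 1)"
        using t' x ab half[of "b + 1"] by (intro mult_mono powr_mono2) auto
      then show ?thesis by simp
    qed
    have "((1 / 2) powr (a + 1) * (1 - x) powr (a + 1)) * ((1 / 2) powr (b + 1) * x powr (b + 1))
      \<le> (1 - t) powr (a + 1) * t powr (b + 1)" by (intro mult_mono 1 2) auto
    then show ?thesis unfolding cc weight_def by (simp only: mult_ac)
  qed
  have key: "\<bar>LINT t:{y..z}|lebesgue. f t\<bar> \<le> (V / c + 1) * weight (- (a + 1) / 2) (- (b + 1) / 2) x"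
    if x: "x \<in> {0<..<1}" and yz: "0 < y" "z < 1" and t: "\<And>t. t \<in> {y..z} \<Longrightarrow> 1 / 2 \<le> t \<and> t \<le> x \<or> x \<le> t \<and> t \<le> 1 / 2" for x y z
  proof -
    define \<theta> where "\<theta> = weight ((a + 1) / 2) ((b + 1) / 2) x"
    have \<theta>: "\<theta> > 0" unfolding \<theta>_def by (rule weight_pos[OF x])
    have \<theta>2: "\<theta> * \<theta> = ?W x" unfolding \<theta>_def by (simp add: weight_add[symmetric])
    have inv: "weight (- (a + 1) / 2) (- (b + 1) / 2) x = 1 / \<theta>"
    proof -
      have e: "(a + 1) / 2 + - (a + 1) / 2 = 0" "(b + 1) / 2 + - (b + 1) / 2 = 0" by (simp_all add: field_simps)
      have "\<theta> * weight (- (a + 1) / 2) (- (b + 1) / 2) x = 1"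
        unfolding \<theta>_def weight_add[symmetric] e using x by (simp add: weight_def)
      then show ?thesis using \<theta> by (simp add: field_simps)
    qed
    let ?g = "\<lambda>t. (1 / (c * \<theta>)) * (?W t * f t * f t) + 1 / \<theta>"
    \<comment> \<open>The inequality of the arithmetic and geometric means, scaled by
      \<open>\<theta>\<close> so that both terms have the size of the claimed bound.\<close>
    have le: "\<bar>f t\<bar> \<le> ?g t" if "t \<in> {y..z}" for t
    proof -
      have w: "c * (\<theta> * \<theta>) \<le> ?W t" unfolding \<theta>2 by (rule cW[OF x t[OF that]])
      have "\<bar>f t\<bar> * \<theta> \<le> (f t * f t) * (\<theta> * \<theta>) + 1"
      proof -
        have "0 \<le> (\<bar>f t\<bar> * \<theta> - 1)\<^sup>2" by simp
        then have "2 * (\<bar>f t\<bar> * \<theta>) \<le> (\<bar>f t\<bar> * \<bar>f t\<bar>) * (\<theta> * \<theta>) + 1" by (simp add: power2_eq_square algebra_simps)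
        moreover have "0 \<le> \<bar>f t\<bar> * \<theta>" using \<theta> by simp
        ultimately show ?thesis by simp
      qed
      also have "(f t * f t) * (\<theta> * \<theta>) \<le> (?W t * f t * f t) / c"
        using mult_left_mono[OF w, of "f t * f t"] c by (simp add: field_simps)
      finally show ?thesis using \<theta> c by (simp add: field_simps)
    qed
    have iW: "set_integrable lebesgue {y..z} (\<lambda>t. ?W t * f t * f t)"
      by (rule set_integrable_subset[of _ "{0<..<1}"]) (use iV yz in \<open>auto simp: set_integrable_U01\<close>)
    have ig: "set_integrable lebesgue {y..z} ?g"
      by (intro set_integral_add(1) set_integrable_mult_right iW absolutely_integrable_continuous_real continuous_on_const)
    have i1: "set_integrable lebesgue {y..z} (\<lambda>t. (1 / (c * \<theta>)) * (?W t * f t * f t))"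
      by (intro set_integrable_mult_right iW)
    have i2: "set_integrable lebesgue {y..z} (\<lambda>t. 1 / \<theta>)"
      by (intro absolutely_integrable_continuous_real continuous_on_const)
    have fi: "set_integrable lebesgue {y..z} f" by (rule ac_derivD(1)[OF F yz])
    have q1: "(LINT t:{y..z}|lebesgue. ?W t * f t * f t) \<le> V"
      unfolding V_def set_integral_U01[symmetric] set_lebesgue_integral_def
    proof (rule integral_mono)
      show "integrable lebesgue (\<lambda>t. indicator {y..z} t *\<^sub>R (?W t * f t * f t))" using iW by (simp add: set_integrable_def)
      show "integrable lebesgue (\<lambda>t. indicator {0<..<1} t *\<^sub>R (?W t * f t * f t))" using iV by (simp add: set_integrable_U01[symmetric] set_integrable_def)
      show "indicator {y..z} t *\<^sub>R (?W t * f t * f t) \<le> indicator {0<..<1} t *\<^sub>R (?W t * f t * f t)" for t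
        using yz by (auto simp: indicator_def mult.assoc weight_nonneg)
    qed
    have q2: "(LINT t:{y..z}|lebesgue. 1 / \<theta>) \<le> 1 / \<theta>"
    proof -
      have "(LINT t:{y..z}|lebesgue. 1 / \<theta>) = measure lebesgue {y..z} * (1 / \<theta>)"
        by (simp add: set_lebesgue_integral_def)
      also have "\<dots> \<le> 1 * (1 / \<theta>)" using yz \<theta> by (intro mult_right_mono) (auto simp: measure_completion content_real_if)
      finally show ?thesis by simp
    qed
    have "\<bar>LINT t:{y..z}|lebesgue. f t\<bar> \<le> (LINT t:{y..z}|lebesgue. \<bar>f t\<bar>)"
      using set_integral_norm_bound[OF fi] by simp
    also have "\<dots> \<le> (LINT t:{y..z}|lebesgue. ?g t)"
      by (rule set_integral_mono[OF set_integrable_abs[OF fi] ig le])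
    also have "\<dots> = (LINT t:{y..z}|lebesgue. (1 / (c * \<theta>)) * (?W t * f t * f t)) + (LINT t:{y..z}|lebesgue. 1 / \<theta>)"
      by (rule set_integral_add(2)[OF i1 i2])
    also have "(LINT t:{y..z}|lebesgue. (1 / (c * \<theta>)) * (?W t * f t * f t)) = (1 / (c * \<theta>)) * (LINT t:{y..z}|lebesgue. ?W t * f t * f t)"
      by (rule set_integral_mult_right)
    also have "(1 / (c * \<theta>)) * (LINT t:{y..z}|lebesgue. ?W t * f t * f t) + (LINT t:{y..z}|lebesgue. 1 / \<theta>)
      \<le> (1 / (c * \<theta>)) * V + 1 / \<theta>"
      using c \<theta> by (intro add_mono mult_left_mono q1 q2) simp
    also have "\<dots> = (V / c + 1) * (1 / \<theta>)" using c \<theta> by (simp add: field_simps)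
    finally show ?thesis unfolding inv .
  qed
  have "\<bar>F x\<bar> \<le> (\<bar>F (1/2)\<bar> + (V / c + 1)) * weight (- (a + 1) / 2) (- (b + 1) / 2) x" if x: "x \<in> {0<..<1}" for x
  proof -
    let ?g = "weight (- (a + 1) / 2) (- (b + 1) / 2) x"
    have "weight 0 0 x \<le> ?g" using x ab by (intro weight_antimono) auto
    then have g1: "1 \<le> ?g" using x by (simp add: weight_def)
    have "\<bar>F x - F (1/2)\<bar> \<le> (V / c + 1) * ?g"
    proof (cases "1 / 2 \<le> x")
      case True
      then have "F x = F (1/2) + (LINT t:{1/2..x}|lebesgue. f t)" using x by (intro ac_derivD(2)[OF F]) auto
      then show ?thesis using key[OF x, of "1/2" x] x by auto
    next
      case False
      then have "F (1/2) = F x + (LINT t:{x..1/2}|lebesgue. f t)" using x by (intro ac_derivD(2)[OF F]) auto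
      then show ?thesis using key[OF x, of x "1/2"] x by auto
    qed
    moreover have "\<bar>F (1/2)\<bar> * 1 \<le> \<bar>F (1/2)\<bar> * ?g" by (intro mult_left_mono g1) simp
    ultimately show ?thesis by (simp add: algebra_simps)
  qed
  then show ?thesis by blast
qed

text \<open>The case distinction concerns the integrability of \<open>f\<close> at 0. If
  \<open>f\<close> is not integrable there, then all integrals from 0 to \<open>x\<close> have the
  default value 0 and the zero chain has the stated properties.\<close>

lemma primitive_chain:
  assumes ab: "a > -1" "b > -1" and f: "f \<in> wH s (a + 1) (b + 1)"
  obtains F where "\<And>j. j < s + 1 \<Longrightarrow> ac_deriv (F j) (F (Suc j))"
    and "\<And>x. x \<in> {0<..<1} \<Longrightarrow> F 0 x = (LINT y:{0<..<x}|lebesgue. f y)"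
    and "\<And>j. j \<le> s + 1 \<Longrightarrow> admissible a b j (F j)"
proof -
  have "\<forall>j. j \<le> s \<longrightarrow> (\<exists>h. has_weak_deriv j f h \<and> h \<in> wL2 (a + 1 + real j) (b + 1 + real j))"
    using f by (simp add: wH_def)
  then obtain h where h: "\<And>j. j \<le> s \<Longrightarrow> has_weak_deriv j f (h j)"
    and hL: "\<And>j. j \<le> s \<Longrightarrow> h j \<in> wL2 (a + 1 + real j) (b + 1 + real j)"
    by metis
  obtain d where d: "\<And>j. j < s \<Longrightarrow> ac_deriv (d j) (d (Suc j))"
    and ae: "\<And>j. j \<le> s \<Longrightarrow> AE x in U01. h j x = d j x" and li: "\<And>j. j \<le> s \<Longrightarrow> locally_integrable (d j)"
    using weak_deriv_chain[of s f h] h by blast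
  have dL: "d j \<in> wL2 (a + 1 + real j) (b + 1 + real j)" if "j \<le> s" for j
    by (rule wL2_AE_cong[OF hL ae locally_integrable_measurable[OF li]]) (use that in auto)
  have lif: "locally_integrable f" using h[of 0] by (simp add: has_weak_deriv_def)
  have "has_weak_deriv 0 f f" using lif by (simp add: has_weak_deriv_def)
  from has_weak_deriv_unique[OF this h[of 0]] have f0: "AE x in U01. f x = d 0 x"
    using ae[of 0] by (auto elim: AE_mp)
  let ?F0 = "\<lambda>x. LINT y:{0<..<x}|lebesgue. f y"
  have fL: "f \<in> wL2 (a + 1) (b + 1)"
  proof (rule wL2_AE_cong[of "d 0"])
    show "d 0 \<in> wL2 (a + 1) (b + 1)" using dL[of 0] by simp
    show "AE x in U01. d 0 x = f x" using f0 by eventually_elim simp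
  qed (rule locally_integrable_measurable[OF lif])
  have adm_d: "admissible a b (Suc j) (d j)" if "j \<le> s" for j
    using dL[OF that] by (intro admissible_of_wL2 ab) (simp_all add: add_ac)
  show ?thesis
  proof (cases "set_integrable lebesgue {0<..<1/2} f")
    case True
    have i0: "set_integrable lebesgue {0<..<x} f" if "0 < x" "x < 1" for x
    proof -
      have "set_integrable lebesgue {1/4..x} f" using lif that by (auto simp: locally_integrable_def)
      then have "set_integrable lebesgue ({0<..<1/2} \<union> {1/4..x}) f" by (intro set_integrable_Un True) auto
      then show ?thesis by (rule set_integrable_subset) (use that in auto)
    qed
    have "ac_deriv ?F0 f"
      unfolding ac_deriv_def
    proof (intro conjI lif allI impI)
      fix x y :: real assume xy: "0 < x \<and> x \<le> y \<and> y < 1"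
      have ixy: "set_integrable lebesgue {x..y} f" using lif xy by (auto simp: locally_integrable_def)
      have "(LINT t:{0<..<y}|lebesgue. f t) = (LINT t:({0<..<x} \<union> {x..y})|lebesgue. f t)"
        unfolding set_lebesgue_integral_def
      proof (rule integral_cong_AE)
        have "AE t in lebesgue. t \<noteq> y" by (auto intro!: AE_completion AE_lborel_singleton)
        then show "AE t in lebesgue. indicator {0<..<y} t *\<^sub>R f t = indicator ({0<..<x} \<union> {x..y}) t *\<^sub>R f t"
          by eventually_elim (use xy in \<open>auto simp: indicator_def\<close>)
        show "(\<lambda>t. indicator {0<..<y} t *\<^sub>R f t) \<in> borel_measurable lebesgue"
          using i0[of y] xy by (auto simp: set_integrable_def)
        have "set_integrable lebesgue ({0<..<x} \<union> {x..y}) f" by (intro set_integrable_Un i0 ixy) (use xy in auto)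
        then show "(\<lambda>t. indicator ({0<..<x} \<union> {x..y}) t *\<^sub>R f t) \<in> borel_measurable lebesgue"
          by (auto simp: set_integrable_def)
      qed
      also have "\<dots> = (LINT t:{0<..<x}|lebesgue. f t) + (LINT t:{x..y}|lebesgue. f t)"
        by (rule set_integral_Un[OF _ i0 ixy]) (use xy in auto)
      finally show "?F0 y - ?F0 x = (LINT t:{x..y}|lebesgue. f t)" by simp
    qed
    note acF = this
    define F where "F j = (case j of 0 \<Rightarrow> ?F0 | Suc k \<Rightarrow> d k)" for j
    show ?thesis
    proof (rule that[of F])
      show "ac_deriv (F j) (F (Suc j))" if "j < s + 1" for j
        using that ac_deriv_AE_cong[OF acF li[of 0] f0] d by (cases j) (auto simp: F_def)
      show "admissible a b j (F j)" if "j \<le> s + 1" for j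
      proof (cases j)
        case 0
        obtain C where "\<forall>x\<in>{0<..<1}. \<bar>?F0 x\<bar> \<le> C * weight (- (a + 1) / 2) (- (b + 1) / 2) x"
          using primitive_growth[OF ab acF fL] by blast
        then have "admissible a b 0 ?F0"
          by (intro admissible_of_growth[OF ab continuous_measurable_U01[OF ac_deriv_continuous[OF acF]]]) auto
        then show ?thesis by (simp add: F_def 0)
      next
        case (Suc k)
        then show ?thesis using adm_d[of k] that by (simp add: F_def)
      qed
    qed (simp add: F_def)
  next
    case False
    have z: "?F0 x = 0" if "x \<in> {0<..<1}" for x
    proof -
      have "\<not> set_integrable lebesgue {0<..<x} f"
      proof
        assume i: "set_integrable lebesgue {0<..<x} f"
        have "set_integrable lebesgue {x/2..1/2} f" using lif that by (auto simp: locally_integrable_def)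
        then have "set_integrable lebesgue ({0<..<x} \<union> {x/2..1/2}) f" by (intro set_integrable_Un i) auto
        then have "set_integrable lebesgue {0<..<1/2} f" by (rule set_integrable_subset) auto
        then show False using False by simp
      qed
      then show ?thesis unfolding set_lebesgue_integral_def set_integrable_def by (rule not_integrable_integral_eq)
    qed
    show ?thesis
    proof (rule that[of "\<lambda>j x. 0"])
      show "admissible a b j (\<lambda>x. 0)" for j by (simp add: admissible_def wL2_iff)
    qed (simp_all add: z ac_deriv_const)
  qed
qed

lemma sum_binomial_Suc:
  fixes X :: "nat \<Rightarrow> nat \<Rightarrow> real"
  shows "(\<Sum>i\<le>j. real (j choose i) * (X (Suc i) (j - i) + X i (Suc (j - i))))
    = (\<Sum>i\<le>Suc j. real (Suc j choose i) * X i (Suc j - i))"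
proof -
  have "(\<Sum>i\<le>Suc j. real (Suc j choose i) * X i (Suc j - i))
    = X 0 (Suc j) + (\<Sum>i\<le>j. real (Suc j choose Suc i) * X (Suc i) (j - i))"
    by (simp only: sum.atMost_Suc_shift) simp
  also have "(\<Sum>i\<le>j. real (Suc j choose Suc i) * X (Suc i) (j - i))
    = (\<Sum>i\<le>j. real (j choose i) * X (Suc i) (j - i)) + (\<Sum>i\<le>j. real (j choose Suc i) * X (Suc i) (j - i))"
    by (simp add: sum.distrib[symmetric] algebra_simps)
  also have "X 0 (Suc j) + ((\<Sum>i\<le>j. real (j choose i) * X (Suc i) (j - i)) + (\<Sum>i\<le>j. real (j choose Suc i) * X (Suc i) (j - i)))
    = (\<Sum>i\<le>j. real (j choose i) * X (Suc i) (j - i)) + (X 0 (Suc j) + (\<Sum>i\<le>j. real (j choose Suc i) * X (Suc i) (j - i)))"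
    by simp
  also have "X 0 (Suc j) + (\<Sum>i\<le>j. real (j choose Suc i) * X (Suc i) (j - i)) = (\<Sum>i\<le>Suc j. real (j choose i) * X i (Suc j - i))"
    by (simp only: sum.atMost_Suc_shift) simp
  also have "\<dots> = (\<Sum>i\<le>j. real (j choose i) * X i (Suc (j - i)))"
    by (simp add: Suc_diff_le)
  finally show ?thesis by (simp add: sum.distrib[symmetric] algebra_simps)
qed

text \<open>The Leibniz rule. In the term with \<open>i\<close> derivatives on the bounded factor, the
  other factor has the order \<open>j - i\<close> and is admissible at \<open>j\<close> by
  monotonicity.\<close>

lemma product_chain:
  assumes ab: "a > -1" "b > -1"
    and k: "\<And>j. j < m \<Longrightarrow> ac_deriv (k j) (k (Suc j))" and km: "\<And>j. j \<le> m \<Longrightarrow> k j \<in> borel_measurable U01"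
    and kb: "\<And>j. j \<le> m \<Longrightarrow> \<exists>C. AE x in U01. \<bar>k j x\<bar> \<le> C"
    and F: "\<And>j. j < m \<Longrightarrow> ac_deriv (F j) (F (Suc j))" and Fa: "\<And>j. j \<le> m \<Longrightarrow> admissible a b j (F j)"
  obtains e where "\<And>j. j < m \<Longrightarrow> ac_deriv (e j) (e (Suc j))" and "\<And>x. e 0 x = k 0 x * F 0 x"
    and "\<And>j. j \<le> m \<Longrightarrow> admissible a b j (e j)"
proof -
  define e where "e j x = (\<Sum>i\<le>j. real (j choose i) * (k i x * F (j - i) x))" for j x
  have "ac_deriv (e j) (e (Suc j))" if j: "j < m" for j
  proof -
    have "ac_deriv (\<lambda>x. \<Sum>i\<le>j. real (j choose i) * (k i x * F (j - i) x))
      (\<lambda>x. \<Sum>i\<le>j. real (j choose i) * (k (Suc i) x * F (j - i) x + k i x * F (Suc (j - i)) x))"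
      using j by (intro ac_deriv_sum ac_deriv_cmult ac_deriv_mult k F) auto
    then show ?thesis
      unfolding e_def[abs_def] sum_binomial_Suc[of j "\<lambda>i l. k i x * F l x" for x, symmetric] by simp
  qed
  moreover have "admissible a b j (e j)" if j: "j \<le> m" for j
    unfolding e_def[abs_def]
  proof (rule admissible_sum)
    fix i assume i: "i \<in> {..j}"
    obtain C where C: "AE x in U01. \<bar>k i x\<bar> \<le> C" using kb[of i] i j by auto
    have "AE x in U01. \<bar>real (j choose i) * k i x\<bar> \<le> real (j choose i) * C"
      using C by eventually_elim (simp add: abs_mult mult_left_mono)
    then have "admissible a b j (\<lambda>x. (real (j choose i) * k i x) * F (j - i) x)"
      using i j by (intro admissible_bounded_mult[OF admissible_mono[OF Fa]] borel_measurable_times km) auto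
    then show "admissible a b j (\<lambda>x. real (j choose i) * (k i x * F (j - i) x))" by (simp add: mult.assoc)
  qed simp
  ultimately show ?thesis by (intro that[of e]) (auto simp: e_def)
qed

lemma W_inf_chain:
  assumes v: "v \<in> W_inf m"
  obtains k where "\<And>j. j < m \<Longrightarrow> ac_deriv (k j) (k (Suc j))" "\<And>j. j \<le> m \<Longrightarrow> k j \<in> borel_measurable U01"
    "\<And>j. j \<le> m \<Longrightarrow> \<exists>C. AE x in U01. \<bar>k j x\<bar> \<le> C" "AE x in U01. v x = k 0 x"
proof -
  have "\<forall>j. j \<le> m \<longrightarrow> (\<exists>h. has_weak_deriv j v h \<and> Linf_norm h < \<infinity>)" using v by (simp add: W_inf_def)
  then obtain h where h: "\<And>j. j \<le> m \<Longrightarrow> has_weak_deriv j v (h j)" and hL: "\<And>j. j \<le> m \<Longrightarrow> Linf_norm (h j) < \<infinity>"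
    by metis
  obtain d where d: "\<And>j. j < m \<Longrightarrow> ac_deriv (d j) (d (Suc j))"
    and ae: "\<And>j. j \<le> m \<Longrightarrow> AE x in U01. h j x = d j x" and li: "\<And>j. j \<le> m \<Longrightarrow> locally_integrable (d j)"
    using weak_deriv_chain[of m v h] h by blast
  have "\<exists>C. AE x in U01. \<bar>d j x\<bar> \<le> C" if j: "j \<le> m" for j
  proof -
    have A: "AE x in U01. ereal \<bar>h j x\<bar> \<le> Linf_norm (h j)" unfolding Linf_norm_def by (rule esssup_AE)
    obtain C where C: "Linf_norm (h j) \<le> ereal C"
      using hL[OF j] by (cases "Linf_norm (h j)") auto
    have "AE x in U01. \<bar>d j x\<bar> \<le> C"
      using A ae[OF j]
    proof eventually_elim
      case (elim x)
      then have "ereal \<bar>d j x\<bar> \<le> ereal C" using C by (metis order.trans)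
      then show ?case by simp
    qed
    then show ?thesis by blast
  qed
  moreover have "AE x in U01. v x = d 0 x"
  proof -
    have "has_weak_deriv 0 v v" using h[of 0] by (simp add: has_weak_deriv_def)
    from has_weak_deriv_unique[OF this h[of 0]] ae[of 0] show ?thesis by (auto elim: AE_mp)
  qed
  ultimately show ?thesis using that d locally_integrable_measurable[OF li] by blast
qed

section \<open>The solution and the Riesz kernel\<close>

lemma continuous_AE_eq:
  assumes f: "continuous_on {0<..<1} f" and g: "continuous_on {0<..<1} g" and ae: "AE x in U01. f x = g x"
    and x: "x \<in> {0<..<1}"
  shows "f x = (g x :: real)"
proof (rule ccontr)
  assume ne: "f x \<noteq> g x"
  define S where "S = {0<..<1} \<inter> (\<lambda>x. f x - g x) -` (- {0})"
  have "open S" unfolding S_def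
    by (intro continuous_open_preimage continuous_on_diff f g) auto
  moreover have "x \<in> S" using ne x by (simp add: S_def)
  ultimately have nn: "\<not> negligible S" using open_not_negligible by blast
  have ae': "AE x in lebesgue. x \<in> {0<..<1} \<longrightarrow> f x = g x" using ae by (simp add: AE_restrict_space_iff)
  have Sm: "S \<in> sets lebesgue" using \<open>open S\<close> by auto
  have Se: "{x \<in> space lebesgue. \<not> (x \<in> {0<..<1} \<longrightarrow> f x = g x)} = S" by (auto simp: S_def)
  have "emeasure lebesgue S = 0" by (rule AE_iff_measurable[OF Sm Se, THEN iffD1, OF ae'])
  then have "S \<in> null_sets lebesgue" using Sm by (intro null_setsI)
  then have "negligible S" by (simp add: negligible_iff_null_sets)
  then show False using nn by simp
qed

lemma set_integrable_closed_U01: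
  fixes h :: "real \<Rightarrow> real"
  assumes "integrable U01 h"
  shows "set_integrable lebesgue {0..1} h"
proof -
  have "integrable lebesgue (\<lambda>x. indicator {0<..<1} x *\<^sub>R h x + (indicator {0} x * h 0 + indicator {1} x * h 1))"
  proof (intro Bochner_Integration.integrable_add integrable_mult_left)
    show "integrable lebesgue (\<lambda>x. indicator {0<..<1} x *\<^sub>R h x)"
      using assms by (simp add: set_integrable_U01[symmetric] set_integrable_def)
  qed (auto intro: integrable_real_indicator)
  moreover have "indicator {0<..<1} x *\<^sub>R h x + (indicator {0} x * h 0 + indicator {1} x * h 1) = indicator {0..1} x *\<^sub>R h x" for x
    by (auto simp: indicator_def)
  ultimately show ?thesis by (simp add: set_integrable_def)
qed

lemma set_integral_closed_U01:
  fixes f :: "real \<Rightarrow> real"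
  assumes "set_integrable lebesgue {0..1} f"
  shows "integrable U01 f" "(LINT x:{0..1}|lebesgue. f x) = (LINT x|U01. f x)"
proof -
  have "set_integrable lebesgue {0<..<1} f" using assms by (rule set_integrable_subset) auto
  then show i: "integrable U01 f" by (simp add: set_integrable_U01)
  have "(f has_integral (LINT x:{0..1}|lebesgue. f x)) {0..1}" by (rule has_integral_set_lebesgue[OF assms])
  from integral_U01_eqI[OF this i] show "(LINT x:{0..1}|lebesgue. f x) = (LINT x|U01. f x)" by simp
qed

text \<open>Weak differentiability determines \<open>u\<close> up to a constant inside the interval, and
  continuity up to the boundary extends this to the end points.\<close>

lemma solution_is_primitive:
  assumes u: "continuous_on {0..1} u" "u 0 = 0" and w: "has_weak_deriv 1 u h" and i: "integrable U01 h"
    and x: "x \<in> {0..1}"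
  shows "u x = (LINT t:{0..x}|lebesgue. h t)"
proof -
  obtain G where G: "ac_deriv G h" and ae: "AE x in U01. u x = G x"
    using has_weak_deriv_AE_ac_deriv[OF w] by blast
  have uG: "u y = G y" if "y \<in> {0<..<1}" for y
    by (rule continuous_AE_eq[OF continuous_on_subset[OF u(1)] ac_deriv_continuous[OF G] ae that]) auto
  define W where "W x = (LINT t:{0..x}|lebesgue. h t)" for x
  have h01: "set_integrable lebesgue {0..1} h" by (rule set_integrable_closed_U01[OF i])
  have W: "continuous_on {0..1} W"
    by (rule indefinite_integral_continuous[OF h01, of _ 0]) (simp add: W_def)
  have D: "W y - W z = u y - u z" if "0 < z" "z \<le> y" "y < 1" for y z
  proof -
    have "set_integrable lebesgue {0..y} h" by (rule set_integrable_sub_Icc[OF h01]) (use that in auto)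
    from set_integral_combine[OF this, of z] have "W y = W z + (LINT t:{z..y}|lebesgue. h t)"
      using that by (simp add: W_def)
    moreover have "G y = G z + (LINT t:{z..y}|lebesgue. h t)" by (rule ac_derivD(2)[OF G]) (use that in auto)
    ultimately show ?thesis using uG[of y] uG[of z] that by simp
  qed
  have const: "u y - W y = u (1/2) - W (1/2)" if "y \<in> {0<..<1}" for y
    using D[of y "1/2"] D[of "1/2" y] that by (cases "y \<le> 1/2") auto
  have cl: "closure {0<..<1::real} = {0..1}" by simp
  have const': "u y - W y = u (1/2) - W (1/2)" if "y \<in> {0..1}" for y
    by (rule continuous_constant_on_closure[of "{0<..<1}" "\<lambda>y. u y - W y"])
      (unfold cl, intro continuous_on_diff u W, rule const, assumption, rule that)
  have "W 0 = 0"
  proof -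
    have "W 0 = (LINT t:{0..0}|lebesgue. h t) + W 0"
      using set_integral_combine[OF set_integrable_sub_Icc[OF h01, of 0 0], of 0] by (simp add: W_def)
    moreover have "set_integrable lebesgue {0..0} h" by (rule set_integrable_sub_Icc[OF h01]) auto
    then have "(LINT t:{0..0}|lebesgue. h t) = integral {0..0} h" by (rule set_lebesgue_integral_eq_integral(2))
    ultimately show ?thesis by (simp add: W_def)
  qed
  then show ?thesis using const'[of 0] const'[OF x] u(2) by (simp add: W_def)
qed

lemma solution_integration_by_parts:
  assumes u: "\<And>x. x \<in> {0..1} \<Longrightarrow> u x = (LINT t:{0..x}|lebesgue. h t)" and i: "integrable U01 h"
    and u01: "u 0 = 0" "u 1 = 0"
  shows "(LINT x|U01. h x * poly P x) = - (LINT x|U01. u x * poly (pderiv P) x)"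
proof -
  have h01: "set_integrable lebesgue {0..1} h" by (rule set_integrable_closed_U01[OF i])
  have p01: "set_integrable lebesgue {0..1} (poly (pderiv P))"
    by (intro absolutely_integrable_continuous_real continuous_intros)
  have uc: "continuous_on {0..1} u"
    by (rule indefinite_integral_continuous[OF h01, of _ 0]) (simp add: u)
  have pP: "poly P t = poly P 0 + (LINT s:{0..t}|lebesgue. poly (pderiv P) s)" if t: "t \<in> {0..1}" for t
  proof -
    have "(poly (pderiv P) has_integral (poly P t - poly P 0)) {0..t}"
    proof (rule fundamental_theorem_of_calculus)
      fix y assume "y \<in> {0..t}"
      have "(poly P has_real_derivative poly (pderiv P) y) (at y within {0..t})"
        by (rule has_field_derivative_at_within[OF poly_DERIV])
      then show "(poly P has_vector_derivative poly (pderiv P) y) (at y within {0..t})"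
        by (simp only: has_real_derivative_iff_has_vector_derivative)
    qed (use t in auto)
    moreover have "set_integrable lebesgue {0..t} (poly (pderiv P))"
      by (intro absolutely_integrable_continuous_real continuous_intros)
    ultimately show ?thesis by (simp add: set_lebesgue_integral_eq_integral(2) integral_unique)
  qed
  have uu: "u t = u 0 + (LINT s:{0..t}|lebesgue. h s)" if "t \<in> {0..1}" for t using u[OF that] u01 by simp
  note ibp = integration_by_parts_ac[of 0 1 h "poly (pderiv P)" u "poly P", OF _ h01 p01 uu pP]
  have s1: "set_integrable lebesgue {0..1} (\<lambda>x. h x * poly P x)"
    by (rule set_integrable_cont_mult[OF h01]) (intro continuous_intros)
  have s2: "set_integrable lebesgue {0..1} (\<lambda>x. u x * poly (pderiv P) x)"
    by (intro absolutely_integrable_continuous_real continuous_on_mult uc continuous_intros)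
  have "0 = (LINT t:{0..1}|lebesgue. h t * poly P t + u t * poly (pderiv P) t)"
    using ibp(2) u01 by simp
  also have "\<dots> = (LINT t|U01. h t * poly P t) + (LINT t|U01. u t * poly (pderiv P) t)"
    unfolding set_integral_add(2)[OF s1 s2] set_integral_closed_U01(2)[OF s1] set_integral_closed_U01(2)[OF s2] ..
  finally show ?thesis by simp
qed

text \<open>The quotient that determines \<open>r\<close> is chosen so that both fractional integrals
  acquire the sines of the kernel. Splitting the integral at \<open>x\<close> requires integrability,
  because otherwise the default value 0 of the whole might differ from the sum of the parts.\<close>

lemma frac_op_riesz:
  fixes \<alpha> \<beta> r x :: real and u :: "real \<Rightarrow> real"
  defines "h \<equiv> weak_deriv 1 u" and "S \<equiv> sin (pi * (\<alpha> - \<beta>)) + sin (pi * \<beta>)"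
  assumes r: "r = sin (pi * \<beta>) / S" and S: "S \<noteq> 0" and x: "x \<in> {0<..<1}"
    and i: "integrable U01 (\<lambda>s. h s * riesz_kernel (\<alpha> - \<beta> - 1) (\<beta> - 1) x s)"
  shows "frac_op \<alpha> r u x = - (1 / (Gamma (2 - \<alpha>) * S)) * (LINT s|U01. h s * riesz_kernel (\<alpha> - \<beta> - 1) (\<beta> - 1) x s)"
proof -
  let ?k = "riesz_kernel (\<alpha> - \<beta> - 1) (\<beta> - 1) x"
  have m: "(\<lambda>s. h s * ?k s * indicator A s) \<in> borel_measurable U01" if "A \<in> sets borel" for A
  proof -
    have "(\<lambda>s. indicator A s :: real) \<in> borel_measurable U01" by (rule borel_measurable_U01) (use that in simp)
    then show ?thesis by (rule borel_measurable_times[OF borel_measurable_integrable[OF i]])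
  qed
  have iA: "integrable U01 (\<lambda>s. h s * ?k s * indicator A s)" if "A \<in> sets borel" for A
    by (rule Bochner_Integration.integrable_bound[OF i m[OF that]]) (auto simp: indicator_def)
  have L: "(LINT s|U01. h s * ?k s * indicator {..<x} s)
      = sin (pi * \<beta>) * (LINT s:{0<..<x}|lebesgue. h s * (x - s) powr (2 - \<alpha> - 1))"
  proof -
    have "(LINT s|U01. h s * ?k s * indicator {..<x} s)
      = (LINT s|U01. sin (pi * \<beta>) * (indicator {0<..<x} s *\<^sub>R (h s * (x - s) powr (2 - \<alpha> - 1))))"
      by (intro Bochner_Integration.integral_cong refl) (auto simp: indicator_def riesz_kernel_def)
    also have "\<dots> = sin (pi * \<beta>) * (LINT s|U01. indicator {0<..<x} s *\<^sub>R (h s * (x - s) powr (2 - \<alpha> - 1)))"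
      by (rule integral_mult_right_zero)
    also have "(LINT s|U01. indicator {0<..<x} s *\<^sub>R (h s * (x - s) powr (2 - \<alpha> - 1)))
      = (LINT s:{0<..<x}|lebesgue. h s * (x - s) powr (2 - \<alpha> - 1))"
      unfolding set_integral_U01[symmetric] set_lebesgue_integral_def using x
      by (intro Bochner_Integration.integral_cong refl) (auto simp: indicator_def)
    finally show ?thesis .
  qed
  have R: "(LINT s|U01. h s * ?k s * indicator {x<..} s)
      = sin (pi * (\<alpha> - \<beta>)) * (LINT s:{x<..<1}|lebesgue. h s * (s - x) powr (2 - \<alpha> - 1))"
  proof -
    have "(LINT s|U01. h s * ?k s * indicator {x<..} s)
      = (LINT s|U01. sin (pi * (\<alpha> - \<beta>)) * (indicator {x<..<1} s *\<^sub>R (h s * (s - x) powr (2 - \<alpha> - 1))))"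
      by (intro Bochner_Integration.integral_cong refl) (auto simp: indicator_def riesz_kernel_def)
    also have "\<dots> = sin (pi * (\<alpha> - \<beta>)) * (LINT s|U01. indicator {x<..<1} s *\<^sub>R (h s * (s - x) powr (2 - \<alpha> - 1)))"
      by (rule integral_mult_right_zero)
    also have "(LINT s|U01. indicator {x<..<1} s *\<^sub>R (h s * (s - x) powr (2 - \<alpha> - 1)))
      = (LINT s:{x<..<1}|lebesgue. h s * (s - x) powr (2 - \<alpha> - 1))"
      unfolding set_integral_U01[symmetric] set_lebesgue_integral_def using x
      by (intro Bochner_Integration.integral_cong refl) (auto simp: indicator_def)
    finally show ?thesis .
  qed
  have split: "h s * ?k s = h s * ?k s * indicator {..<x} s + h s * ?k s * indicator {x<..} s" for s
    by (auto simp: indicator_def riesz_kernel_def)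
  have "(LINT s|U01. h s * ?k s) = (LINT s|U01. h s * ?k s * indicator {..<x} s + h s * ?k s * indicator {x<..} s)"
    by (rule Bochner_Integration.integral_cong[OF refl split])
  also have "\<dots> = (LINT s|U01. h s * ?k s * indicator {..<x} s) + (LINT s|U01. h s * ?k s * indicator {x<..} s)"
    by (intro Bochner_Integration.integral_add iA) auto
  finally have T: "(LINT s|U01. h s * ?k s) = sin (pi * \<beta>) * (LINT s:{0<..<x}|lebesgue. h s * (x - s) powr (2 - \<alpha> - 1))
     + sin (pi * (\<alpha> - \<beta>)) * (LINT s:{x<..<1}|lebesgue. h s * (s - x) powr (2 - \<alpha> - 1))"
    unfolding L R .
  have r': "1 - r = sin (pi * (\<alpha> - \<beta>)) / S" unfolding r using S by (simp add: S_def field_simps)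
  have alg: "- (p / S * (1 / g * X) + q / S * (1 / g * Y)) = - (1 / (g * S)) * (p * X + q * Y)" for p q g X Y :: real
    by (simp add: add_divide_distrib algebra_simps)
  show ?thesis unfolding frac_op_def frac_int_left_def frac_int_right_def r' T h_def[symmetric]
    unfolding r by (rule alg)
qed

section \<open>Coefficients of the solution\<close>

text \<open>By induction; the step is Young's inequality for the exponents \<open>\<alpha> - 1\<close>
  and \<open>2 - \<alpha>\<close>, a weighted inequality of the arithmetic and geometric
  means.\<close>

lemma Gamma_ratio_lower_bound:
  fixes \<alpha> :: real assumes "1 < \<alpha>" "\<alpha> < 2"
  shows "Gamma \<alpha> * (real j + 1) powr (\<alpha> - 1) \<le> Gamma (real j + \<alpha>) / fact j"
proof (induction j)
  case 0 show ?case by simp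
next
  case (Suc j)
  let ?n = "real j + 1"
  have "(?n + 1) powr (\<alpha> - 1) * ?n powr (1 - (\<alpha> - 1)) \<le> (\<alpha> - 1) * (?n + 1) + (1 - (\<alpha> - 1)) * ?n"
    by (rule Youngs_inequality_0) (use assms in auto)
  also have "\<dots> = real j + \<alpha>" by (simp add: algebra_simps)
  also have "?n powr (1 - (\<alpha> - 1)) = ?n / ?n powr (\<alpha> - 1)" by (subst powr_diff) simp
  finally have Y: "(?n + 1) powr (\<alpha> - 1) * (?n / ?n powr (\<alpha> - 1)) \<le> real j + \<alpha>" .
  have "X * (n / Y) \<le> Z \<Longrightarrow> n > 0 \<Longrightarrow> Y > 0 \<Longrightarrow> X \<le> Z / n * Y" for X Y Z n :: real by (simp add: field_simps)
  from this[OF Y] have "(?n + 1) powr (\<alpha> - 1) \<le> (real j + \<alpha>) / ?n * ?n powr (\<alpha> - 1)" by simp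
  then have "Gamma \<alpha> * (?n + 1) powr (\<alpha> - 1) \<le> Gamma \<alpha> * ((real j + \<alpha>) / ?n * ?n powr (\<alpha> - 1))"
    using assms by (intro mult_left_mono) (auto intro: less_imp_le[OF Gamma_real_pos])
  also have "\<dots> = (real j + \<alpha>) / ?n * (Gamma \<alpha> * ?n powr (\<alpha> - 1))" by simp
  also have "\<dots> \<le> (real j + \<alpha>) / ?n * (Gamma (real j + \<alpha>) / fact j)"
    using assms Suc by (intro mult_left_mono) auto
  also have "\<dots> = Gamma (real (Suc j) + \<alpha>) / fact (Suc j)"
  proof -
    have "Gamma (real j + \<alpha> + 1) = (real j + \<alpha>) * Gamma (real j + \<alpha>)"
      using assms by (intro Gamma_plus1) (auto dest: nonpos_Ints_nonpos)
    moreover have "real (Suc j) + \<alpha> = real j + \<alpha> + 1" by simp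
    ultimately have G: "Gamma (real (Suc j) + \<alpha>) = (real j + \<alpha>) * Gamma (real j + \<alpha>)" by (simp only:)
    have f: "(fact (Suc j) :: real) = ?n * fact j" by (simp add: algebra_simps)
    show ?thesis unfolding G f by simp
  qed
  finally show ?case by (simp add: add_ac)
qed

locale spectral_problem =
  fixes \<alpha> \<beta> r K\<^sub>m K\<^sub>M A :: real and K f u :: "real \<Rightarrow> real" and s :: nat
  assumes \<alpha>: "1 < \<alpha>" "\<alpha> < 2" and \<beta>: "\<alpha> - 1 \<le> \<beta>" "\<beta> \<le> 1"
    and r: "r = sin (pi * \<beta>) / (sin (pi * (\<alpha> - \<beta>)) + sin (pi * \<beta>))"
    and Km: "0 < K\<^sub>m" and K: "\<And>x. x \<in> {0<..<1} \<Longrightarrow> K\<^sub>m \<le> K x \<and> K x \<le> K\<^sub>M"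
    and f: "f \<in> wH s \<beta> (\<alpha> - \<beta>)" and k: "(\<lambda>x. 1 / K x) \<in> W_inf (s + 1)"
    and sol: "is_solution \<alpha> \<beta> r K f u A"
begin

abbreviation "p \<equiv> \<alpha> - \<beta> - 1"
abbreviation "q \<equiv> \<beta> - 1"
abbreviation "S \<equiv> sin (pi * (\<alpha> - \<beta>)) + sin (pi * \<beta>)"
abbreviation "g \<equiv> (\<lambda>x. rhs1 K f x - A * rhs2 K x)"
abbreviation "\<delta> \<equiv> pi / (Gamma (2 - \<alpha>) * S)"

sublocale riesz_params p q
  by unfold_locales (use \<alpha> \<beta> in auto)

lemma S_pos: "S > 0"
proof -
  have "q + 1 = \<beta>" "p + 1 = \<alpha> - \<beta>" by simp_all
  then have 1: "0 \<le> sin (pi * \<beta>)" "0 \<le> sin (pi * (\<alpha> - \<beta>))" using sin_nonneg by (simp_all only:)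
  show ?thesis
  proof (cases "\<beta> < 1")
    case True
    then have "0 < sin (pi * \<beta>)" using \<alpha> \<beta> by (intro sin_gt_zero) auto
    then show ?thesis using 1 by simp
  next
    case False
    then have "0 < sin (pi * (\<alpha> - \<beta>))" using \<alpha> \<beta> by (intro sin_gt_zero) auto
    then show ?thesis using 1 by simp
  qed
qed

lemma solution_derivative:
  "has_weak_deriv 1 u (weak_deriv 1 u)" "integrable U01 (weak_deriv 1 u)"
proof -
  obtain h where h: "has_weak_deriv 1 u h" "set_integrable lebesgue {0<..<1} h"
    using sol unfolding is_solution_def by blast
  show w: "has_weak_deriv 1 u (weak_deriv 1 u)"
    using h(1) unfolding weak_deriv_def by (rule someI[of "has_weak_deriv 1 u"])
  have "locally_integrable (weak_deriv 1 u)" using w by (simp add: has_weak_deriv_def)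
  from integrable_cong_AE_imp[OF h(2)[unfolded set_integrable_U01] locally_integrable_measurable[OF this]
      has_weak_deriv_unique[OF h(1) w]]
  show "integrable U01 (weak_deriv 1 u)" .
qed

lemma KM_pos: "K\<^sub>M > 0" using K[of "1/2"] Km by simp

lemma rhs2_bounds: "x \<in> {0<..<1} \<Longrightarrow> 1 / K\<^sub>M \<le> 1 / K x \<and> 1 / K x \<le> 1 / K\<^sub>m"
  using K[of x] Km by (auto intro!: divide_left_mono mult_pos_pos)

text \<open>The Leibniz rule applied to \<open>1 / K\<close> and the primitive of \<open>f\<close>,
  shifted by the constant \<open>A\<close>. The shift affects only the member of order 0.\<close>

lemma rhs_chain:
  obtains e where "\<And>j. j < s + 1 \<Longrightarrow> ac_deriv (e j) (e (Suc j))" and "AE x in U01. g x = e 0 x"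
    and "\<And>j. j \<le> s + 1 \<Longrightarrow> admissible q p j (e j)"
    and "rhs1 K f \<in> borel_measurable U01" "rhs2 K \<in> borel_measurable U01"
    and "\<And>R. integrable U01 (\<lambda>x. weight q p x * rhs1 K f x * poly R x)"
    and "\<And>R. integrable U01 (\<lambda>x. weight q p x * rhs2 K x * poly R x)"
proof -
  have f': "f \<in> wH s (q + 1) (p + 1)" using f by simp
  obtain F where F: "\<And>j. j < s + 1 \<Longrightarrow> ac_deriv (F j) (F (Suc j))"
    and F0: "\<And>x. x \<in> {0<..<1} \<Longrightarrow> F 0 x = (LINT y:{0<..<x}|lebesgue. f y)"
    and Fa: "\<And>j. j \<le> s + 1 \<Longrightarrow> admissible q p j (F j)"
    using primitive_chain[OF q(1) p(1) f'] by blast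
  obtain k' where k': "\<And>j. j < s + 1 \<Longrightarrow> ac_deriv (k' j) (k' (Suc j))" "\<And>j. j \<le> s + 1 \<Longrightarrow> k' j \<in> borel_measurable U01"
    "\<And>j. j \<le> s + 1 \<Longrightarrow> \<exists>C. AE x in U01. \<bar>k' j x\<bar> \<le> C" "AE x in U01. 1 / K x = k' 0 x"
    using W_inf_chain[OF k] by blast
  have km: "(\<lambda>x. 1 / K x) \<in> borel_measurable U01"
    using k by (auto simp: W_inf_def has_weak_deriv_def intro: locally_integrable_measurable)
  have kb: "AE x in U01. \<bar>1 / K x\<bar> \<le> 1 / K\<^sub>m"
  proof (rule AE_U01_I)
    fix x :: real assume x: "x \<in> {0<..<1}"
    have "0 < 1 / K x" using K[OF x] Km by simp
    then show "\<bar>1 / K x\<bar> \<le> 1 / K\<^sub>m" using rhs2_bounds[OF x] by simp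
  qed
  \<comment> \<open>The chain of the primitive of \<open>f\<close> minus \<open>A\<close>; then
    \<open>g\<close> is \<open>1 / K\<close> times its first member.\<close>
  define G where "G j = (if j = 0 then (\<lambda>x. F 0 x + (- A)) else F j)" for j
  have G: "ac_deriv (G j) (G (Suc j))" if "j < s + 1" for j
    using F[OF that] ac_deriv_add[OF F[of 0] ac_deriv_const[of "- A"]] that by (cases j) (auto simp: G_def)
  have cadm: "admissible q p 0 (\<lambda>x. c)" for c :: real
    unfolding admissible_def
  proof (intro conjI allI impI)
    show "integrable U01 (\<lambda>x. weight (q + real j) (p + real j) x * c)" for j
      using p q by (intro integrable_weight_mult) auto
    show "(\<lambda>x. c) \<in> wL2 (q + real j) (p + real j)" for j
      using p q by (intro continuous_in_wL2) auto
  qed simp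
  have Ga: "admissible q p j (G j)" if "j \<le> s + 1" for j
    using Fa[OF that] admissible_add[OF Fa[of 0] cadm[of "- A"]] by (cases j) (auto simp: G_def)
  obtain e where e: "\<And>j. j < s + 1 \<Longrightarrow> ac_deriv (e j) (e (Suc j))" "\<And>x. e 0 x = k' 0 x * G 0 x"
    "\<And>j. j \<le> s + 1 \<Longrightarrow> admissible q p j (e j)"
    using product_chain[where k = k' and F = G, OF q(1) p(1) k'(1,2,3) G Ga] by blast
  have r1: "rhs1 K f x = 1 / K x * F 0 x" if "x \<in> {0<..<1}" for x
    by (simp add: rhs1_def F0[OF that])
  have g: "AE x in U01. g x = e 0 x"
  proof -
    have "AE x in U01. x \<in> {0<..<1}" by (rule AE_U01_I)
    then show ?thesis using k'(4)
    proof eventually_elim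
      case (elim x)
      have "g x = (1 / K x) * G 0 x" unfolding r1[OF elim(1)] by (simp add: rhs2_def G_def algebra_simps)
      then show ?case by (simp only: elim(2) e(2))
    qed
  qed
  have F0a: "admissible q p 0 (F 0)" using Fa[of 0] by simp
  have m1: "(\<lambda>x. 1 / K x * F 0 x) \<in> borel_measurable U01"
    using F0a by (intro borel_measurable_times km) (simp add: admissible_def)
  have m1': "rhs1 K f \<in> borel_measurable U01"
    using m1 by (subst measurable_cong[of _ _ "\<lambda>x. 1 / K x * F 0 x"]) (auto simp: r1)
  have m2: "rhs2 K \<in> borel_measurable U01" using km by (simp add: rhs2_def[abs_def])
  have Rb: "\<exists>C. AE x in U01. \<bar>poly R x\<bar> \<le> C" for R
  proof -
    obtain C where "\<forall>x\<in>{0..1}. \<bar>poly R x\<bar> \<le> C" using riesz_poly_integrable(2)[of "1/2" R] by auto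
    then show ?thesis by (intro exI[of _ C] AE_U01_I) auto
  qed
  have Rm: "poly R \<in> borel_measurable U01" for R by (intro continuous_measurable_U01 continuous_intros)
  have iadm: "integrable U01 (\<lambda>x. weight q p x * H x * poly R x)" if "admissible q p 0 H" for H R
  proof -
    obtain C where "AE x in U01. \<bar>poly R x\<bar> \<le> C" using Rb by blast
    from admissible_bounded_mult[OF that Rm this]
    have "integrable U01 (\<lambda>x. weight (q + real 0) (p + real 0) x * (poly R x * H x))" unfolding admissible_def by blast
    then show ?thesis by (simp add: mult_ac)
  qed
  have i1: "integrable U01 (\<lambda>x. weight q p x * rhs1 K f x * poly R x)" for R
  proof -
    have "integrable U01 (\<lambda>x. weight q p x * (1 / K x * F 0 x) * poly R x)"
      by (rule iadm[OF admissible_bounded_mult[OF F0a km kb]])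
    then show ?thesis by (subst Bochner_Integration.integrable_cong[OF refl]) (auto simp: r1)
  qed
  have i2: "integrable U01 (\<lambda>x. weight q p x * rhs2 K x * poly R x)" for R
    using iadm[OF admissible_bounded_mult[OF cadm[of 1] km kb], of R] by (simp add: rhs2_def)
  show ?thesis by (rule that[OF e(1) g e(3) m1' m2 i1 i2])
qed

lemma rhs_measurable: "rhs1 K f \<in> borel_measurable U01" "rhs2 K \<in> borel_measurable U01"
  by (rule rhs_chain; assumption)+

text \<open>The weak form of the equation with all operators moved onto the polynomial.\<close>

lemma solution_moment:
  "(LINT x|U01. weight q p x * poly R x * g x) = \<delta> * (LINT x|U01. u x * poly (pderiv (riesz_image p q R)) x)"
proof -
  let ?h = "weak_deriv 1 u"
  note F = riesz_Fubini[OF solution_derivative(2)]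
  have S0: "S \<noteq> 0" using S_pos by simp
  have uc: "continuous_on {0..1} u" "u 0 = 0" "u 1 = 0" using sol by (auto simp: is_solution_def)
  have up: "u x = (LINT t:{0..x}|lebesgue. ?h t)" if "x \<in> {0..1}" for x
    by (rule solution_is_primitive[OF uc(1,2) solution_derivative that])
  let ?c = "- (1 / (Gamma (2 - \<alpha>) * S))"
  let ?T = "\<lambda>x. LINT s|U01. ?h s * riesz_kernel p q x s"
  have eq: "AE x in U01. g x = ?c * ?T x"
  proof -
    have "AE x in U01. frac_op \<alpha> r u x = g x" using sol by (simp add: is_solution_def)
    moreover have "AE x in U01. x \<in> {0<..<1}" by (rule AE_U01_I)
    ultimately show ?thesis using F(3)
    proof eventually_elim
      case (elim x)
      have "frac_op \<alpha> r u x = ?c * ?T x" by (rule frac_op_riesz[OF r S0 elim(2,3)])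
      then show ?case using elim(1) by simp
    qed
  qed
  have "(LINT x|U01. weight q p x * poly R x * g x) = (LINT x|U01. ?c * (weight q p x * poly R x * ?T x))"
  proof (rule integral_cong_AE)
    show "AE x in U01. weight q p x * poly R x * g x = ?c * (weight q p x * poly R x * ?T x)"
      using eq by eventually_elim (simp only: mult.left_commute)
    have gm: "g \<in> borel_measurable U01"
      by (intro borel_measurable_diff borel_measurable_times borel_measurable_const rhs_measurable)
    show "(\<lambda>x. weight q p x * poly R x * g x) \<in> borel_measurable U01"
      by (rule borel_measurable_times[OF borel_measurable_times[OF measurable_weight continuous_measurable_U01] gm])
        (intro continuous_intros)
    show "(\<lambda>x. ?c * (weight q p x * poly R x * ?T x)) \<in> borel_measurable U01"
      by (rule borel_measurable_integrable[OF integrable_mult_right[OF F(1)]])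
  qed
  also have "\<dots> = ?c * (pi * (LINT x|U01. ?h x * poly (riesz_image p q R) x))"
    by (simp only: integral_mult_right_zero F(2))
  also have "(LINT x|U01. ?h x * poly (riesz_image p q R) x) = - (LINT x|U01. u x * poly (pderiv (riesz_image p q R)) x)"
    by (rule solution_integration_by_parts[of u ?h, OF up solution_derivative(2) uc(2,3)])
  also have "?c * (pi * - (LINT x|U01. u x * poly (pderiv (riesz_image p q R)) x))
     = \<delta> * (LINT x|U01. u x * poly (pderiv (riesz_image p q R)) x)" by simp
  finally show ?thesis .
qed

text \<open>The kernel maps constants to constants, whose derivative is 0. So the right-hand side has
  vanishing mean for \<open>weight q p\<close>, and this determines \<open>A\<close>.\<close>

lemma const_A_eq: "A = const_A \<alpha> \<beta> K f"
proof -
  obtain i: "integrable U01 (\<lambda>x. weight q p x * rhs1 K f x * poly 1 x)" "integrable U01 (\<lambda>x. weight q p x * rhs2 K x * poly 1 x)"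
    using rhs_chain by metis
  have "riesz_image p q 1 = 1" by (simp add: riesz_image_def)
  then have "0 = (LINT x|U01. weight q p x * poly 1 x * g x)" unfolding solution_moment by simp
  also have "\<dots> = (LINT x|U01. weight q p x * rhs1 K f x * poly 1 x - A * (weight q p x * rhs2 K x * poly 1 x))"
    by (simp add: algebra_simps)
  also have "\<dots> = wip q p (rhs1 K f) (\<lambda>_. 1) - A * wip q p (rhs2 K) (\<lambda>_. 1)"
    by (subst Bochner_Integration.integral_diff[OF i(1) integrable_mult_right[OF i(2)]]) (simp add: wip_U01)
  finally have e: "wip q p (rhs1 K f) (\<lambda>_. 1) = A * wip q p (rhs2 K) (\<lambda>_. 1)" by simp
  have "(LINT x|U01. 1 / K\<^sub>M * weight q p x) \<le> (LINT x|U01. weight q p x * rhs2 K x * 1)"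
  proof (rule integral_mono)
    show "integrable U01 (\<lambda>x. 1 / K\<^sub>M * weight q p x)" by (intro integrable_mult_right integrable_weight p q)
    show "integrable U01 (\<lambda>x. weight q p x * rhs2 K x * 1)" using i(2) by simp
    fix x assume "x \<in> space U01"
    then have "1 / K\<^sub>M \<le> 1 / K x" using rhs2_bounds[of x] by simp
    from mult_right_mono[OF this weight_nonneg[of q p x]]
    show "1 / K\<^sub>M * weight q p x \<le> weight q p x * rhs2 K x * 1" by (simp add: rhs2_def)
  qed
  moreover have "(LINT x|U01. 1 / K\<^sub>M * weight q p x) > 0"
  proof -
    have "(LINT x|U01. 1 / K\<^sub>M * weight q p x) = 1 / K\<^sub>M * Beta (p + 1) (q + 1)"
      by (simp only: integral_mult_right_zero integrable_weight(2)[OF q(1) p(1)])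
    moreover have "Beta (p + 1) (q + 1) > 0" using p q by (intro Beta_pos) auto
    ultimately show ?thesis using KM_pos by simp
  qed
  ultimately have "wip q p (rhs2 K) (\<lambda>_. 1) > 0" by (simp add: wip_U01)
  then show ?thesis unfolding const_A_def using e by (simp add: diff_diff_eq2 diff_diff_eq)
qed

abbreviation "\<omega> \<equiv> weight (\<alpha> - \<beta>) \<beta>"
abbreviation "v \<equiv> (\<lambda>x. u x / \<omega> x)"

lemma eigenval_bound: "\<exists>L>0. \<forall>j. L * (real j + 1) powr (\<alpha> - 1) \<le> \<bar>eigenval \<alpha> \<beta> j\<bar>"
proof -
  define L where "L = \<bar>sin (pi * \<alpha>) / S\<bar> * Gamma \<alpha>"
  have "sin (pi * \<alpha>) = - sin (pi * (\<alpha> - 1))" by (simp add: right_diff_distrib sin_diff)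
  moreover have "sin (pi * (\<alpha> - 1)) > 0" using \<alpha> by (intro sin_gt_zero) auto
  ultimately have "sin (pi * \<alpha>) \<noteq> 0" by simp
  then have L: "L > 0" unfolding L_def using S_pos \<alpha> by (intro mult_pos_pos Gamma_real_pos) auto
  have "L * (real j + 1) powr (\<alpha> - 1) \<le> \<bar>eigenval \<alpha> \<beta> j\<bar>" for j
  proof -
    have "L * (real j + 1) powr (\<alpha> - 1) = \<bar>sin (pi * \<alpha>) / S\<bar> * (Gamma \<alpha> * (real j + 1) powr (\<alpha> - 1))" by (simp add: L_def)
    also have "\<dots> \<le> \<bar>sin (pi * \<alpha>) / S\<bar> * (Gamma (real j + \<alpha>) / fact j)"
      by (intro mult_left_mono Gamma_ratio_lower_bound \<alpha>) simp
    also have "\<dots> = \<bar>eigenval \<alpha> \<beta> j\<bar>"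
    proof -
      have "Gamma (real j + \<alpha>) > 0" using \<alpha> by (intro Gamma_real_pos) auto
      then have "\<bar>Gamma (real j + \<alpha>) / fact j\<bar> = Gamma (real j + \<alpha>) / fact j" by simp
      then show ?thesis unfolding eigenval_def abs_mult by simp
    qed
    finally show ?thesis .
  qed
  then show ?thesis using L by blast
qed

text \<open>The ratio of the norms compensates for the factors from the differentiation of the Jacobi
  polynomial when the coefficients of \<open>u\<close> and of the right-hand side are compared.\<close>

lemma norm2_shift: "(real j + \<alpha>) * jacobi_norm2 j (\<alpha> - \<beta>) \<beta> = (real j + 1) * jacobi_norm2 (Suc j) q p"
proof -
  define B where "B = Beta (\<beta> + real j + 1) (\<alpha> - \<beta> + real j + 1)"
  have "jacobi_norm2 j (\<alpha> - \<beta>) \<beta> = ((2 * real j + \<alpha>) gchoose j) * B"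
    by (simp add: jacobi_norm2_def B_def algebra_simps)
  moreover have "jacobi_norm2 (Suc j) q p = ((2 * real j + \<alpha>) gchoose Suc j) * B"
  proof -
    have "2 * real (Suc j) + q + p = 2 * real j + \<alpha>" "p + real (Suc j) + 1 = \<alpha> - \<beta> + real j + 1"
      "q + real (Suc j) + 1 = \<beta> + real j + 1" by simp_all
    then show ?thesis unfolding jacobi_norm2_def B_def by (simp only: Beta_commute)
  qed
  moreover have "(2 * real j + \<alpha> - real j) * ((2 * real j + \<alpha>) gchoose j) = real (Suc j) * ((2 * real j + \<alpha>) gchoose Suc j)"
    by (rule gbinomial_step)
  ultimately show ?thesis by (simp add: algebra_simps)
qed

text \<open>The eigenvalue of the problem is that of the kernel, up to the constants of the operator and
  the factor \<open>j + 1\<close>. The reflection formula reconciles the two ways of writing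
  it.\<close>

lemma eigenval_eq:
  "eigenval \<alpha> \<beta> j = - \<delta> * (pochhammer (1 + p + q) (Suc j) / fact (Suc j)) * (real j + 1)"
proof -
  have pq: "1 + p + q = \<alpha> - 1" by simp
  have G: "Gamma (\<alpha> - 1) > 0" "Gamma (2 - \<alpha>) > 0" using \<alpha> by (intro Gamma_real_pos; simp)+
  have ni: "\<alpha> - 1 \<notin> \<int>\<^sub>\<le>\<^sub>0" using \<alpha> by (auto dest: nonpos_Ints_nonpos)
  have "pochhammer (\<alpha> - 1) (Suc j) = Gamma (\<alpha> - 1 + of_nat (Suc j)) / Gamma (\<alpha> - 1)"
    by (rule pochhammer_Gamma[OF ni])
  also have "\<alpha> - 1 + of_nat (Suc j) = real j + \<alpha>" by simp
  finally have P: "pochhammer (\<alpha> - 1) (Suc j) = Gamma (real j + \<alpha>) / Gamma (\<alpha> - 1)" .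
  have s0: "sin (pi * (\<alpha> - 1)) > 0" using \<alpha> by (intro sin_gt_zero) auto
  have "Gamma (\<alpha> - 1) * Gamma (1 - (\<alpha> - 1)) = pi / sin (pi * (\<alpha> - 1))" by (rule Gamma_reflection_real)
  moreover have "1 - (\<alpha> - 1) = 2 - \<alpha>" by simp
  ultimately have "Gamma (\<alpha> - 1) * Gamma (2 - \<alpha>) = pi / sin (pi * (\<alpha> - 1))" by (simp only:)
  then have R: "pi / (Gamma (2 - \<alpha>) * Gamma (\<alpha> - 1)) = sin (pi * (\<alpha> - 1))"
    using s0 G by (simp add: field_simps)
  have sn: "sin (pi * \<alpha>) = - sin (pi * (\<alpha> - 1))" by (simp add: right_diff_distrib sin_diff)
  have f: "(fact (Suc j) :: real) = (real j + 1) * fact j" by (simp add: algebra_simps)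
  have alg: "- (w / (a * T)) * (X / b / (n * y)) * n = - (w / (a * b)) / T * (X / y)" if "n \<noteq> 0" for w a T X b n y :: real
    using that by (simp add: field_simps)
  have "- \<delta> * (pochhammer (1 + p + q) (Suc j) / fact (Suc j)) * (real j + 1)
    = - (pi / (Gamma (2 - \<alpha>) * Gamma (\<alpha> - 1))) / S * (Gamma (real j + \<alpha>) / fact j)"
    unfolding pq P f by (rule alg) simp
  also have "\<dots> = eigenval \<alpha> \<beta> j" unfolding R eigenval_def sn by simp
  finally show ?thesis by simp
qed

lemma wnorm_jacobi: "(wnorm q p (jacobi_G n q p))\<^sup>2 = jacobi_norm2 n q p"
proof -
  have "wip q p (jacobi_G n q p) (jacobi_G n q p) = jacobi_norm2 n q p"
    using jacobi_norm2[OF q(1) p(1), of n] by (simp add: wip_U01 mult.assoc)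
  then show ?thesis unfolding wnorm_def using jacobi_norm2_pos[OF q(1) p(1), of n] by simp
qed

lemma sol_coeff_eq_moment:
  "sol_coeff \<alpha> \<beta> K f j = - (LINT x|U01. weight q p x * g x * jacobi_G (Suc j) q p x) / (jacobi_norm2 (Suc j) q p * eigenval \<alpha> \<beta> j)"
proof -
  let ?J = "jacobi_poly (Suc j) q p"
  obtain i: "integrable U01 (\<lambda>x. weight q p x * rhs1 K f x * poly ?J x)" "integrable U01 (\<lambda>x. weight q p x * rhs2 K x * poly ?J x)"
    using rhs_chain by metis
  have "(LINT x|U01. weight q p x * g x * poly ?J x)
    = (LINT x|U01. weight q p x * rhs1 K f x * poly ?J x - A * (weight q p x * rhs2 K x * poly ?J x))"
    by (simp add: algebra_simps)
  also have "\<dots> = wip q p (rhs1 K f) (jacobi_G (Suc j) q p) - A * wip q p (rhs2 K) (jacobi_G (Suc j) q p)"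
    by (subst Bochner_Integration.integral_diff[OF i(1) integrable_mult_right[OF i(2)]])
      (simp add: wip_U01 poly_jacobi_poly)
  finally have e: "(LINT x|U01. weight q p x * g x * jacobi_G (Suc j) q p x)
    = wip q p (rhs1 K f) (jacobi_G (Suc j) q p) - A * wip q p (rhs2 K) (jacobi_G (Suc j) q p)"
    by (simp only: poly_jacobi_poly)
  have M: "jacobi_norm2 (Suc j) q p \<noteq> 0" using jacobi_norm2_pos[OF q(1) p(1), of "Suc j"] by simp
  have pp: "\<alpha> - \<beta> - 1 = p" by simp
  have "(- (a / M) + A * (b / M)) / l = - (a - A * b) / (M * l)" if "M \<noteq> 0" for a b M l :: real
    using that by (simp add: field_simps)
  from this[OF M] show ?thesis
    unfolding e sol_coeff_def jacobi_coeff_def const_A_eq[symmetric] wnorm_jacobi Suc_eq_plus1[symmetric] .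
qed

text \<open>Testing the equation against the Jacobi polynomial of degree \<open>j + 1\<close> gives,
  after \<open>riesz_image_jacobi\<close> and differentiation, the integral of \<open>u\<close> against
  the one of degree \<open>j\<close> for \<open>\<omega>\<close>.\<close>

lemma sol_coeff_eq_fourier: "sol_coeff \<alpha> \<beta> K f j = fourier_jacobi (\<alpha> - \<beta>) \<beta> v j"
proof -
  let ?U = "LINT x|U01. u x * jacobi_G j (\<alpha> - \<beta>) \<beta> x"
  let ?\<kappa> = "pochhammer (1 + p + q) (Suc j) / fact (Suc j)"
  let ?N = "jacobi_norm2 j (\<alpha> - \<beta>) \<beta>" and ?M = "jacobi_norm2 (Suc j) q p" and ?l = "eigenval \<alpha> \<beta> j"
  have d: "pderiv (riesz_image p q (jacobi_poly (Suc j) q p))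
    = smult ?\<kappa> (smult (real j + \<alpha>) (jacobi_poly j (\<alpha> - \<beta>) \<beta>))"
  proof -
    have "real j + p + q + 2 = real j + \<alpha>" "p + 1 = \<alpha> - \<beta>" "q + 1 = \<beta>" by simp_all
    then show ?thesis unfolding riesz_image_jacobi pderiv_smult pderiv_jacobi_poly[OF p(1) q(1)] by (simp only:)
  qed
  have "(LINT x|U01. weight q p x * g x * jacobi_G (Suc j) q p x)
    = (LINT x|U01. weight q p x * poly (jacobi_poly (Suc j) q p) x * g x)"
    by (simp only: poly_jacobi_poly mult_ac)
  also have "\<dots> = \<delta> * (LINT x|U01. u x * poly (smult ?\<kappa> (smult (real j + \<alpha>) (jacobi_poly j (\<alpha> - \<beta>) \<beta>))) x)"
    unfolding solution_moment d ..
  also have "(LINT x|U01. u x * poly (smult ?\<kappa> (smult (real j + \<alpha>) (jacobi_poly j (\<alpha> - \<beta>) \<beta>))) x)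
    = (LINT x|U01. (?\<kappa> * (real j + \<alpha>)) * (u x * jacobi_G j (\<alpha> - \<beta>) \<beta> x))"
    by (simp only: poly_smult poly_jacobi_poly mult_ac)
  also have "\<dots> = (?\<kappa> * (real j + \<alpha>)) * ?U" by (rule integral_mult_right_zero)
  finally have I: "(LINT x|U01. weight q p x * g x * jacobi_G (Suc j) q p x) = \<delta> * ((?\<kappa> * (real j + \<alpha>)) * ?U)" .
  have F: "fourier_jacobi (\<alpha> - \<beta>) \<beta> v j = ?U / ?N"
  proof -
    have "(LINT x|U01. \<omega> x * v x * jacobi_G j (\<alpha> - \<beta>) \<beta> x) = ?U"
    proof (intro Bochner_Integration.integral_cong refl)
      fix x assume "x \<in> space U01"
      then have "\<omega> x > 0" by (intro weight_pos) simp
      then show "\<omega> x * v x * jacobi_G j (\<alpha> - \<beta>) \<beta> x = u x * jacobi_G j (\<alpha> - \<beta>) \<beta> x" by simp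
    qed
    then show ?thesis by (simp add: fourier_jacobi_def)
  qed
  have N: "?N > 0" using \<alpha> \<beta> by (intro jacobi_norm2_pos) auto
  have M: "?M > 0" by (rule jacobi_norm2_pos[OF q(1) p(1)])
  obtain L where L: "L > 0" "L * (real j + 1) powr (\<alpha> - 1) \<le> \<bar>?l\<bar>" using eigenval_bound by blast
  have "0 < L * (real j + 1) powr (\<alpha> - 1)" using L(1) by (intro mult_pos_pos) auto
  then have l: "?l \<noteq> 0" using L(2) by auto
  have "- \<delta> * ?\<kappa> * (real j + \<alpha>) * ?N = - \<delta> * ?\<kappa> * ((real j + \<alpha>) * ?N)" by simp
  also have "\<dots> = ?M * ?l" unfolding norm2_shift eigenval_eq by simp
  finally have key: "- \<delta> * ?\<kappa> * (real j + \<alpha>) * ?N = ?M * ?l" .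
  have alg: "- (d * ((k * t) * U)) / (M * l) = U / N" if "- d * k * t * N = M * l" "N > 0" "M > 0" "l \<noteq> 0" for d k t N M l U :: real
  proof -
    have "M * l = - (d * (k * t)) * N" using that(1) by simp
    moreover have "d * (k * t) \<noteq> 0" using calculation that by auto
    ultimately show ?thesis using that(2) by simp
  qed
  show ?thesis unfolding sol_coeff_eq_moment I F by (rule alg[OF key N M l])
qed

section \<open>The rate of convergence\<close>

lemma quotient_in_wL2: "v \<in> wL2 (\<alpha> - \<beta>) \<beta>"
proof -
  have u: "u \<in> wL2 (- (\<alpha> - \<beta>)) (- \<beta>)" using sol by (simp add: is_solution_def)
  have um: "u \<in> borel_measurable U01" and ui: "integrable U01 (\<lambda>x. weight (- (\<alpha> - \<beta>)) (- \<beta>) x * u x * u x)"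
    using u by (auto simp: wL2_iff)
  have vm: "v \<in> borel_measurable U01" by (intro borel_measurable_divide um measurable_weight)
  have "\<omega> x * v x * v x = weight (- (\<alpha> - \<beta>)) (- \<beta>) x * u x * u x" if "x \<in> space U01" for x
  proof -
    have w: "\<omega> x > 0" using that by (intro weight_pos) simp
    have "weight (- (\<alpha> - \<beta>)) (- \<beta>) x * \<omega> x = 1"
      using that unfolding weight_add[symmetric] by (simp add: weight_def)
    then have "weight (- (\<alpha> - \<beta>)) (- \<beta>) x = 1 / \<omega> x" using w by (simp add: field_simps)
    then show ?thesis using w by simp
  qed
  then have "integrable U01 (\<lambda>x. \<omega> x * v x * v x)" using ui by (subst Bochner_Integration.integrable_cong[OF refl]) auto
  with vm show ?thesis by (simp add: wL2_iff)
qed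

text \<open>Division by \<open>\<omega>\<close> turns the weight \<open>1 / \<omega>\<close> into
  \<open>\<omega>\<close>.\<close>

lemma wnorm_error:
  "wnorm (- (\<alpha> - \<beta>)) (- \<beta>) (\<lambda>x. u x - spectral_approx \<alpha> \<beta> K f N x) = sqrt (jacobi_error (\<alpha> - \<beta>) \<beta> v N)"
proof -
  have "weight (- (\<alpha> - \<beta>)) (- \<beta>) x * (u x - spectral_approx \<alpha> \<beta> K f N x) * (u x - spectral_approx \<alpha> \<beta> K f N x)
    = \<omega> x * (v x - (\<Sum>k\<le>N. fourier_jacobi (\<alpha> - \<beta>) \<beta> v k * jacobi_G k (\<alpha> - \<beta>) \<beta> x))\<^sup>2"
    if "x \<in> space U01" for x
  proof -
    have w: "\<omega> x > 0" using that by (intro weight_pos) simp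
    have "weight (- (\<alpha> - \<beta>)) (- \<beta>) x * \<omega> x = 1"
      using that unfolding weight_add[symmetric] by (simp add: weight_def)
    then have i: "weight (- (\<alpha> - \<beta>)) (- \<beta>) x = 1 / \<omega> x" using w by (simp add: field_simps)
    have e: "u x - spectral_approx \<alpha> \<beta> K f N x
      = \<omega> x * (v x - (\<Sum>k\<le>N. fourier_jacobi (\<alpha> - \<beta>) \<beta> v k * jacobi_G k (\<alpha> - \<beta>) \<beta> x))"
      unfolding spectral_approx_def sol_coeff_eq_fourier right_diff_distrib using w by simp
    show ?thesis unfolding e i using w by (simp add: power2_eq_square)
  qed
  then show ?thesis unfolding wnorm_def jacobi_error_def wip_U01
    by (subst Bochner_Integration.integral_cong[OF refl]) auto
qed

text \<open>The sequence \<open>t\<close> consists, up to a factor, of the squared normalized Jacobi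
  coefficients of the derivative of order \<open>s + 1\<close> of the right-hand side, which are
  summable by Bessel's inequality. The exponent is twice the sum of \<open>s + 1\<close> from the
  Rodrigues steps and \<open>\<alpha> - 1\<close> from the eigenvalue.\<close>

lemma coefficient_decay:
  "\<exists>Q t. Q \<ge> 0 \<and> (\<forall>k. 0 \<le> t k) \<and> (\<forall>M. (\<Sum>k\<le>M. t k) \<le> Q) \<and>
     (\<forall>j\<ge>s. (fourier_jacobi (\<alpha> - \<beta>) \<beta> v j)\<^sup>2 * jacobi_norm2 j (\<alpha> - \<beta>) \<beta>
        \<le> t (j - s) / (real j + 1) powr (2 * (\<alpha> + real s)))"
proof (rule rhs_chain)
  fix e assume e: "\<And>j. j < s + 1 \<Longrightarrow> ac_deriv (e j) (e (Suc j))" and ge: "AE x in U01. g x = e 0 x"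
    and ea: "\<And>j. j \<le> s + 1 \<Longrightarrow> admissible q p j (e j)"
  let ?m = "s + 1" and ?a = "q + real (s + 1)" and ?b = "p + real (s + 1)"
  have ab: "?a > -1" "?b > -1" using p q by auto
  have em: "e ?m \<in> wL2 ?a ?b" using ea[of ?m] unfolding admissible_def by auto
  have e0m: "e 0 \<in> borel_measurable U01" using ea[of 0] unfolding admissible_def by auto
  have ei: "integrable U01 (\<lambda>x. weight (q + real j) (p + real j) x * e j x)" if "j \<le> ?m" for j
    using ea[OF that] unfolding admissible_def by auto
  have gm: "g \<in> borel_measurable U01"
    by (intro borel_measurable_diff borel_measurable_times borel_measurable_const rhs_measurable)
  let ?D = "\<lambda>k. LINT x|U01. weight ?a ?b x * e ?m x * jacobi_G k ?a ?b x"
  let ?H = "\<lambda>k. jacobi_norm2 k ?a ?b"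
  have Hpos: "?H k > 0" for k by (rule jacobi_norm2_pos[OF ab])
  define t0 where "t0 k = (fourier_jacobi ?a ?b (e ?m) k)\<^sup>2 * ?H k" for k
  define Z where "Z = (LINT x|U01. weight ?a ?b x * e ?m x * e ?m x)"
  have t0: "t0 k \<ge> 0" for k unfolding t0_def using less_imp_le[OF Hpos] by (intro mult_nonneg_nonneg) auto
  have tZ: "(\<Sum>k\<le>M. t0 k) \<le> Z" for M unfolding t0_def Z_def by (rule bessel_jacobi[OF ab em])
  have Z: "Z \<ge> 0" using tZ[of 0] t0[of 0] by simp
  have "q + p \<ge> -1" using \<alpha> by simp
  then obtain C where C: "C > 0" "\<And>n. n \<ge> ?m \<Longrightarrow> jacobi_norm2 (n - ?m) (q + real ?m) (p + real ?m) * (fact (n - ?m) / fact n)\<^sup>2 * real n ^ (2 * ?m)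
     \<le> C * jacobi_norm2 n q p"
    using jacobi_norm2_ratio_bound[OF q(1) p(1), of ?m] by blast
  obtain L where L: "L > 0" "\<And>j. L * (real j + 1) powr (\<alpha> - 1) \<le> \<bar>eigenval \<alpha> \<beta> j\<bar>" using eigenval_bound by blast
  have bound: "(fourier_jacobi (\<alpha> - \<beta>) \<beta> v j)\<^sup>2 * jacobi_norm2 j (\<alpha> - \<beta>) \<beta>
        \<le> (C / L\<^sup>2 * t0 (j - s)) / (real j + 1) powr (2 * (\<alpha> + real s))" if j: "j \<ge> s" for j
  proof -
    let ?n = "Suc j"
    let ?N = "jacobi_norm2 j (\<alpha> - \<beta>) \<beta>" and ?M = "jacobi_norm2 ?n q p" and ?l = "eigenval \<alpha> \<beta> j"
    let ?\<rho> = "fact (?n - ?m) / fact ?n :: real"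
    have n: "?n \<ge> ?m" "?n - ?m = j - s" using j by auto
    have N: "?N > 0" using \<alpha> \<beta> by (intro jacobi_norm2_pos) auto
    have M: "?M > 0" by (rule jacobi_norm2_pos[OF q(1) p(1)])
    have NM: "?N \<le> ?M"
    proof -
      have "(real j + 1) * ?N \<le> (real j + \<alpha>) * ?N" using \<alpha> N by (intro mult_right_mono) auto
      then have "(real j + 1) * ?N \<le> (real j + 1) * ?M" by (simp only: norm2_shift)
      then show ?thesis by (rule mult_left_le_imp_le) simp
    qed
    have I: "(LINT x|U01. weight q p x * g x * jacobi_G ?n q p x) = ?\<rho> * ?D (j - s)"
    proof -
      have "(LINT x|U01. weight q p x * g x * jacobi_G ?n q p x) = (LINT x|U01. weight q p x * e 0 x * jacobi_G ?n q p x)"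
      proof (rule integral_cong_AE)
        have G: "jacobi_G ?n q p \<in> borel_measurable U01" by (intro continuous_measurable_U01 continuous_jacobi_G)
        show "(\<lambda>x. weight q p x * g x * jacobi_G ?n q p x) \<in> borel_measurable U01"
          by (intro borel_measurable_times[OF borel_measurable_times[OF measurable_weight gm] G])
        show "(\<lambda>x. weight q p x * e 0 x * jacobi_G ?n q p x) \<in> borel_measurable U01"
          by (intro borel_measurable_times[OF borel_measurable_times[OF measurable_weight e0m] G])
        show "AE x in U01. weight q p x * g x * jacobi_G ?n q p x = weight q p x * e 0 x * jacobi_G ?n q p x"
          using ge by eventually_elim (simp only:)
      qed
      also have "\<dots> = ?\<rho> * (LINT x|U01. weight ?a ?b x * e ?m x * jacobi_G (?n - ?m) ?a ?b x)"
        by (rule rodrigues_ac_iterate[OF q(1) p(1) e ei n(1)])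
      finally show ?thesis by (simp only: n(2))
    qed
    have c: "fourier_jacobi (\<alpha> - \<beta>) \<beta> v j = - (?\<rho> * ?D (j - s)) / (?M * ?l)"
      unfolding sol_coeff_eq_fourier[symmetric] sol_coeff_eq_moment I ..
    have H: "(?D (j - s))\<^sup>2 = t0 (j - s) * ?H (j - s)"
    proof -
      have "d\<^sup>2 = (d / h)\<^sup>2 * h * h" if "h \<noteq> 0" for d h :: real using that by (simp add: power2_eq_square)
      from this[of "?H (j - s)" "?D (j - s)"] show ?thesis
        using Hpos[of "j - s"] unfolding t0_def fourier_jacobi_def by simp
    qed
    define P where "P = (real j + 1) powr (\<alpha> - 1)"
    have P: "P > 0" by (simp add: P_def)
    have l: "L * P \<le> \<bar>?l\<bar>" unfolding P_def by (rule L(2))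
    have l2: "(L * P)\<^sup>2 \<le> ?l\<^sup>2"
      using power_mono[OF l, of 2] L(1) P by simp
    have lp: "0 < L * P" using L(1) P by simp
    have Cn: "?H (j - s) * ?\<rho>\<^sup>2 * real ?n ^ (2 * ?m) \<le> C * ?M"
      using C(2)[OF n(1)] by (simp only: n(2))
    let ?R = "real ?n ^ (2 * ?m)"
    have R: "?R > 0" by simp
    have l0: "?l\<^sup>2 > 0" using l2 zero_less_power[OF lp, of 2] by linarith
    have "(fourier_jacobi (\<alpha> - \<beta>) \<beta> v j)\<^sup>2 * ?N = (?\<rho>\<^sup>2 * (t0 (j - s) * ?H (j - s))) / (?M\<^sup>2 * ?l\<^sup>2) * ?N"
    proof -
      have "(- (a * d) / (b * l))\<^sup>2 = a\<^sup>2 * d\<^sup>2 / (b\<^sup>2 * l\<^sup>2)" for a b d l :: real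
        by (simp add: power_divide power_mult_distrib)
      then show ?thesis unfolding c by (simp only: H)
    qed
    also have "\<dots> \<le> (?\<rho>\<^sup>2 * (t0 (j - s) * ?H (j - s))) / (?M\<^sup>2 * ?l\<^sup>2) * ?M"
      using NM t0 less_imp_le[OF Hpos] by (intro mult_left_mono divide_nonneg_nonneg mult_nonneg_nonneg) auto
    also have "\<dots> = t0 (j - s) * (?H (j - s) * ?\<rho>\<^sup>2) / (?M * ?l\<^sup>2)"
    proof -
      have "a * (t * h) / (b\<^sup>2 * l) * b = t * (h * a) / (b * l)" if "b \<noteq> 0" for a t h b l :: real
        using that by (simp add: power2_eq_square)
      moreover have "?M \<noteq> 0" using M by simp
      ultimately show ?thesis .
    qed
    also have "\<dots> \<le> t0 (j - s) * (C * ?M / ?R) / (?M * ?l\<^sup>2)"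
    proof -
      have "?H (j - s) * ?\<rho>\<^sup>2 \<le> C * ?M / ?R" using Cn R by (simp only: pos_le_divide_eq)
      then show ?thesis using t0 M l0 by (intro divide_right_mono mult_left_mono) auto
    qed
    also have "\<dots> = (t0 (j - s) * C / ?R) / ?l\<^sup>2" using M by simp
    also have "\<dots> \<le> (t0 (j - s) * C / ?R) / (L * P)\<^sup>2"
    proof (rule divide_left_mono[OF l2])
      show "0 \<le> t0 (j - s) * C / ?R" using t0[of "j - s"] C(1) by simp
      show "0 < ?l\<^sup>2 * (L * P)\<^sup>2" by (rule mult_pos_pos[OF l0 zero_less_power[OF lp]])
    qed
    also have "\<dots> = (C / L\<^sup>2 * t0 (j - s)) / (?R * P\<^sup>2)"
    proof -
      have "t * C / R / (L * P)\<^sup>2 = (C / L\<^sup>2 * t) / (R * P\<^sup>2)" for t R :: real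
        by (simp add: power_mult_distrib mult_ac)
      then show ?thesis .
    qed
    also have "?R * P\<^sup>2 = (real j + 1) powr (2 * (\<alpha> + real s))"
    proof -
      have "?R = (real j + 1) powr (real (2 * ?m))" by (subst powr_realpow) (simp_all add: add.commute)
      moreover have "P\<^sup>2 = (real j + 1) powr (2 * (\<alpha> - 1))"
        unfolding P_def power2_eq_square powr_add[symmetric] by simp
      moreover have "real (2 * ?m) + 2 * (\<alpha> - 1) = 2 * (\<alpha> + real s)" by simp
      ultimately show ?thesis by (simp only: powr_add[symmetric])
    qed
    finally show ?thesis .
  qed
  have "0 \<le> C / L\<^sup>2" using C(1) by simp
  then have "(\<Sum>k\<le>M. C / L\<^sup>2 * t0 k) \<le> C / L\<^sup>2 * Z" for M
    unfolding sum_distrib_left[symmetric] by (intro mult_left_mono tZ)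
  then show ?thesis using bound t0 Z C(1)
    by (intro exI[of _ "C / L\<^sup>2 * Z"] exI[of _ "\<lambda>k. C / L\<^sup>2 * t0 k"]) auto
qed

text \<open>For \<open>N \<ge> s\<close> the tail is bounded by \<open>coefficient_decay\<close>. The
  finitely many smaller \<open>N\<close> are absorbed in the constant through the norm of the quotient
  \<open>u / \<omega>\<close>.\<close>

lemma error_decay: "\<exists>Q\<ge>0. \<forall>N. sqrt (jacobi_error (\<alpha> - \<beta>) \<beta> v N) \<le> Q / (real N + 1) powr (\<alpha> + real s)"
proof -
  let ?E = "jacobi_error (\<alpha> - \<beta>) \<beta> v"
  let ?t = "\<lambda>k. (fourier_jacobi (\<alpha> - \<beta>) \<beta> v k)\<^sup>2 * jacobi_norm2 k (\<alpha> - \<beta>) \<beta>"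
  let ?\<gamma> = "\<alpha> + real s"
  have ab: "\<alpha> - \<beta> > 0" "\<beta> > 0" and ab': "\<alpha> - \<beta> > -1" "\<beta> > -1" using \<alpha> \<beta> by auto
  have uc: "continuous_on {0..1} u" using sol by (simp add: is_solution_def)
  have tn: "?t k \<ge> 0" for k using less_imp_le[OF jacobi_norm2_pos[OF ab', of k]] by (intro mult_nonneg_nonneg) auto
  obtain Q t where Q: "Q \<ge> 0" "\<And>k. 0 \<le> t k" "\<And>M. (\<Sum>k\<le>M. t k) \<le> Q"
    and tt: "\<And>j. j \<ge> s \<Longrightarrow> ?t j \<le> t (j - s) / (real j + 1) powr (2 * ?\<gamma>)"
    using coefficient_decay by blast
  have large: "?E N \<le> Q / (real N + 1) powr (2 * ?\<gamma>)" if N: "N \<ge> s" for N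
  proof (rule jacobi_error_bound[OF ab uc quotient_in_wL2])
    fix M
    have "(\<Sum>k\<in>{N<..M}. ?t k) \<le> (\<Sum>k\<in>{N<..M}. t (k - s) / (real N + 1) powr (2 * ?\<gamma>))"
    proof (rule sum_mono)
      fix k assume k: "k \<in> {N<..M}"
      then have "?t k \<le> t (k - s) / (real k + 1) powr (2 * ?\<gamma>)" using N by (intro tt) auto
      also have "\<dots> \<le> t (k - s) / (real N + 1) powr (2 * ?\<gamma>)"
        using k \<alpha> Q(2) by (intro divide_left_mono powr_mono2 mult_pos_pos) auto
      finally show "?t k \<le> t (k - s) / (real N + 1) powr (2 * ?\<gamma>)" .
    qed
    also have "\<dots> = (\<Sum>k\<in>{N<..M}. t (k - s)) / (real N + 1) powr (2 * ?\<gamma>)" by (simp add: sum_divide_distrib)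
    also have "\<dots> \<le> Q / (real N + 1) powr (2 * ?\<gamma>)"
    proof (rule divide_right_mono)
      have "inj_on (\<lambda>k. k - s) {N<..M}" using N by (auto simp: inj_on_def)
      then have "(\<Sum>k\<in>{N<..M}. t (k - s)) = (\<Sum>k\<in>(\<lambda>k. k - s) ` {N<..M}. t k)" by (simp add: sum.reindex)
      also have "\<dots> \<le> (\<Sum>k\<le>M. t k)" by (intro sum_mono2 Q(2)) auto
      also have "\<dots> \<le> Q" by (rule Q(3))
      finally show "(\<Sum>k\<in>{N<..M}. t (k - s)) \<le> Q" .
    qed simp
    finally show "(\<Sum>k\<in>{N<..M}. ?t k) \<le> Q / (real N + 1) powr (2 * ?\<gamma>)" .
  qed
  define V where "V = (LINT x|U01. \<omega> x * v x * v x)"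
  have all: "?E N \<le> V" for N
    unfolding jacobi_error_eq[OF ab' quotient_in_wL2] V_def using sum_nonneg[of "{..N}" ?t] tn by simp
  have V: "V \<ge> 0" using all[of 0] jacobi_error_nonneg[of "\<alpha> - \<beta>" \<beta> v 0] by linarith
  \<comment> \<open>The second entry serves the indices below \<open>s\<close>, where only the trivial
    bound by the norm is used.\<close>
  define W where "W = max (sqrt Q) (sqrt V * (real s + 1) powr ?\<gamma>)"
  have "sqrt (?E N) \<le> W / (real N + 1) powr ?\<gamma>" for N
  proof (cases "N \<ge> s")
    case True
    have sq: "(real N + 1) powr (2 * ?\<gamma>) = ((real N + 1) powr ?\<gamma>)\<^sup>2"
      by (simp only: power2_eq_square powr_add[symmetric] mult_2)
    have "sqrt (?E N) \<le> sqrt (Q / ((real N + 1) powr ?\<gamma>)\<^sup>2)"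
      using large[OF True] by (simp only: sq real_sqrt_le_iff)
    also have "\<dots> = sqrt Q / (real N + 1) powr ?\<gamma>" by (simp add: real_sqrt_divide)
    also have "\<dots> \<le> W / (real N + 1) powr ?\<gamma>" by (intro divide_right_mono) (auto simp: W_def)
    finally show ?thesis .
  next
    case False
    have "(real N + 1) powr ?\<gamma> \<le> (real s + 1) powr ?\<gamma>" using False \<alpha> by (intro powr_mono2) auto
    then have "sqrt V * (real N + 1) powr ?\<gamma> \<le> W"
      using V mult_left_mono[of "(real N + 1) powr ?\<gamma>" "(real s + 1) powr ?\<gamma>" "sqrt V"] by (simp add: W_def)
    then have "sqrt V \<le> W / (real N + 1) powr ?\<gamma>" by (subst pos_le_divide_eq) auto
    then show ?thesis using all[of N] real_sqrt_le_mono order.trans by blast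
  qed
  moreover have "W \<ge> 0" using Q(1) by (simp add: W_def le_max_iff_disj)
  ultimately show ?thesis by blast
qed

text \<open>The chosen weak derivative of order 0 agrees with \<open>1 / K\<close> almost everywhere,
  so that its essential supremum is at least \<open>1 / K\<^sub>M\<close> and, being finite, it is not
  sent to 0 by \<open>real_of_ereal\<close>.\<close>

lemma W_inf_norm_pos: "W_inf_norm (s + 1) (\<lambda>x. 1 / K x) > 0"
proof -
  let ?k = "\<lambda>x. 1 / K x" and ?h = "weak_deriv 0 (\<lambda>x. 1 / K x)"
  obtain h where h: "has_weak_deriv 0 ?k h" "Linf_norm h < \<infinity>" using k by (auto simp: W_inf_def)
  have w: "has_weak_deriv 0 ?k ?h" using h(1) unfolding weak_deriv_def by (rule someI[of "has_weak_deriv 0 ?k"])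
  have kk: "has_weak_deriv 0 ?k ?k" using h(1) by (simp add: has_weak_deriv_def)
  have hm: "(\<lambda>x. ereal \<bar>?h x\<bar>) \<in> borel_measurable U01"
    using locally_integrable_measurable[of ?h] w by (simp add: has_weak_deriv_def)
  have "Linf_norm ?h \<le> Linf_norm h"
    unfolding Linf_norm_def[of ?h]
  proof (rule esssup_I[OF hm])
    have "AE x in U01. ereal \<bar>h x\<bar> \<le> Linf_norm h" unfolding Linf_norm_def by (rule esssup_AE)
    with has_weak_deriv_unique[OF w h(1)] show "AE x in U01. ereal \<bar>?h x\<bar> \<le> Linf_norm h"
      by eventually_elim simp
  qed
  then have fin: "Linf_norm ?h < \<infinity>" using h(2) by (rule order.strict_trans1)
  have lower: "ereal (1 / K\<^sub>M) \<le> Linf_norm ?h"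
  proof (rule ccontr)
    assume ne: "\<not> ereal (1 / K\<^sub>M) \<le> Linf_norm ?h"
    have "AE x in U01. ereal \<bar>?h x\<bar> \<le> Linf_norm ?h" unfolding Linf_norm_def by (rule esssup_AE)
    moreover have "AE x in U01. x \<in> {0<..<1}" by (rule AE_U01_I)
    ultimately have "AE x in U01. False" using has_weak_deriv_unique[OF kk w]
    proof eventually_elim
      case (elim x)
      have "1 / K\<^sub>M \<le> \<bar>?h x\<bar>" using rhs2_bounds[OF elim(2)] elim(3) abs_ge_self[of "?h x"] by linarith
      then have "ereal (1 / K\<^sub>M) \<le> ereal \<bar>?h x\<bar>" by simp
      then show ?case using elim(1) ne order.trans by blast
    qed
    then show False using U01_infinite by blast
  qed
  have "0 < real_of_ereal (Linf_norm ?h)"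
    using fin lower KM_pos by (cases "Linf_norm ?h") (auto intro: less_le_trans[of 0 "1 / K\<^sub>M"])
  also have "\<dots> \<le> W_inf_norm (s + 1) ?k"
    unfolding W_inf_norm_def by (intro Max_ge) auto
  finally show ?thesis .
qed

lemma spectral_error_estimate:
  "\<exists>C>0. \<forall>N::nat. wnorm (- (\<alpha> - \<beta>)) (- \<beta>) (\<lambda>x. u x - spectral_approx \<alpha> \<beta> K f N x)
     \<le> C * W_inf_norm (s + 1) (\<lambda>x. 1 / K x) / (real N + 1) powr (\<alpha> + real s) * (wH_norm s \<beta> (\<alpha> - \<beta>) f + 1)"
proof -
  obtain Q where Q: "Q \<ge> 0" "\<And>N. sqrt (jacobi_error (\<alpha> - \<beta>) \<beta> v N) \<le> Q / (real N + 1) powr (\<alpha> + real s)"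
    using error_decay by blast
  let ?W = "W_inf_norm (s + 1) (\<lambda>x. 1 / K x)"
  have W: "?W > 0" by (rule W_inf_norm_pos)
  have H: "wH_norm s \<beta> (\<alpha> - \<beta>) f \<ge> 0" by (simp add: wH_norm_def sum_nonneg)
  have "wnorm (- (\<alpha> - \<beta>)) (- \<beta>) (\<lambda>x. u x - spectral_approx \<alpha> \<beta> K f N x)
     \<le> (Q + 1) / ?W * ?W / (real N + 1) powr (\<alpha> + real s) * (wH_norm s \<beta> (\<alpha> - \<beta>) f + 1)" for N :: nat
  proof -
    have "Q / (real N + 1) powr (\<alpha> + real s) \<le> (Q + 1) / (real N + 1) powr (\<alpha> + real s)"
      by (intro divide_right_mono) auto
    also have "\<dots> = (Q + 1) / (real N + 1) powr (\<alpha> + real s) * 1" by simp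
    also have "\<dots> \<le> (Q + 1) / (real N + 1) powr (\<alpha> + real s) * (wH_norm s \<beta> (\<alpha> - \<beta>) f + 1)"
      using H Q(1) by (intro mult_left_mono) auto
    finally have "sqrt (jacobi_error (\<alpha> - \<beta>) \<beta> v N) \<le> (Q + 1) / (real N + 1) powr (\<alpha> + real s) * (wH_norm s \<beta> (\<alpha> - \<beta>) f + 1)"
      using Q(2)[of N] by linarith
    moreover have "(Q + 1) / ?W * ?W = Q + 1" using W by simp
    ultimately show ?thesis by (simp only: wnorm_error)
  qed
  moreover have "(Q + 1) / ?W > 0" using W Q(1) by simp
  ultimately show ?thesis by blast
qed

end

theorem theorem4p1:
  fixes \<alpha> \<beta> r K\<^sub>m K\<^sub>M A :: real and K f u :: "real \<Rightarrow> real" and s :: nat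
  assumes "1 < \<alpha>" "\<alpha> < 2"
    and "0 \<le> r" "r \<le> 1"
    and "\<alpha> - 1 \<le> \<beta>" "\<beta> \<le> 1"
    and "r = sin (pi * \<beta>) / (sin (pi * (\<alpha> - \<beta>)) + sin (pi * \<beta>))"
    and "0 < K\<^sub>m" "\<And>x. x \<in> {0<..<1} \<Longrightarrow> K\<^sub>m \<le> K x \<and> K x \<le> K\<^sub>M"
    and "f \<in> wH s \<beta> (\<alpha> - \<beta>)"
    and "(\<lambda>x. 1 / K x) \<in> W_inf (s + 1)"
    and "is_solution \<alpha> \<beta> r K f u A"
  shows "\<exists>C>0. \<forall>N::nat.
           wnorm (- (\<alpha> - \<beta>)) (- \<beta>) (\<lambda>x. u x - spectral_approx \<alpha> \<beta> K f N x)
           \<le> C * W_inf_norm (s + 1) (\<lambda>x. 1 / K x) / (real N + 1) powr (\<alpha> + real s)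
               * (wH_norm s \<beta> (\<alpha> - \<beta>) f + 1)"
proof -
  interpret spectral_problem \<alpha> \<beta> r "K\<^sub>m" "K\<^sub>M" A K f u s
    by unfold_locales (use assms in auto)
  show ?thesis by (rule spectral_error_estimate)
qed

end
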